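(* Let $s\in(0,1)$. There exist a sequence $\{h_k\}_{k\in\mathbb{N}}\subset L^2([-1,1])$ (where $k\ge1$) and constants $C,c>0$ such that the following holds. For every $k\in\mathbb{N}$ and any function $\tilde h_k$ with the property that (i) $\tilde h_k$ approximates $h_k$ in the sense that $$\|(1-x^2)^{-s}(h_k-\tilde h_k)\|_{L^2([-1,1])}\le k^{-1},$$ (ii) $\tilde h_k$ satisfies the equation $$(-\partial_{xx})^s\tilde h_k=0\ \text{in }[-1,1],\qquad \tilde h_k=\chi_{[2,3]}\tilde f_k\ \text{in }\mathbb{R}\setminus[-1,1]$$ for some $\tilde f_k\in L^2([2,3])$, the associated control function $\tilde f_k$ satisfies $$\|\tilde f_k\|_{L^2([2,3])}\ge C e^{ck}.$$
   Context: $(-\partial_{xx})^s$ is the fractional Laplacian on $\mathbb{R}$ (Fourier multiplier $|\xi|^{2s}$), and $\chi_{[2,3]}$ is the indicator function of $[2,3]$. For $\tilde f\in L^2([2,3])$, let $E_0\tilde f$ be its extension by zero to $\mathbb{R}$. The solution of the exterior value problem in (ii) with data $\tilde f$ is $E_0\tilde f+v$, where $v\in\widetilde{H}^s((-1,1))$ (the closure of $C_c^\infty((-1,1))$ in $H^s(\mathbb{R})$) is the unique weak solution of $(-\partial_{xx})^sv=-((-\partial_{xx})^sE_0\tilde f)|_{(-1,1)}$ in $(-1,1)$. The function $\tilde h_k$ in (ii) is this solution for the data $\tilde f_k$. *)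

theory Defs
  imports "HOL-Analysis.Analysis"
begin

definition L2_on :: "real set \<Rightarrow> (real \<Rightarrow> 'a::real_normed_vector) \<Rightarrow> bool" where
  "L2_on A f \<longleftrightarrow> f \<in> borel_measurable (lebesgue_on A) \<and>
     integrable (lebesgue_on A) (\<lambda>x. (norm (f x))\<^sup>2)"

text \<open>Only meaningful for functions satisfying \<^const>\<open>L2_on\<close>; otherwise the Bochner integral
  may default to 0.\<close>
definition L2_norm :: "real set \<Rightarrow> (real \<Rightarrow> 'a::real_normed_vector) \<Rightarrow> real" where
  "L2_norm A f = sqrt (LINT x|lebesgue_on A. (norm (f x))\<^sup>2)"

text \<open>Convention: \<open>\<integral> u(x) e\<^sup>-\<^sup>i\<^sup>x\<^sup>\<xi> dx\<close>, so that \<open>- d\<^sup>2/dx\<^sup>2\<close> has symbol \<open>\<xi>\<^sup>2\<close>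
  and Plancherel's identity carries a factor \<open>2 \<pi>\<close>.\<close>
definition fourier_integral :: "(real \<Rightarrow> real) \<Rightarrow> real \<Rightarrow> complex" where
  "fourier_integral u \<xi> = (LINT x|lebesgue. complex_of_real (u x) * cis (- (x * \<xi>)))"

text \<open>The Fourier transform on square-integrable functions is the \<open>L\<^sup>2\<close> limit of the Fourier
  integrals of the truncations to \<open>[-R, R]\<close>. It is determined up to null sets, and a
  representative is chosen.\<close>
definition is_fourier_L2 :: "(real \<Rightarrow> real) \<Rightarrow> (real \<Rightarrow> complex) \<Rightarrow> bool" where
  "is_fourier_L2 u g \<longleftrightarrow> L2_on UNIV g \<and>
     ((\<lambda>R. \<integral>\<^sup>+\<xi>. ennreal ((cmod (fourier_integral (\<lambda>x. indicator {-R..R} x * u x) \<xi> - g \<xi>))\<^sup>2)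
         \<partial>lebesgue) \<longlongrightarrow> 0) at_top"

definition fourier_L2 :: "(real \<Rightarrow> real) \<Rightarrow> real \<Rightarrow> complex" where
  "fourier_L2 u = (SOME g. is_fourier_L2 u g)"

definition test_functions :: "real set \<Rightarrow> (real \<Rightarrow> real) set" where
  "test_functions \<Omega> = {\<phi>. (\<forall>n x. (deriv ^^ n) \<phi> field_differentiable at x) \<and>
     (\<exists>K. compact K \<and> K \<subseteq> \<Omega> \<and> (\<forall>x. x \<notin> K \<longrightarrow> \<phi> x = 0))}"

definition bessel_weighted_fourier :: "real \<Rightarrow> (real \<Rightarrow> real) \<Rightarrow> real \<Rightarrow> complex" where
  "bessel_weighted_fourier s u \<xi> = complex_of_real ((1 + \<xi>\<^sup>2) powr (s / 2)) * fourier_L2 u \<xi>"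

definition Hs :: "real \<Rightarrow> (real \<Rightarrow> real) set" where
  "Hs s = {u. L2_on UNIV u \<and> L2_on UNIV (bessel_weighted_fourier s u)}"

definition Hs_norm :: "real \<Rightarrow> (real \<Rightarrow> real) \<Rightarrow> real" where
  "Hs_norm s u = L2_norm UNIV (bessel_weighted_fourier s u)"

definition Hs_tilde :: "real \<Rightarrow> real set \<Rightarrow> (real \<Rightarrow> real) set" where
  "Hs_tilde s \<Omega> = {v \<in> Hs s. \<exists>\<phi>::nat \<Rightarrow> real \<Rightarrow> real.
     (\<forall>n. \<phi> n \<in> test_functions \<Omega>) \<and> (\<lambda>n. Hs_norm s (\<lambda>x. \<phi> n x - v x)) \<longlonglongrightarrow> 0}"

text \<open>The tempered distribution with Fourier transform \<open>|\<xi>|\<^sup>2\<^sup>s u^(\<xi>)\<close>, for \<open>u\<close> in \<open>L\<^sup>2\<close>, applied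
  to a real-valued test function \<open>\<phi>\<close>. The complex conjugate appears because
  \<open>\<phi>^(-\<xi>)\<close> is the conjugate of \<open>\<phi>^(\<xi>)\<close>.\<close>
definition frac_laplacian :: "real \<Rightarrow> (real \<Rightarrow> real) \<Rightarrow> (real \<Rightarrow> real) \<Rightarrow> complex" where
  "frac_laplacian s u \<phi> = complex_of_real (1 / (2 * pi)) *
     (LINT \<xi>|lebesgue. complex_of_real (\<bar>\<xi>\<bar> powr (2 * s)) * fourier_L2 u \<xi> * cnj (fourier_integral \<phi> \<xi>))"

definition zero_extension :: "real set \<Rightarrow> (real \<Rightarrow> real) \<Rightarrow> real \<Rightarrow> real" where
  "zero_extension W f x = (if x \<in> W then f x else 0)"

text \<open>\<open>w\<close> solves the exterior value problem in \<open>\<Omega>\<close> with exterior data \<open>f\<close> on \<open>W\<close>. The data is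
  only in \<open>L\<^sup>2\<close>, so the correction \<open>v\<close>, not \<open>w\<close>, has finite energy.\<close>
definition exterior_value_solution ::
  "real \<Rightarrow> real set \<Rightarrow> real set \<Rightarrow> (real \<Rightarrow> real) \<Rightarrow> (real \<Rightarrow> real) \<Rightarrow> bool" where
  "exterior_value_solution s \<Omega> W f w \<longleftrightarrow>
     (\<exists>v \<in> Hs_tilde s \<Omega>.
        (\<forall>\<phi> \<in> test_functions \<Omega>.
           frac_laplacian s v \<phi> = - frac_laplacian s (zero_extension W f) \<phi>) \<and>
        (AE x in lebesgue. w x = zero_extension W f x + v x))"

end

theory Submission
  imports Defs "HOL-Probability.Characteristic_Functions" "HOL-Probability.Sinc_Integral"
begin

text \<open>Exterior data on \<open>[2,3]\<close> acts on \<open>[-1,1]\<close> only through a kernel that is analytic there, so most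
targets can be matched only at exponential cost. The proof makes this quantitative by duality.

Let \<open>\<phi>\<close> be a test function in \<open>(-1,1)\<close> and let \<open>g\<close> be its fractional Laplacian, up to a constant
factor. For a solution \<open>w\<close> with exterior data \<open>f\<close> the weak formulation, tested with \<open>\<phi>\<close>, reads
\<open>\<integral>\<^bsub>[-1,1]\<^esub> w g = - \<integral>\<^bsub>[2,3]\<^esub> f g\<close> (\<open>exterior_solution_duality\<close>). Choose \<open>\<phi>\<close> with support in
\<open>[-1/2,1/2]\<close> and with \<open>N\<close> vanishing moments. Away from the support,
\<open>g(y) = - 1/2 \<integral> \<phi>(x) (y - x)\<^sup>-\<^sup>1\<^sup>-\<^sup>2\<^sup>s dx\<close>; a Taylor polynomial in \<open>x\<close> of degree below \<open>N\<close> may be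
subtracted from the kernel, so \<open>g\<close> is of size \<open>2\<^sup>-\<^sup>N \<parallel>\<phi>\<parallel>\<close> on \<open>[2,3]\<close>
(\<open>singular_integral_exponentially_small\<close>). On \<open>[-1,1]\<close>, however, \<open>g\<close> cannot be small, since
\<open>\<integral> g \<phi> \<ge> \<parallel>\<phi>\<parallel>\<^sup>2 / 8\<close> (\<open>singular_integral_coercive\<close>). Put \<open>A = \<parallel>(1 - x\<^sup>2)\<^sup>s g\<parallel>\<close>, which by the last
estimate is at least a fixed multiple of \<open>\<parallel>\<phi>\<parallel>\<close>. The target \<open>h = 2/(k A) (1 - x\<^sup>2)\<^sup>2\<^sup>s g\<close> satisfies
\<open>\<integral> h g = 2A/k\<close>, and an error of weighted norm \<open>1/k\<close> changes this pairing by at most \<open>A/k\<close>. Therefore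
\<open>A/k \<le> \<bar>\<integral> w g\<bar> \<le> \<parallel>f\<parallel> sup\<^bsub>[2,3]\<^esub> \<bar>g\<bar>\<close> (\<open>control_lower_bound\<close>), and with \<open>N = 2k\<close> the norm of \<open>f\<close>
is at least a constant times \<open>4\<^sup>k / k \<ge> 2\<^sup>k\<close>. As \<open>\<phi>\<close> serves the \<open>N\<close>-th derivative of a bump function,
whose first \<open>N\<close> moments vanish after integration by parts (\<open>oscillating_test_functions\<close>).

Most of the text serves the duality identity, because the fractional Laplacian is a Fourier
multiplier while the estimates of \<open>g\<close> are made in physical space. The \<open>L\<^sup>2\<close> Fourier transform exists
because truncated Fourier integrals are Cauchy by Bessel's inequality (\<open>is_fourier_L2_fourier_L2\<close>),
and it satisfies Parseval's identity against test functions (\<open>Parseval_L2\<close>). Writing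
\<open>\<bar>\<xi>\<bar>\<^sup>2\<^sup>s\<close> as a superposition of the multipliers \<open>1 - cos (t \<xi>)\<close> of second differences then turns the
fractional Laplacian into a singular integral (\<open>frac_laplacian_eq_singular_integral\<close>). Finally,
elements of the energy space vanish outside \<open>[-1,1]\<close> (\<open>Hs_tilde_vanishes_outside\<close>), so that the
correction \<open>v\<close> contributes on \<open>[-1,1]\<close> only.\<close>

section \<open>Square-integrable functions\<close>

text \<open>The quadratic polynomial \<open>l \<mapsto> \<integral> (l \<bar>f\<bar> - \<bar>g\<bar>)\<^sup>2\<close> is nonnegative, so its discriminant is not positive.\<close>

lemma Cauchy_Schwarz_integral:
  fixes f g :: "'a \<Rightarrow> 'b::{real_normed_algebra,banach,second_countable_topology}"
  assumes [measurable]: "f \<in> borel_measurable M" "g \<in> borel_measurable M"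
    and f: "integrable M (\<lambda>x. (norm (f x))\<^sup>2)" and g: "integrable M (\<lambda>x. (norm (g x))\<^sup>2)"
  shows "integrable M (\<lambda>x. f x * g x)"
    and "norm (LINT x|M. f x * g x) \<le> sqrt (LINT x|M. (norm (f x))\<^sup>2) * sqrt (LINT x|M. (norm (g x))\<^sup>2)"
proof -
  have amgm: "norm (f x) * norm (g x) \<le> (norm (f x))\<^sup>2 + (norm (g x))\<^sup>2" for x
  proof -
    have "2 * (norm (f x) * norm (g x)) \<le> (norm (f x))\<^sup>2 + (norm (g x))\<^sup>2"
      using sum_squares_bound[of "norm (f x)" "norm (g x)"] by (simp only: mult.assoc)
    moreover have "0 \<le> norm (f x) * norm (g x)" by simp
    ultimately show ?thesis by linarith
  qed
  have int_norm: "integrable M (\<lambda>x. norm (f x) * norm (g x))"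
    by (rule Bochner_Integration.integrable_bound[OF Bochner_Integration.integrable_add[OF f g]])
      (auto intro!: AE_I2 amgm)
  show int: "integrable M (\<lambda>x. f x * g x)"
    by (rule Bochner_Integration.integrable_bound[OF int_norm]) (auto intro!: AE_I2 norm_mult_ineq)
  define A where "A = (LINT x|M. (norm (f x))\<^sup>2)"
  define B where "B = (LINT x|M. (norm (g x))\<^sup>2)"
  define P where "P = (LINT x|M. norm (f x) * norm (g x))"
  have A: "A \<ge> 0" and B: "B \<ge> 0" and P: "P \<ge> 0" unfolding A_def B_def P_def by auto
  have quad: "0 \<le> l\<^sup>2 * A - 2 * l * P + B" for l
  proof -
    have "0 \<le> (LINT x|M. (l * norm (f x) - norm (g x))\<^sup>2)" by auto
    also have "\<dots> = (LINT x|M. l\<^sup>2 * (norm (f x))\<^sup>2 - 2 * l * (norm (f x) * norm (g x)) + (norm (g x))\<^sup>2)"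
      by (intro Bochner_Integration.integral_cong) (auto simp: power2_eq_square algebra_simps)
    also have "\<dots> = l\<^sup>2 * A - 2 * l * P + B"
      unfolding A_def B_def P_def using f g int_norm by simp
    finally show ?thesis .
  qed
  have "P\<^sup>2 \<le> A * B"
  proof (cases "A = 0")
    case True
    have "P = 0"
    proof (rule ccontr)
      assume "P \<noteq> 0"
      \<comment> \<open>For \<open>A = 0\<close> the polynomial is affine in \<open>l\<close> and would become negative.\<close>
      with quad[of "(B+1)/(2*P)"] True show False by simp
    qed
    with True show ?thesis by simp
  next
    case False
    have "(P/A)\<^sup>2 * A - 2 * (P/A) * P = - (P\<^sup>2 / A)"
      using False by (simp add: power2_eq_square)
    with quad[of "P/A"] have "P\<^sup>2 / A \<le> B" by linarith
    moreover have "0 < A" using False A by simp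
    ultimately show ?thesis by (simp only: pos_divide_le_eq mult.commute)
  qed
  then have "P \<le> sqrt A * sqrt B"
    using real_le_rsqrt[of P "A*B"] by (simp add: real_sqrt_mult)
  moreover have "norm (LINT x|M. f x * g x) \<le> P"
    unfolding P_def using int int_norm
    by (intro order_trans[OF integral_norm_bound] integral_mono) (auto intro: norm_mult_ineq)
  ultimately show "norm (LINT x|M. f x * g x) \<le> sqrt (LINT x|M. (norm (f x))\<^sup>2) * sqrt (LINT x|M. (norm (g x))\<^sup>2)"
    unfolding A_def B_def by (rule order_trans[rotated])
qed

text \<open>Finiteness of the weighted series bounds each single term, and the weights \<open>2\<^sup>n\<close> turn this bound
into geometric decay.\<close>

lemma summable_if_geometric_square_weights_finite:
  fixes D :: "nat \<Rightarrow> 'a::banach"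
  assumes fin: "(\<Sum>n. ennreal (2^n * (norm (D n))\<^sup>2)) \<noteq> \<infinity>"
  shows "summable D"
proof -
  let ?X = "\<Sum>n. ennreal (2^n * (norm (D n))\<^sup>2)"
  obtain S where S: "?X = ennreal S" "0 \<le> S"
    using fin ennreal_cases[of ?X] unfolding infinity_ennreal_def by blast
  have bound: "norm (D n) \<le> sqrt S * (1 / sqrt 2)^n" for n
  proof -
    have "f n \<le> suminf f" for f :: "nat \<Rightarrow> ennreal"
      using sum_le_suminf[OF summableI, of "{n}" f] by simp
    from this[of "\<lambda>n. ennreal (2^n * (norm (D n))\<^sup>2)"] have "2^n * (norm (D n))\<^sup>2 \<le> S"
      unfolding S(1) using S(2) by (simp only: ennreal_le_iff)
    then have "(norm (D n))\<^sup>2 \<le> S / 2^n"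
      by (simp add: pos_le_divide_eq mult.commute)
    then have "norm (D n) \<le> sqrt (S / 2^n)" by (rule real_le_rsqrt)
    also have "\<dots> = sqrt S * (1 / sqrt 2)^n"
      unfolding real_sqrt_divide real_sqrt_power power_divide by simp
    finally show ?thesis .
  qed
  show ?thesis
    by (rule summable_comparison_test'[where g="\<lambda>n. sqrt S * (1 / sqrt 2)^n" and N=0])
      (auto intro!: bound summable_mult summable_geometric)
qed

text \<open>The pointwise half of the Riesz-Fischer theorem. The rate \<open>8\<^sup>-\<^sup>n\<close> leaves room for the weights \<open>2\<^sup>n\<close>:
the weighted sum of squared increments has finite integral, hence is finite almost everywhere.\<close>

lemma L2_Cauchy_sequence_converges_AE:
  fixes F :: "nat \<Rightarrow> 'a \<Rightarrow> complex"
  assumes [measurable]: "\<And>n. F n \<in> borel_measurable M"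
    and Cauchy: "\<And>n. (\<integral>\<^sup>+x. ennreal ((cmod (F (Suc n) x - F n x))\<^sup>2) \<partial>M) \<le> ennreal ((1/8)^n)"
  shows "\<exists>G\<in>borel_measurable M. AE x in M. (\<lambda>n. F n x) \<longlonglongrightarrow> G x"
proof -
  let ?D = "\<lambda>n x. ennreal (2^n * (cmod (F (Suc n) x - F n x))\<^sup>2)"
  have "(\<integral>\<^sup>+x. (\<Sum>n. ?D n x) \<partial>M) = (\<Sum>n. \<integral>\<^sup>+x. ?D n x \<partial>M)"
    by (intro nn_integral_suminf) measurable
  also have "\<dots> \<le> (\<Sum>n. ennreal ((1/4)^n))"
  proof (intro suminf_le)
    fix n
    have "(\<integral>\<^sup>+x. ?D n x \<partial>M) = ennreal (2^n) * (\<integral>\<^sup>+x. ennreal ((cmod (F (Suc n) x - F n x))\<^sup>2) \<partial>M)"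
      by (subst nn_integral_cmult[symmetric]) (auto simp: ennreal_mult)
    also have "\<dots> \<le> ennreal (2^n) * ennreal ((1/8)^n)"
      by (intro mult_left_mono Cauchy) auto
    also have "\<dots> = ennreal ((1/4)^n)"
      by (subst ennreal_mult[symmetric]) (auto simp: power_mult_distrib[symmetric])
    finally show "(\<integral>\<^sup>+x. ?D n x \<partial>M) \<le> ennreal ((1/4)^n)" .
  qed auto
  also have "\<dots> < \<infinity>"
    by (subst suminf_ennreal2) (auto simp: summable_geometric)
  finally have "AE x in M. (\<Sum>n. ?D n x) \<noteq> \<infinity>"
    by (intro nn_integral_noteq_infinite) auto
  then have conv: "AE x in M. convergent (\<lambda>n. F n x)"
  proof (eventually_elim)
    fix x assume fin: "(\<Sum>n. ?D n x) \<noteq> \<infinity>"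
    have "summable (\<lambda>n. F (Suc n) x - F n x)"
      by (rule summable_if_geometric_square_weights_finite[OF fin])
    then have "convergent (\<lambda>n. \<Sum>k<n. F (Suc k) x - F k x)"
      by (simp add: summable_iff_convergent)
    then have "convergent (\<lambda>n. F n x - F 0 x)"
      by (simp only: sum_lessThan_telescope[where f="\<lambda>n. F n x"])
    then show "convergent (\<lambda>n. F n x)"
      using convergent_diff_const_right_iff[of "\<lambda>n. F n x" "F 0 x"] by blast
  qed
  show ?thesis
  proof (intro bexI)
    show "AE x in M. (\<lambda>n. F n x) \<longlonglongrightarrow> lim (\<lambda>n. F n x)"
      using conv by (auto simp: convergent_LIMSEQ_iff)
    show "(\<lambda>x. lim (\<lambda>n. F n x)) \<in> borel_measurable M" by measurable
  qed
qed

text \<open>The norm half of the Riesz-Fischer theorem, which is Fatou's lemma.\<close>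

lemma L2_distance_limit_le:
  fixes F :: "nat \<Rightarrow> 'a \<Rightarrow> complex"
  assumes [measurable]: "\<And>n. F n \<in> borel_measurable M" "G \<in> borel_measurable M" "H \<in> borel_measurable M"
    and lim: "AE x in M. (\<lambda>n. F n x) \<longlonglongrightarrow> G x"
    and bound: "\<forall>\<^sub>F n in sequentially. (\<integral>\<^sup>+x. ennreal ((cmod (H x - F n x))\<^sup>2) \<partial>M) \<le> B"
  shows "(\<integral>\<^sup>+x. ennreal ((cmod (H x - G x))\<^sup>2) \<partial>M) \<le> B"
proof -
  have "(\<integral>\<^sup>+x. ennreal ((cmod (H x - G x))\<^sup>2) \<partial>M)
      = (\<integral>\<^sup>+x. liminf (\<lambda>n. ennreal ((cmod (H x - F n x))\<^sup>2)) \<partial>M)"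
  proof (rule nn_integral_cong_AE, use lim in eventually_elim)
    fix x assume "(\<lambda>n. F n x) \<longlonglongrightarrow> G x"
    then have "(\<lambda>n. ennreal ((cmod (H x - F n x))\<^sup>2)) \<longlonglongrightarrow> ennreal ((cmod (H x - G x))\<^sup>2)"
      by (intro tendsto_intros tendsto_ennrealI)
    from lim_imp_Liminf[OF _ this]
    show "ennreal ((cmod (H x - G x))\<^sup>2) = liminf (\<lambda>n. ennreal ((cmod (H x - F n x))\<^sup>2))"
      by (metis trivial_limit_sequentially)
  qed
  also have "\<dots> \<le> liminf (\<lambda>n. \<integral>\<^sup>+x. ennreal ((cmod (H x - F n x))\<^sup>2) \<partial>M)"
    by (intro nn_integral_liminf) measurable
  also have "\<dots> \<le> B"
    using bound by (intro Liminf_le) auto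
  finally show ?thesis .
qed

section \<open>The Fourier transform of integrable functions\<close>

lemma borel_measurable_cis [measurable]: "cis \<in> borel_measurable borel"
  by (intro borel_measurable_continuous_onI continuous_intros)

lemma norm_integral_le_nn_integral:
  fixes f :: "'a \<Rightarrow> 'b::{banach,second_countable_topology}"
  shows "ennreal (norm (integral\<^sup>L M f)) \<le> (\<integral>\<^sup>+x. ennreal (norm (f x)) \<partial>M)"
  by (cases "integrable M f") (auto simp: integral_norm_bound_ennreal not_integrable_integral_eq)

text \<open>Every exchange of a Fourier integral with another integral has this form, with a character as \<open>k\<close>.\<close>

lemma Fubini_bounded_kernel:
  fixes f g :: "real \<Rightarrow> complex" and k :: "real \<Rightarrow> real \<Rightarrow> complex"
  assumes f: "integrable lborel f" and g: "integrable lborel g"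
    and k [measurable]: "(\<lambda>(x, y). k x y) \<in> borel_measurable (borel \<Otimes>\<^sub>M borel)"
    and k1: "\<And>x y. norm (k x y) \<le> 1"
  shows "(LBINT y. g y * (LBINT x. f x * k x y)) =
         (LBINT x. f x * (LBINT y. g y * k x y))"
proof -
  have [measurable]: "f \<in> borel_measurable borel" "g \<in> borel_measurable borel"
    using f g by (auto dest: borel_measurable_integrable)
  have k1': "norm (a * k x y) \<le> norm a" for a x y
    using mult_left_mono[OF k1[of x y], of "norm a"] by (simp add: norm_mult)
  have fk: "integrable lborel (\<lambda>x. f x * k x y)" for y
    by (rule Bochner_Integration.integrable_bound[OF f]) (auto intro!: AE_I2 k1')
  have gk: "integrable lborel (\<lambda>y. g y * k x y)" for x
    by (rule Bochner_Integration.integrable_bound[OF g]) (auto intro!: AE_I2 k1')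
  have int: "integrable (lborel \<Otimes>\<^sub>M lborel) (\<lambda>(x, y). f x * (g y * k x y))"
  proof (rule lborel_pair.Fubini_integrable)
    show "integrable lborel (\<lambda>x. LBINT y. norm (case (x, y) of (x, y) \<Rightarrow> f x * (g y * k x y)))"
    proof (rule Bochner_Integration.integrable_bound)
      show "integrable lborel (\<lambda>x. norm (f x) * (LBINT y. norm (g y)))" using f by simp
      show "AE x in lborel. norm (LBINT y. norm (case (x, y) of (x, y) \<Rightarrow> f x * (g y * k x y)))
              \<le> norm (norm (f x) * (LBINT y. norm (g y)))"
      proof (rule AE_I2)
        fix x
        have "(LBINT y. norm (f x * (g y * k x y))) \<le> (LBINT y. norm (f x) * norm (g y))"
          using gk[of x] g by (intro integral_mono)
            (auto intro!: mult_left_mono k1' simp: norm_mult[of "f x"])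
        then show "norm (LBINT y. norm (case (x, y) of (x, y) \<Rightarrow> f x * (g y * k x y)))
              \<le> norm (norm (f x) * (LBINT y. norm (g y)))"
          by (simp add: abs_mult)
      qed
    qed measurable
    show "AE x in lborel. integrable lborel (\<lambda>y. case (x, y) of (x, y) \<Rightarrow> f x * (g y * k x y))"
      using gk by auto
  qed measurable
  have "(LBINT y. g y * (LBINT x. f x * k x y))
      = (LBINT y. (LBINT x. f x * (g y * k x y)))"
    by (simp only: integral_mult_right_zero[symmetric] mult.left_commute)
  also have "\<dots> = (LBINT x. (LBINT y. f x * (g y * k x y)))"
    using lborel_pair.Fubini_integral[of "\<lambda>x y. f x * (g y * k x y)"] int by simp
  also have "\<dots> = (LBINT x. f x * (LBINT y. g y * k x y))"
    by (intro Bochner_Integration.integral_cong refl) simp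
  finally show ?thesis .
qed

text \<open>The characteristic function of the standard normal distribution, rescaled.\<close>

lemma gaussian_Fourier_integral:
  fixes e z :: real assumes "e > 0"
  shows "integrable lborel (\<lambda>\<xi>. exp (- (e * \<xi>)\<^sup>2 / 2))"
    and "(LBINT \<xi>. complex_of_real (exp (- (e * \<xi>)\<^sup>2 / 2)) * cis (z * \<xi>))
       = complex_of_real (2 * pi * normal_density 0 e z)"
proof -
  have eq: "exp (- (e * \<xi>)\<^sup>2 / 2) = sqrt (2 * pi) * std_normal_density (e * \<xi>)" for \<xi>
    by (simp add: std_normal_density_def)
  show "integrable lborel (\<lambda>\<xi>. exp (- (e * \<xi>)\<^sup>2 / 2))"
    unfolding eq using assms
    by (intro integrable_mult_right)
      (use lborel_integrable_real_affine[of std_normal_density e 0] in simp)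
  have "complex_of_real (exp (- (z / e)\<^sup>2 / 2)) = char std_normal_distribution (z / e)"
    by (simp add: char_std_normal_distribution)
  also have "\<dots> = (LBINT x. std_normal_density x *\<^sub>R cis (z / e * x))"
    unfolding char_def by (subst integral_density) (auto simp: cis_conv_exp)
  also have "\<dots> = e *\<^sub>R (LBINT \<xi>. std_normal_density (e * \<xi>) *\<^sub>R cis (z * \<xi>))"
    using assms by (subst lborel_integral_real_affine[where c = e and t = 0]) auto
  finally have *: "(LBINT \<xi>. std_normal_density (e * \<xi>) *\<^sub>R cis (z * \<xi>))
      = (1 / e) *\<^sub>R complex_of_real (exp (- (z / e)\<^sup>2 / 2))"
    using assms by simp
  have "(LBINT \<xi>. complex_of_real (exp (- (e * \<xi>)\<^sup>2 / 2)) * cis (z * \<xi>))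
      = (LBINT \<xi>. sqrt (2 * pi) *\<^sub>R (std_normal_density (e * \<xi>) *\<^sub>R cis (z * \<xi>)))"
    unfolding eq by (simp add: scaleR_conv_of_real mult.assoc)
  also have "\<dots> = sqrt (2 * pi) *\<^sub>R (LBINT \<xi>. std_normal_density (e * \<xi>) *\<^sub>R cis (z * \<xi>))"
    by (rule integral_scaleR_right)
  also have "\<dots> = complex_of_real (sqrt (2 * pi) * ((1 / e) * exp (- (z / e)\<^sup>2 / 2)))"
    unfolding * by (simp add: scaleR_conv_of_real)
  also have "sqrt (2 * pi) * ((1 / e) * exp (- (z / e)\<^sup>2 / 2)) = 2 * pi * normal_density 0 e z"
  proof -
    have "2 * pi / (sqrt (2 * pi) * e) = sqrt (2 * pi) / e"
      by (metis divide_divide_eq_left' mult.commute pi_ge_zero real_div_sqrt zero_le_mult_iff zero_le_numeral)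
    moreover have "sqrt (2 * pi * e\<^sup>2) = sqrt (2 * pi) * e"
      using assms by (simp add: real_sqrt_mult)
    moreover have "- (z / e)\<^sup>2 / 2 = - (z - 0)\<^sup>2 / (2 * e\<^sup>2)"
      by (simp add: power_divide)
    ultimately show ?thesis
      unfolding normal_density_def by (metis (no_types, lifting) times_divide_eq_left times_divide_eq_right mult_1)
  qed
  finally show "(LBINT \<xi>. complex_of_real (exp (- (e * \<xi>)\<^sup>2 / 2)) * cis (z * \<xi>))
       = complex_of_real (2 * pi * normal_density 0 e z)" .
qed

lemma fourier_integral_eq_lborel:
  assumes [measurable]: "u \<in> borel_measurable borel"
  shows "fourier_integral u \<xi> = (LBINT x. complex_of_real (u x) * cis (- (x * \<xi>)))"
  unfolding fourier_integral_def by (rule integral_completion) measurable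

lemma borel_measurable_fourier_integral [measurable]:
  assumes [measurable]: "u \<in> borel_measurable borel"
  shows "fourier_integral u \<in> borel_measurable borel"
  unfolding fourier_integral_eq_lborel[OF assms] by measurable

lemma integrable_fourier_integrand:
  assumes u: "integrable lborel (u :: real \<Rightarrow> real)"
  shows "integrable lborel (\<lambda>x. complex_of_real (u x) * cis (a * x + b))"
proof (rule Bochner_Integration.integrable_bound[OF u])
  have [measurable]: "u \<in> borel_measurable borel" using u by auto
  show "(\<lambda>x. complex_of_real (u x) * cis (a * x + b)) \<in> borel_measurable lborel" by measurable
qed (auto simp: norm_mult)

lemma norm_fourier_integral_le:
  assumes u: "integrable lborel u"
  shows "norm (fourier_integral u \<xi>) \<le> (LBINT x. \<bar>u x\<bar>)"
proof -
  have [measurable]: "u \<in> borel_measurable borel" using u by auto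
  have "norm (fourier_integral u \<xi>) \<le> (LBINT x. norm (complex_of_real (u x) * cis (- (x * \<xi>))))"
    unfolding fourier_integral_eq_lborel[OF \<open>u \<in> borel_measurable borel\<close>]
    by (rule integral_norm_bound)
  then show ?thesis by (simp add: norm_mult)
qed

text \<open>Without the Gaussian weight the double integral need not converge absolutely. With it, Fubini's
theorem yields the convolution of \<open>u\<close> with an approximate identity.\<close>

lemma gaussian_regularized_inversion:
  assumes u: "integrable lborel u" and e: "e > 0"
  shows "integrable lborel (\<lambda>\<xi>. complex_of_real (exp (- (e * \<xi>)\<^sup>2 / 2)) * fourier_integral u \<xi> * cis (y * \<xi>))"
    and "(LBINT \<xi>. complex_of_real (exp (- (e * \<xi>)\<^sup>2 / 2)) * fourier_integral u \<xi> * cis (y * \<xi>))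
      = complex_of_real (LBINT x. u x * (2 * pi * normal_density 0 e (y - x)))"
proof -
  have um [measurable]: "u \<in> borel_measurable borel" using u by auto
  note g = gaussian_Fourier_integral[OF e]
  let ?e = "\<lambda>\<xi>. complex_of_real (exp (- (e * \<xi>)\<^sup>2 / 2))"
  let ?B = "LBINT x. \<bar>u x\<bar>"
  have gB: "integrable lborel (\<lambda>\<xi>. exp (- (e * \<xi>)\<^sup>2 / 2) * ?B)"
    using g(1) by (rule integrable_mult_left)
  show "integrable lborel (\<lambda>\<xi>. ?e \<xi> * fourier_integral u \<xi> * cis (y * \<xi>))"
    by (rule Bochner_Integration.integrable_bound[OF gB])
      (auto intro!: AE_I2 mult_left_mono norm_fourier_integral_le[OF u] simp: norm_mult)
  have ge: "integrable lborel (\<lambda>\<xi>. ?e \<xi> * cis (y * \<xi>))"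
    by (rule Bochner_Integration.integrable_bound[OF g(1)]) (auto simp: norm_mult)
  have "(LBINT \<xi>. ?e \<xi> * fourier_integral u \<xi> * cis (y * \<xi>))
      = (LBINT \<xi>. (?e \<xi> * cis (y * \<xi>)) * (LBINT x. complex_of_real (u x) * cis (- (x * \<xi>))))"
    unfolding fourier_integral_eq_lborel[OF um] by (simp only: mult_ac)
  also have "\<dots> = (LBINT x. complex_of_real (u x) * (LBINT \<xi>. (?e \<xi> * cis (y * \<xi>)) * cis (- (x * \<xi>))))"
    using u ge by (intro Fubini_bounded_kernel) auto
  also have "\<dots> = (LBINT x. complex_of_real (u x * (2 * pi * normal_density 0 e (y - x))))"
  proof (intro Bochner_Integration.integral_cong refl)
    fix x
    have "(LBINT \<xi>. (?e \<xi> * cis (y * \<xi>)) * cis (- (x * \<xi>))) = (LBINT \<xi>. ?e \<xi> * cis ((y - x) * \<xi>))"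
      by (simp add: mult.assoc cis_mult left_diff_distrib)
    then show "complex_of_real (u x) * (LBINT \<xi>. (?e \<xi> * cis (y * \<xi>)) * cis (- (x * \<xi>)))
        = complex_of_real (u x * (2 * pi * normal_density 0 e (y - x)))"
      unfolding g(2) by simp
  qed
  also have "\<dots> = complex_of_real (LBINT x. u x * (2 * pi * normal_density 0 e (y - x)))"
    by (rule integral_complex_of_real)
  finally show "(LBINT \<xi>. ?e \<xi> * fourier_integral u \<xi> * cis (y * \<xi>))
      = complex_of_real (LBINT x. u x * (2 * pi * normal_density 0 e (y - x)))" .
qed

lemma gaussian_weights_tendsto_1: "(\<lambda>n. exp (- (1 / Suc n * \<xi>)\<^sup>2 / 2)) \<longlonglongrightarrow> (1::real)"
proof -
  have "(\<lambda>n. 1 / real (Suc n)) \<longlonglongrightarrow> 0" using LIMSEQ_inverse_real_of_nat by (simp add: inverse_eq_divide)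
  then have "(\<lambda>n. exp (- (1 / real (Suc n) * \<xi>)\<^sup>2 / 2)) \<longlonglongrightarrow> exp (- (0 * \<xi>)\<^sup>2 / 2)"
    by (intro tendsto_intros) auto
  then show ?thesis by simp
qed

text \<open>Both sides of \<open>gaussian_regularized_inversion\<close> converge as the Gaussian weight tends to \<open>1\<close>. On the
right, the substitution \<open>x = y - e z\<close> moves the parameter from the density into the argument of \<open>u\<close>.\<close>

lemma Fourier_inversion:
  assumes u: "integrable lborel u" and cont: "continuous_on UNIV u" and bdd: "\<And>x. \<bar>u x\<bar> \<le> B"
    and int: "integrable lborel (fourier_integral u)"
  shows "(LBINT \<xi>. fourier_integral u \<xi> * cis (y * \<xi>)) = complex_of_real (2 * pi * u y)"
proof (rule LIMSEQ_unique)
  have um [measurable]: "u \<in> borel_measurable borel" using u by auto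
  define e where "e = (\<lambda>n. 1 / real (Suc n))"
  have e: "e n > 0" for n by (simp add: e_def)
  have e0: "e \<longlonglongrightarrow> 0" unfolding e_def
    using LIMSEQ_inverse_real_of_nat by (simp add: inverse_eq_divide)
  let ?I = "\<lambda>n. LBINT \<xi>. complex_of_real (exp (- (e n * \<xi>)\<^sup>2 / 2)) * fourier_integral u \<xi> * cis (y * \<xi>)"
  show "?I \<longlonglongrightarrow> (LBINT \<xi>. fourier_integral u \<xi> * cis (y * \<xi>))"
  proof (rule integral_dominated_convergence[where w = "\<lambda>\<xi>. norm (fourier_integral u \<xi>)"])
    show "AE \<xi> in lborel. (\<lambda>n. complex_of_real (exp (- (e n * \<xi>)\<^sup>2 / 2)) * fourier_integral u \<xi> * cis (y * \<xi>))
        \<longlonglongrightarrow> fourier_integral u \<xi> * cis (y * \<xi>)"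
    proof (rule AE_I2)
      fix \<xi>
      have "(\<lambda>n. complex_of_real (exp (- (e n * \<xi>)\<^sup>2 / 2)) * fourier_integral u \<xi> * cis (y * \<xi>))
          \<longlonglongrightarrow> complex_of_real 1 * fourier_integral u \<xi> * cis (y * \<xi>)"
        unfolding e_def by (intro tendsto_intros gaussian_weights_tendsto_1)
      then show "(\<lambda>n. complex_of_real (exp (- (e n * \<xi>)\<^sup>2 / 2)) * fourier_integral u \<xi> * cis (y * \<xi>))
          \<longlonglongrightarrow> fourier_integral u \<xi> * cis (y * \<xi>)" by simp
    qed
    fix n
    show "AE \<xi> in lborel. norm (complex_of_real (exp (- (e n * \<xi>)\<^sup>2 / 2)) * fourier_integral u \<xi> * cis (y * \<xi>))
        \<le> norm (fourier_integral u \<xi>)"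
      by (intro AE_I2) (auto simp: norm_mult intro!: mult_left_le_one_le)
  qed (use int in auto)
  have I_eq: "?I n = complex_of_real (LBINT z. 2 * pi * u (y - e n * z) * std_normal_density z)" for n
  proof -
    have "(LBINT x. u x * (2 * pi * normal_density 0 (e n) (y - x)))
       = \<bar>- e n\<bar> *\<^sub>R (LBINT z. u (y + - e n * z) * (2 * pi * normal_density 0 (e n) (y - (y + - e n * z))))"
      using e[of n] by (intro lborel_integral_real_affine) auto
    also have "\<dots> = (LBINT z. e n *\<^sub>R (u (y + - e n * z) * (2 * pi * normal_density 0 (e n) (y - (y + - e n * z)))))"
      using e[of n] by simp
    also have "\<dots> = (LBINT z. 2 * pi * u (y - e n * z) * std_normal_density z)"
    proof (intro Bochner_Integration.integral_cong refl)
      fix z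
      have "e n * normal_density 0 (e n) (e n * z) = std_normal_density z"
        using e[of n] by (simp add: normal_density_def real_sqrt_mult power_mult_distrib)
      then show "e n *\<^sub>R (u (y + - e n * z) * (2 * pi * normal_density 0 (e n) (y - (y + - e n * z))))
          = 2 * pi * u (y - e n * z) * std_normal_density z"
        by (simp add: mult_ac)
    qed
    finally show ?thesis
      using gaussian_regularized_inversion(2)[OF u e[of n], of y] by simp
  qed
  have "(\<lambda>n. LBINT z. 2 * pi * u (y - e n * z) * std_normal_density z)
      \<longlonglongrightarrow> (LBINT z. 2 * pi * u y * std_normal_density z)"
  proof (rule integral_dominated_convergence[where w = "\<lambda>z. 2 * pi * B * std_normal_density z"])
    show "AE z in lborel. (\<lambda>n. 2 * pi * u (y - e n * z) * std_normal_density z) \<longlonglongrightarrow> 2 * pi * u y * std_normal_density z"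
    proof (rule AE_I2)
      fix z
      have "(\<lambda>n. y - e n * z) \<longlonglongrightarrow> y - 0 * z" by (intro tendsto_intros e0)
      then have "(\<lambda>n. u (y - e n * z)) \<longlonglongrightarrow> u y"
        using continuous_on_tendsto_compose[OF cont, of "\<lambda>n. y - e n * z" y] by simp
      then show "(\<lambda>n. 2 * pi * u (y - e n * z) * std_normal_density z) \<longlonglongrightarrow> 2 * pi * u y * std_normal_density z"
        by (intro tendsto_intros)
    qed
    fix n
    show "AE z in lborel. norm (2 * pi * u (y - e n * z) * std_normal_density z) \<le> 2 * pi * B * std_normal_density z"
      by (intro AE_I2) (auto simp: abs_mult intro!: mult_right_mono bdd)
  qed auto
  then show "?I \<longlonglongrightarrow> complex_of_real (2 * pi * u y)"
    unfolding I_eq by (intro tendsto_of_real) simp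
qed

text \<open>Schur's test: estimate the product \<open>\<bar>u(y)\<bar> \<bar>u(x)\<bar>\<close> by the mean of the squares and integrate out the
variable that occurs in the density only, which has total mass \<open>1\<close> in either variable.\<close>

lemma gaussian_convolution_form_le:
  assumes [measurable]: "u \<in> borel_measurable borel" and u2: "integrable lborel (\<lambda>x. (u x)\<^sup>2)" and e: "e > 0"
  shows "(\<integral>\<^sup>+y. \<integral>\<^sup>+x. ennreal (\<bar>u y\<bar> * (\<bar>u x\<bar> * normal_density 0 e (y - x))) \<partial>lborel \<partial>lborel)
     \<le> ennreal (LBINT x. (u x)\<^sup>2)"
proof -
  let ?N = "normal_density 0 e"
  have N1: "(\<integral>\<^sup>+x. ennreal (?N (y - x)) \<partial>lborel) = 1" for y
  proof -
    have "(\<integral>\<^sup>+x. ennreal (?N x) \<partial>lborel) = 1"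
      using e by (subst nn_integral_eq_integral) auto
    moreover have "(\<integral>\<^sup>+x. ennreal (?N x) \<partial>lborel) = ennreal \<bar>- 1\<bar> * (\<integral>\<^sup>+x. ennreal (?N (y + (- 1) * x)) \<partial>lborel)"
      by (intro nn_integral_real_affine) auto
    ultimately show ?thesis by simp
  qed
  have N2: "(\<integral>\<^sup>+y. ennreal (?N (y - x)) \<partial>lborel) = 1" for x
  proof -
    have "?N (y - x) = ?N (x - y)" for y by (simp add: normal_density_def power2_commute)
    then show ?thesis using N1[of x] by simp
  qed
  let ?A = "\<integral>\<^sup>+y. ennreal ((u y)\<^sup>2 / 2) \<partial>lborel"
  have "(\<integral>\<^sup>+y. \<integral>\<^sup>+x. ennreal (\<bar>u y\<bar> * (\<bar>u x\<bar> * ?N (y - x))) \<partial>lborel \<partial>lborel)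
     \<le> (\<integral>\<^sup>+y. \<integral>\<^sup>+x. ennreal ((u y)\<^sup>2 / 2) * ennreal (?N (y - x)) + ennreal ((u x)\<^sup>2 / 2) * ennreal (?N (y - x)) \<partial>lborel \<partial>lborel)"
  proof (intro nn_integral_mono)
    fix x y
    have "\<bar>u y\<bar> * \<bar>u x\<bar> \<le> (u y)\<^sup>2 / 2 + (u x)\<^sup>2 / 2"
      using sum_squares_bound[of "\<bar>u y\<bar>" "\<bar>u x\<bar>"] by simp
    then have "\<bar>u y\<bar> * \<bar>u x\<bar> * ?N (y - x) \<le> ((u y)\<^sup>2 / 2 + (u x)\<^sup>2 / 2) * ?N (y - x)"
      by (intro mult_right_mono) auto
    then show "ennreal (\<bar>u y\<bar> * (\<bar>u x\<bar> * ?N (y - x)))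
        \<le> ennreal ((u y)\<^sup>2 / 2) * ennreal (?N (y - x)) + ennreal ((u x)\<^sup>2 / 2) * ennreal (?N (y - x))"
      by (simp add: ennreal_mult[symmetric] ennreal_plus[symmetric] mult.assoc distrib_right del: ennreal_plus)
  qed
  also have "\<dots> = (\<integral>\<^sup>+y. \<integral>\<^sup>+x. ennreal ((u y)\<^sup>2 / 2) * ennreal (?N (y - x)) \<partial>lborel \<partial>lborel)
      + (\<integral>\<^sup>+y. \<integral>\<^sup>+x. ennreal ((u x)\<^sup>2 / 2) * ennreal (?N (y - x)) \<partial>lborel \<partial>lborel)"
    by (subst nn_integral_add) (auto simp: nn_integral_add)
  also have "(\<integral>\<^sup>+y. \<integral>\<^sup>+x. ennreal ((u x)\<^sup>2 / 2) * ennreal (?N (y - x)) \<partial>lborel \<partial>lborel)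
      = (\<integral>\<^sup>+x. \<integral>\<^sup>+y. ennreal ((u x)\<^sup>2 / 2) * ennreal (?N (y - x)) \<partial>lborel \<partial>lborel)"
    by (rule lborel_pair.Fubini'[symmetric]) measurable
  also have "\<dots> = ?A"
    by (intro nn_integral_cong) (subst nn_integral_cmult, auto simp: N2)
  also have "(\<integral>\<^sup>+y. \<integral>\<^sup>+x. ennreal ((u y)\<^sup>2 / 2) * ennreal (?N (y - x)) \<partial>lborel \<partial>lborel) = ?A"
    by (intro nn_integral_cong) (subst nn_integral_cmult, auto simp: N1)
  also have "?A = ennreal (LBINT y. (u y)\<^sup>2 / 2)"
    using u2 by (intro nn_integral_eq_integral) auto
  also have "ennreal (LBINT y. (u y)\<^sup>2 / 2) + ennreal (LBINT y. (u y)\<^sup>2 / 2) = ennreal (LBINT x. (u x)\<^sup>2)"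
    using u2 by (subst ennreal_plus[symmetric]) auto
  finally show ?thesis .
qed

text \<open>The half of Plancherel's theorem that produces the \<open>L\<^sup>2\<close> Fourier transform. With a Gaussian weight
the left side is a quadratic form in \<open>u\<close> that \<open>gaussian_convolution_form_le\<close> bounds; Fatou's lemma
removes the weight.\<close>

lemma Fourier_Bessel_inequality:
  assumes u: "integrable lborel u" and u2: "integrable lborel (\<lambda>x. (u x)\<^sup>2)"
  shows "(\<integral>\<^sup>+\<xi>. ennreal ((cmod (fourier_integral u \<xi>))\<^sup>2) \<partial>lborel) \<le> ennreal (2 * pi * (LBINT x. (u x)\<^sup>2))"
proof -
  have um [measurable]: "u \<in> borel_measurable borel" using u by auto
  let ?F = "fourier_integral u"
  let ?R = "2 * pi * (LBINT x. (u x)\<^sup>2)"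
  have bound: "(\<integral>\<^sup>+\<xi>. ennreal (exp (- (e * \<xi>)\<^sup>2 / 2) * (cmod (?F \<xi>))\<^sup>2) \<partial>lborel) \<le> ennreal ?R" if e: "e > 0" for e :: real
  proof -
    let ?e = "\<lambda>\<xi>. complex_of_real (exp (- (e * \<xi>)\<^sup>2 / 2))"
    let ?N = "normal_density 0 e"
    let ?B = "LBINT x. \<bar>u x\<bar>"
    have B: "cmod (?F \<xi>) \<le> ?B" for \<xi> by (rule norm_fourier_integral_le[OF u])
    have intF: "integrable lborel (\<lambda>\<xi>. exp (- (e * \<xi>)\<^sup>2 / 2) * (cmod (?F \<xi>))\<^sup>2)"
    proof (rule Bochner_Integration.integrable_bound)
      show "integrable lborel (\<lambda>\<xi>. exp (- (e * \<xi>)\<^sup>2 / 2) * ?B\<^sup>2)"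
        using gaussian_Fourier_integral(1)[OF e] by (rule integrable_mult_left)
      show "AE \<xi> in lborel. norm (exp (- (e * \<xi>)\<^sup>2 / 2) * (cmod (?F \<xi>))\<^sup>2) \<le> norm (exp (- (e * \<xi>)\<^sup>2 / 2) * ?B\<^sup>2)"
        by (intro AE_I2) (auto simp: abs_mult intro!: mult_left_mono power_mono B)
    qed measurable
    have geF: "integrable lborel (\<lambda>\<xi>. ?e \<xi> * ?F \<xi>)"
      using gaussian_regularized_inversion(1)[OF u e, of 0] by simp
    have "complex_of_real (LBINT \<xi>. exp (- (e * \<xi>)\<^sup>2 / 2) * (cmod (?F \<xi>))\<^sup>2)
        = (LBINT \<xi>. complex_of_real (exp (- (e * \<xi>)\<^sup>2 / 2) * (cmod (?F \<xi>))\<^sup>2))"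
      by (rule integral_complex_of_real[symmetric])
    also have "\<dots> = (LBINT \<xi>. ?e \<xi> * ?F \<xi> * (LBINT y. complex_of_real (u y) * cis (y * \<xi>)))"
    proof (intro Bochner_Integration.integral_cong refl)
      fix \<xi>
      have "cnj (?F \<xi>) = (LBINT y. cnj (complex_of_real (u y) * cis (- (y * \<xi>))))"
        unfolding fourier_integral_eq_lborel[OF um] by (simp only: Bochner_Integration.integral_cnj)
      also have "\<dots> = (LBINT y. complex_of_real (u y) * cis (y * \<xi>))"
        by (simp add: cis_cnj)
      finally show "complex_of_real (exp (- (e * \<xi>)\<^sup>2 / 2) * (cmod (?F \<xi>))\<^sup>2)
          = ?e \<xi> * ?F \<xi> * (LBINT y. complex_of_real (u y) * cis (y * \<xi>))"
        by (metis (no_types, lifting) complex_norm_square mult.assoc of_real_mult)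
    qed
    also have "\<dots> = (LBINT y. complex_of_real (u y) * (LBINT \<xi>. ?e \<xi> * ?F \<xi> * cis (y * \<xi>)))"
      using u geF by (intro Fubini_bounded_kernel) auto
    also have "\<dots> = (LBINT y. complex_of_real (u y * (LBINT x. u x * (2 * pi * ?N (y - x)))))"
      unfolding gaussian_regularized_inversion(2)[OF u e] by simp
    also have "\<dots> = complex_of_real (LBINT y. u y * (LBINT x. u x * (2 * pi * ?N (y - x))))"
      by (rule integral_complex_of_real)
    finally have eq: "(LBINT \<xi>. exp (- (e * \<xi>)\<^sup>2 / 2) * (cmod (?F \<xi>))\<^sup>2)
        = (LBINT y. u y * (LBINT x. u x * (2 * pi * ?N (y - x))))"
      by (simp only: of_real_eq_iff)
    have "(\<integral>\<^sup>+\<xi>. ennreal (exp (- (e * \<xi>)\<^sup>2 / 2) * (cmod (?F \<xi>))\<^sup>2) \<partial>lborel)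
        = ennreal (LBINT \<xi>. exp (- (e * \<xi>)\<^sup>2 / 2) * (cmod (?F \<xi>))\<^sup>2)"
      using intF by (intro nn_integral_eq_integral) auto
    also have "\<dots> \<le> ennreal (norm (LBINT y. u y * (LBINT x. u x * (2 * pi * ?N (y - x)))))"
      unfolding eq by (intro ennreal_leI) auto
    also have "\<dots> \<le> (\<integral>\<^sup>+y. ennreal (norm (u y * (LBINT x. u x * (2 * pi * ?N (y - x))))) \<partial>lborel)"
      by (rule norm_integral_le_nn_integral)
    also have "\<dots> \<le> (\<integral>\<^sup>+y. \<integral>\<^sup>+x. ennreal (2 * pi) * ennreal (\<bar>u y\<bar> * (\<bar>u x\<bar> * ?N (y - x))) \<partial>lborel \<partial>lborel)"
    proof (intro nn_integral_mono)
      fix y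
      have "ennreal (norm (u y * (LBINT x. u x * (2 * pi * ?N (y - x)))))
          = ennreal \<bar>u y\<bar> * ennreal (norm (LBINT x. u x * (2 * pi * ?N (y - x))))"
        by (simp add: abs_mult ennreal_mult)
      also have "\<dots> \<le> ennreal \<bar>u y\<bar> * (\<integral>\<^sup>+x. ennreal (norm (u x * (2 * pi * ?N (y - x)))) \<partial>lborel)"
        by (intro mult_left_mono norm_integral_le_nn_integral) auto
      also have "\<dots> = (\<integral>\<^sup>+x. ennreal \<bar>u y\<bar> * ennreal (norm (u x * (2 * pi * ?N (y - x)))) \<partial>lborel)"
        by (subst nn_integral_cmult) auto
      also have "\<dots> = (\<integral>\<^sup>+x. ennreal (2 * pi) * ennreal (\<bar>u y\<bar> * (\<bar>u x\<bar> * ?N (y - x))) \<partial>lborel)"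
        by (intro nn_integral_cong) (simp add: ennreal_mult[symmetric] abs_mult mult_ac)
      finally show "ennreal (norm (u y * (LBINT x. u x * (2 * pi * ?N (y - x)))))
          \<le> (\<integral>\<^sup>+x. ennreal (2 * pi) * ennreal (\<bar>u y\<bar> * (\<bar>u x\<bar> * ?N (y - x))) \<partial>lborel)" .
    qed
    also have "\<dots> = ennreal (2 * pi) * (\<integral>\<^sup>+y. \<integral>\<^sup>+x. ennreal (\<bar>u y\<bar> * (\<bar>u x\<bar> * ?N (y - x))) \<partial>lborel \<partial>lborel)"
      by (simp add: nn_integral_cmult)
    also have "\<dots> \<le> ennreal (2 * pi) * ennreal (LBINT x. (u x)\<^sup>2)"
      by (intro mult_left_mono gaussian_convolution_form_le um u2 e) auto
    also have "\<dots> = ennreal ?R" by (simp add: ennreal_mult)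
    finally show ?thesis .
  qed
  have "(\<integral>\<^sup>+\<xi>. ennreal ((cmod (?F \<xi>))\<^sup>2) \<partial>lborel)
      = (\<integral>\<^sup>+\<xi>. liminf (\<lambda>n. ennreal (exp (- (1 / real (Suc n) * \<xi>)\<^sup>2 / 2) * (cmod (?F \<xi>))\<^sup>2)) \<partial>lborel)"
  proof (rule nn_integral_cong)
    fix \<xi>
    have "(\<lambda>n. exp (- (1 / real (Suc n) * \<xi>)\<^sup>2 / 2) * (cmod (?F \<xi>))\<^sup>2) \<longlonglongrightarrow> 1 * (cmod (?F \<xi>))\<^sup>2"
      by (intro tendsto_intros gaussian_weights_tendsto_1)
    then have "(\<lambda>n. ennreal (exp (- (1 / real (Suc n) * \<xi>)\<^sup>2 / 2) * (cmod (?F \<xi>))\<^sup>2)) \<longlonglongrightarrow> ennreal ((cmod (?F \<xi>))\<^sup>2)"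
      by (intro tendsto_ennrealI) simp
    from lim_imp_Liminf[OF _ this]
    show "ennreal ((cmod (?F \<xi>))\<^sup>2) = liminf (\<lambda>n. ennreal (exp (- (1 / real (Suc n) * \<xi>)\<^sup>2 / 2) * (cmod (?F \<xi>))\<^sup>2))"
      by (metis trivial_limit_sequentially)
  qed
  also have "\<dots> \<le> liminf (\<lambda>n. \<integral>\<^sup>+\<xi>. ennreal (exp (- (1 / real (Suc n) * \<xi>)\<^sup>2 / 2) * (cmod (?F \<xi>))\<^sup>2) \<partial>lborel)"
    by (intro nn_integral_liminf) measurable
  also have "\<dots> \<le> ennreal ?R"
    by (intro Liminf_le always_eventually allI bound) auto
  finally show ?thesis .
qed

section \<open>Existence of the Fourier transform on \<open>L\<^sup>2\<close>\<close>

lemma L2_on_UNIV_iff: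
  "L2_on UNIV f \<longleftrightarrow> f \<in> borel_measurable lebesgue \<and> integrable lebesgue (\<lambda>x. (norm (f x))\<^sup>2)"
  by (simp add: L2_on_def lebesgue_on_UNIV_eq)

lemma L2_on_UNIV_borel_iff:
  assumes [measurable]: "f \<in> borel_measurable borel"
  shows "L2_on UNIV f \<longleftrightarrow> integrable lborel (\<lambda>x. (norm (f x))\<^sup>2)"
  unfolding L2_on_UNIV_iff by (subst integrable_completion) (auto intro: measurable_completion)

lemma L2_on_add:
  fixes f g :: "real \<Rightarrow> 'b::{real_normed_vector,second_countable_topology}"
  assumes f: "L2_on UNIV f" and g: "L2_on UNIV g"
  shows "L2_on UNIV (\<lambda>x. f x + g x)"
  unfolding L2_on_UNIV_iff
proof
  have [measurable]: "f \<in> borel_measurable lebesgue" "g \<in> borel_measurable lebesgue"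
    using f g by (auto simp: L2_on_UNIV_iff)
  show m: "(\<lambda>x. f x + g x) \<in> borel_measurable lebesgue" by measurable
  have "integrable lebesgue (\<lambda>x. 2 * (norm (f x))\<^sup>2 + 2 * (norm (g x))\<^sup>2)"
    using f g by (auto simp: L2_on_UNIV_iff)
  then show "integrable lebesgue (\<lambda>x. (norm (f x + g x))\<^sup>2)"
  proof (rule Bochner_Integration.integrable_bound)
    show "AE x in lebesgue. norm ((norm (f x + g x))\<^sup>2) \<le> norm (2 * (norm (f x))\<^sup>2 + 2 * (norm (g x))\<^sup>2)"
    proof (rule AE_I2)
      fix x
      have "(norm (f x + g x))\<^sup>2 \<le> (norm (f x) + norm (g x))\<^sup>2"
        by (intro power_mono norm_triangle_ineq) auto
      also have "\<dots> \<le> 2 * (norm (f x))\<^sup>2 + 2 * (norm (g x))\<^sup>2"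
        using sum_squares_bound[of "norm (f x)" "norm (g x)"] by (simp add: power2_sum)
      finally show "norm ((norm (f x + g x))\<^sup>2) \<le> norm (2 * (norm (f x))\<^sup>2 + 2 * (norm (g x))\<^sup>2)" by simp
    qed
  qed measurable
qed

lemma L2_on_minus:
  fixes f :: "real \<Rightarrow> 'b::{real_normed_vector,second_countable_topology}"
  assumes f: "L2_on UNIV f" shows "L2_on UNIV (\<lambda>x. - f x)"
  using f by (auto simp: L2_on_UNIV_iff)

lemma L2_on_diff:
  fixes f g :: "real \<Rightarrow> 'b::{real_normed_vector,second_countable_topology}"
  assumes f: "L2_on UNIV f" and g: "L2_on UNIV g"
  shows "L2_on UNIV (\<lambda>x. f x - g x)"
  using L2_on_add[OF f L2_on_minus[OF g]] by simp

lemma L2_on_cong_AE: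
  fixes f g :: "real \<Rightarrow> 'b::{real_normed_vector,second_countable_topology}"
  assumes f: "L2_on UNIV f" and g: "g \<in> borel_measurable lebesgue" and ae: "AE x in lebesgue. f x = g x"
  shows "L2_on UNIV g"
  unfolding L2_on_UNIV_iff
proof
  have [measurable]: "f \<in> borel_measurable lebesgue" "g \<in> borel_measurable lebesgue"
    using f g by (auto simp: L2_on_UNIV_iff)
  have "integrable lebesgue (\<lambda>x. (norm (f x))\<^sup>2) \<longleftrightarrow> integrable lebesgue (\<lambda>x. (norm (g x))\<^sup>2)"
    using ae by (intro integrable_cong_AE) auto
  then show "integrable lebesgue (\<lambda>x. (norm (g x))\<^sup>2)" using f by (simp add: L2_on_UNIV_iff)
qed (rule g)

text \<open>Fubini's theorem is applied to products of Borel measures, where a factor that is only Lebesgue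
measurable has to be replaced first.\<close>

lemma L2_on_borel_representative:
  fixes u :: "real \<Rightarrow> real"
  assumes u: "L2_on UNIV u"
  obtains w where "w \<in> borel_measurable borel" "AE x in lebesgue. u x = w x" "L2_on UNIV w"
proof -
  obtain w where w: "w \<in> borel_measurable lborel" "AE x in lborel. u x = w x"
    using completion_ex_borel_measurable_real[of u lborel] u by (auto simp: L2_on_UNIV_iff)
  have "AE x in lebesgue. u x = w x" using w(2) by (rule AE_completion)
  moreover have "w \<in> borel_measurable lebesgue" using w(1) by (rule measurable_completion)
  ultimately show ?thesis using that[of w] w(1) L2_on_cong_AE[OF u] by simp
qed

lemma fourier_integral_cong_AE:
  assumes [measurable]: "u \<in> borel_measurable lebesgue" "w \<in> borel_measurable lebesgue"
    and ae: "AE x in lebesgue. u x = w x"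
  shows "fourier_integral u \<xi> = fourier_integral w \<xi>"
proof -
  have [measurable]: "(\<lambda>x. cis (- (x * \<xi>))) \<in> borel_measurable lebesgue"
    by (rule measurable_completion) measurable
  show ?thesis
    unfolding fourier_integral_def using ae by (intro integral_cong_AE) auto
qed

lemma integrable_truncation:
  fixes u :: "real \<Rightarrow> real"
  assumes [measurable]: "u \<in> borel_measurable borel" and u: "integrable lborel (\<lambda>x. (u x)\<^sup>2)"
  shows "integrable lborel (\<lambda>x. indicator {-R..R} x * u x)"
    and "integrable lborel (\<lambda>x. (indicator {-R..R} x * u x)\<^sup>2)"
proof -
  show "integrable lborel (\<lambda>x. indicator {-R..R} x * u x)"
  proof (rule Cauchy_Schwarz_integral(1))
    have "(norm (indicator {-R..R} x :: real))\<^sup>2 = indicator {-R..R} x" for x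
      by (auto simp: indicator_def)
    then show "integrable lborel (\<lambda>x. (norm (indicator {-R..R} x :: real))\<^sup>2)"
      by (simp del: real_norm_def) (auto intro!: integrable_real_indicator simp: emeasure_lborel_Icc_eq)
  qed (use u in auto)
  show "integrable lborel (\<lambda>x. (indicator {-R..R} x * u x)\<^sup>2)"
    by (rule Bochner_Integration.integrable_bound[OF u]) (auto simp: indicator_def)
qed

lemma fourier_integral_diff:
  assumes u: "integrable lborel u" and w: "integrable lborel w"
  shows "fourier_integral (\<lambda>x. u x - w x) \<xi> = fourier_integral u \<xi> - fourier_integral w \<xi>"
proof -
  have [measurable]: "u \<in> borel_measurable borel" "w \<in> borel_measurable borel"
    using u w by auto
  have "integrable lborel (\<lambda>x. complex_of_real (u x) * cis (- (x * \<xi>)))"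
    "integrable lborel (\<lambda>x. complex_of_real (w x) * cis (- (x * \<xi>)))"
    using integrable_fourier_integrand[OF u, of "- \<xi>" 0] integrable_fourier_integrand[OF w, of "- \<xi>" 0]
    by (simp_all add: mult.commute)
  then show ?thesis
    by (simp add: fourier_integral_eq_lborel left_diff_distrib)
qed

lemma tail_of_L2_tendsto_0:
  fixes u :: "real \<Rightarrow> real"
  assumes [measurable]: "u \<in> borel_measurable borel" and u: "integrable lborel (\<lambda>x. (u x)\<^sup>2)"
  shows "((\<lambda>R. LBINT x. indicator (- {-R..R}) x * (u x)\<^sup>2) \<longlongrightarrow> 0) at_top"
proof -
  have "((\<lambda>R. LBINT x. indicator (- {-R..R}) x * (u x)\<^sup>2) \<longlongrightarrow> (LINT x|(lborel::real measure). 0)) at_top"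
  proof (rule integral_dominated_convergence_at_top[where w = "\<lambda>x. (u x)\<^sup>2"])
    show "AE x in lborel. ((\<lambda>R. indicator (- {-R..R}) x * (u x)\<^sup>2) \<longlongrightarrow> 0) at_top"
    proof (rule AE_I2)
      fix x :: real
      have "\<forall>\<^sub>F R in at_top. \<bar>x\<bar> \<le> R" by (rule eventually_ge_at_top)
      then have "\<forall>\<^sub>F R in at_top. indicator (- {-R..R}) x * (u x)\<^sup>2 = 0"
        by eventually_elim (auto simp: indicator_def)
      then show "((\<lambda>R. indicator (- {-R..R}) x * (u x)\<^sup>2) \<longlongrightarrow> 0) at_top"
        by (rule tendsto_eventually)
    qed
    show "\<forall>\<^sub>F R in at_top. AE x in lborel. norm (indicator (- {-R..R}) x * (u x)\<^sup>2) \<le> (u x)\<^sup>2"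
      by (intro always_eventually allI AE_I2) (auto simp: indicator_def)
  qed (use u in auto)
  then show ?thesis by simp
qed

text \<open>The transforms of two truncations differ by the transform of a piece of the tail of \<open>u\<close>, so Bessel's
inequality makes them Cauchy. The radii \<open>R n\<close> give the rate that almost everywhere convergence needs.\<close>

lemma is_fourier_L2_exists_borel:
  fixes u :: "real \<Rightarrow> real"
  assumes um [measurable]: "u \<in> borel_measurable borel" and u: "integrable lborel (\<lambda>x. (u x)\<^sup>2)"
  shows "\<exists>g. is_fourier_L2 u g"
proof -
  define T where "T = (\<lambda>R x. indicator {-R..R} x * u x)"
  define F where "F = (\<lambda>R. fourier_integral (T R))"
  define tail where "tail = (\<lambda>R. 2 * pi * (LBINT x. indicator (- {-R..R}) x * (u x)\<^sup>2))"
  have Tm [measurable]: "T R \<in> borel_measurable borel" for R unfolding T_def by measurable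
  have Fm [measurable]: "F R \<in> borel_measurable borel" for R unfolding F_def by measurable
  have T1: "integrable lborel (T R)" and T2: "integrable lborel (\<lambda>x. (T R x)\<^sup>2)" for R
    unfolding T_def using integrable_truncation[OF um u] by auto
  have dist: "(\<integral>\<^sup>+\<xi>. ennreal ((cmod (F R \<xi> - F R' \<xi>))\<^sup>2) \<partial>lborel) \<le> ennreal (tail Q)"
    if "Q \<le> R" "Q \<le> R'" for Q R R'
  proof -
    have i: "integrable lborel (\<lambda>x. indicator (- {-Q..Q}) x * (u x)\<^sup>2)"
      by (rule Bochner_Integration.integrable_bound[OF u]) (auto simp: indicator_def)
    have ptw: "(T R x - T R' x)\<^sup>2 \<le> indicator (- {-Q..Q}) x * (u x)\<^sup>2" for x
      using that by (auto simp: T_def indicator_def)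
    have i2: "integrable lborel (\<lambda>x. (T R x - T R' x)\<^sup>2)"
      by (rule Bochner_Integration.integrable_bound[OF i]) (use ptw in \<open>auto intro!: AE_I2 order_trans[OF ptw]\<close>)
    have "(\<integral>\<^sup>+\<xi>. ennreal ((cmod (F R \<xi> - F R' \<xi>))\<^sup>2) \<partial>lborel)
      = (\<integral>\<^sup>+\<xi>. ennreal ((cmod (fourier_integral (\<lambda>x. T R x - T R' x) \<xi>))\<^sup>2) \<partial>lborel)"
      unfolding F_def by (simp add: fourier_integral_diff[OF T1 T1])
    also have "\<dots> \<le> ennreal (2 * pi * (LBINT x. (T R x - T R' x)\<^sup>2))"
      using T1 i2 by (intro Fourier_Bessel_inequality) auto
    also have "\<dots> \<le> ennreal (tail Q)"
      unfolding tail_def by (intro ennreal_leI mult_left_mono integral_mono i i2 ptw) auto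
    finally show ?thesis .
  qed
  have tail0: "(tail \<longlongrightarrow> 0) at_top"
    unfolding tail_def using tendsto_mult_right_zero[OF tail_of_L2_tendsto_0[OF um u]] by simp
  \<comment> \<open>The additional demand \<open>n \<le> R\<close> makes the radii unbounded.\<close>
  have "\<exists>R\<ge>real n. tail R \<le> (1/8)^n" for n
  proof -
    have "\<forall>\<^sub>F R in at_top. tail R < (1/8)^n"
      using tail0 by (intro order_tendstoD(2)) auto
    then have "\<forall>\<^sub>F R in at_top. real n \<le> R \<and> tail R \<le> (1/8)^n"
      using eventually_ge_at_top[of "real n"] by eventually_elim auto
    then show ?thesis unfolding eventually_at_top_linorder by blast
  qed
  then obtain R where R: "\<And>n. R n \<ge> real n" "\<And>n. tail (R n) \<le> (1/8)^n" by metis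
  have "(\<integral>\<^sup>+\<xi>. ennreal ((cmod (F (R (Suc n)) \<xi> - F (R n) \<xi>))\<^sup>2) \<partial>lborel) \<le> ennreal ((1/8)^n)" for n
  proof -
    have "tail (min (R n) (R (Suc n))) \<le> (1/8)^n"
      using R(2)[of n] order_trans[OF R(2)[of "Suc n"] power_decreasing[of n "Suc n" "1/8::real"]]
      by (auto simp: min_def)
    then show ?thesis
      by (intro order_trans[OF dist[of "min (R n) (R (Suc n))"]] ennreal_leI) auto
  qed
  then obtain G where Gm [measurable]: "G \<in> borel_measurable borel"
    and G: "AE \<xi> in lborel. (\<lambda>n. F (R n) \<xi>) \<longlonglongrightarrow> G \<xi>"
    using L2_Cauchy_sequence_converges_AE[of "\<lambda>n. F (R n)" lborel] by auto
  have FG: "(\<integral>\<^sup>+\<xi>. ennreal ((cmod (F Q \<xi> - G \<xi>))\<^sup>2) \<partial>lborel) \<le> ennreal (tail Q)" for Q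
  proof (rule L2_distance_limit_le[OF _ _ _ G])
    obtain N :: nat where "Q \<le> real N" using real_arch_simple by blast
    then have "Q \<le> R n" if "n \<ge> N" for n using R(1)[of n] that by linarith
    then show "\<forall>\<^sub>F n in sequentially. (\<integral>\<^sup>+\<xi>. ennreal ((cmod (F Q \<xi> - F (R n) \<xi>))\<^sup>2) \<partial>lborel) \<le> ennreal (tail Q)"
      by (intro eventually_sequentiallyI[of N] dist) auto
  qed auto
  have L2F: "L2_on UNIV (F 0)"
  proof -
    have "(\<integral>\<^sup>+\<xi>. ennreal ((cmod (F 0 \<xi>))\<^sup>2) \<partial>lborel) < \<infinity>"
      using Fourier_Bessel_inequality[OF T1 T2, of 0] unfolding F_def
      by (rule le_less_trans) simp
    then show ?thesis
      by (auto simp: L2_on_UNIV_borel_iff integrable_iff_bounded)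
  qed
  have L2d: "L2_on UNIV (\<lambda>\<xi>. F 0 \<xi> - G \<xi>)"
  proof -
    have "(\<integral>\<^sup>+\<xi>. ennreal ((cmod (F 0 \<xi> - G \<xi>))\<^sup>2) \<partial>lborel) < \<infinity>"
      using FG[of 0] by (rule le_less_trans) simp
    then show ?thesis
      by (subst L2_on_UNIV_borel_iff) (auto simp: integrable_iff_bounded)
  qed
  have "L2_on UNIV G" using L2_on_diff[OF L2F L2d] by simp
  moreover have "((\<lambda>Q. \<integral>\<^sup>+\<xi>. ennreal ((cmod (fourier_integral (\<lambda>x. indicator {-Q..Q} x * u x) \<xi> - G \<xi>))\<^sup>2)
         \<partial>lebesgue) \<longlongrightarrow> 0) at_top"
  proof (rule tendsto_sandwich[OF _ _ tendsto_const])
    show "\<forall>\<^sub>F Q in at_top. (\<integral>\<^sup>+\<xi>. ennreal ((cmod (fourier_integral (\<lambda>x. indicator {-Q..Q} x * u x) \<xi> - G \<xi>))\<^sup>2)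
         \<partial>lebesgue) \<le> ennreal (tail Q)"
      using FG unfolding F_def T_def by (simp add: nn_integral_completion)
    show "((\<lambda>Q. ennreal (tail Q)) \<longlongrightarrow> 0) at_top"
      using tendsto_ennrealI[OF tail0] by simp
  qed auto
  ultimately show ?thesis unfolding is_fourier_L2_def by blast
qed

theorem is_fourier_L2_fourier_L2:
  assumes u: "L2_on UNIV u"
  shows "is_fourier_L2 u (fourier_L2 u)"
proof -
  obtain w where w: "w \<in> borel_measurable borel" "AE x in lebesgue. u x = w x" "L2_on UNIV w"
    using L2_on_borel_representative[OF u] .
  have meas: "u \<in> borel_measurable lebesgue" "w \<in> borel_measurable lebesgue"
    using u w(3) by (auto simp: L2_on_UNIV_iff)
  have eq: "fourier_integral (\<lambda>x. indicator {-R..R} x * u x) = fourier_integral (\<lambda>x. indicator {-R..R} x * w x)" for R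
    using meas w(2) by (intro ext fourier_integral_cong_AE borel_measurable_times borel_measurable_indicator) auto
  obtain g where "is_fourier_L2 w g"
    using is_fourier_L2_exists_borel[OF w(1)] w(3) by (auto simp: L2_on_UNIV_borel_iff[OF w(1)])
  then have "is_fourier_L2 u g" unfolding is_fourier_L2_def eq .
  then show ?thesis unfolding fourier_L2_def by (rule someI[where P = "is_fourier_L2 u"])
qed

section \<open>Parseval's identity\<close>

lemma integrable_1_over_1_plus_square: "integrable lborel (\<lambda>x::real. 1 / (1 + x\<^sup>2))"
  using integrable_inverse_1_plus_square
  by (simp add: set_integrable_def einterval_def inverse_eq_divide)

lemma borel_measurable_cnj [measurable]: "cnj \<in> borel_measurable borel"
  by (intro borel_measurable_continuous_onI continuous_intros)

text \<open>What the Fourier arguments use of a test function. The power \<open>2\<close> is chosen so that the transform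
stays square-integrable after multiplication by \<open>\<bar>\<xi>\<bar>\<^sup>2\<^sup>s\<close> or \<open>(1 + \<xi>\<^sup>2)\<^sup>s\<^sup>/\<^sup>2\<close>, both at most \<open>1 + \<xi>\<^sup>2\<close>.\<close>

definition fourier_decaying :: "(real \<Rightarrow> real) \<Rightarrow> bool" where
  "fourier_decaying \<psi> \<longleftrightarrow> continuous_on UNIV \<psi> \<and> (\<exists>M. \<forall>x. M < \<bar>x\<bar> \<longrightarrow> \<psi> x = 0) \<and>
     (\<exists>C. \<forall>\<xi>. cmod (fourier_integral \<psi> \<xi>) * (1 + \<xi>\<^sup>2)\<^sup>2 \<le> C)"

lemma fourier_decaying_borel:
  assumes "fourier_decaying \<psi>" shows "\<psi> \<in> borel_measurable borel"
  using assms by (auto simp: fourier_decaying_def intro: borel_measurable_continuous_onI)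

lemma continuous_compact_support_integrable:
  fixes \<psi> :: "real \<Rightarrow> real"
  assumes cont: "continuous_on UNIV \<psi>" and M: "\<And>x. M < \<bar>x\<bar> \<Longrightarrow> \<psi> x = 0"
  shows "integrable lborel \<psi>"
proof -
  have "integrable lborel (\<lambda>x. indicator {-M..M} x *\<^sub>R \<psi> x)"
    using cont by (intro borel_integrable_compact continuous_on_subset[OF cont]) auto
  moreover have "(\<lambda>x. indicator {-M..M} x *\<^sub>R \<psi> x) = \<psi>"
  proof
    show "indicator {-M..M} x *\<^sub>R \<psi> x = \<psi> x" for x
      using M[of x] by (cases "\<bar>x\<bar> \<le> M") (auto simp: indicator_def)
  qed
  ultimately show ?thesis by (simp only:)
qed

lemma fourier_decaying_integrable:
  assumes "fourier_decaying \<psi>"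
  shows "integrable lborel \<psi>" and "integrable lborel (\<lambda>x. (\<psi> x)\<^sup>2)"
proof -
  obtain M where M: "\<And>x. M < \<bar>x\<bar> \<Longrightarrow> \<psi> x = 0" and c: "continuous_on UNIV \<psi>"
    using assms unfolding fourier_decaying_def by blast
  show "integrable lborel \<psi>" by (rule continuous_compact_support_integrable[OF c M])
  show "integrable lborel (\<lambda>x. (\<psi> x)\<^sup>2)"
    using M c by (intro continuous_compact_support_integrable[where M = M] continuous_intros) auto
qed

lemma continuous_compact_support_bounded:
  fixes \<psi> :: "real \<Rightarrow> real"
  assumes cont: "continuous_on UNIV \<psi>" and M: "\<And>x. M < \<bar>x\<bar> \<Longrightarrow> \<psi> x = 0"
  shows "\<exists>B. \<forall>x. \<bar>\<psi> x\<bar> \<le> B"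
proof -
  have "bounded (\<psi> ` {-M..M})"
    by (intro compact_imp_bounded compact_continuous_image continuous_on_subset[OF cont]) auto
  then obtain B where B: "\<forall>x\<in>{-M..M}. \<bar>\<psi> x\<bar> \<le> B"
    unfolding bounded_iff by auto
  have "\<bar>\<psi> x\<bar> \<le> max B 0" for x
  proof (cases "\<bar>x\<bar> \<le> M")
    case True
    then have "\<bar>\<psi> x\<bar> \<le> B" by (intro bspec[OF B]) (auto simp: abs_le_iff)
    then show ?thesis by simp
  qed (use M[of x] in auto)
  then show ?thesis by blast
qed

lemma fourier_decaying_weighted_L2:
  assumes \<psi>: "fourier_decaying \<psi>" and [measurable]: "w \<in> borel_measurable borel"
    and w: "\<And>\<xi>. \<bar>w \<xi>\<bar> \<le> 1 + \<xi>\<^sup>2"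
  shows "L2_on UNIV (\<lambda>\<xi>. complex_of_real (w \<xi>) * fourier_integral \<psi> \<xi>)"
    and "integrable lborel (\<lambda>\<xi>. complex_of_real (w \<xi>) * fourier_integral \<psi> \<xi>)"
proof -
  have [measurable]: "\<psi> \<in> borel_measurable borel" by (rule fourier_decaying_borel[OF \<psi>])
  obtain C where C: "\<And>\<xi>. cmod (fourier_integral \<psi> \<xi>) * (1 + \<xi>\<^sup>2)\<^sup>2 \<le> C"
    using \<psi> unfolding fourier_decaying_def by blast
  have C0: "0 \<le> C" using C[of 0] norm_ge_zero[of "fourier_integral \<psi> 0"] by (simp del: norm_ge_zero)
  have bound: "norm (complex_of_real (w \<xi>) * fourier_integral \<psi> \<xi>) \<le> C * (1 / (1 + \<xi>\<^sup>2))" for \<xi>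
  proof -
    have pos: "0 < 1 + \<xi>\<^sup>2" by (simp add: add_pos_nonneg)
    have "norm (complex_of_real (w \<xi>) * fourier_integral \<psi> \<xi>) * (1 + \<xi>\<^sup>2) = \<bar>w \<xi>\<bar> * (cmod (fourier_integral \<psi> \<xi>) * (1 + \<xi>\<^sup>2))"
      by (simp add: norm_mult)
    also have "\<dots> \<le> (1 + \<xi>\<^sup>2) * (cmod (fourier_integral \<psi> \<xi>) * (1 + \<xi>\<^sup>2))"
      using pos by (intro mult_right_mono w) auto
    also have "\<dots> = cmod (fourier_integral \<psi> \<xi>) * (1 + \<xi>\<^sup>2)\<^sup>2" by (simp add: power2_eq_square)
    also have "\<dots> \<le> C" by (rule C)
    finally show ?thesis using pos by (simp add: pos_le_divide_eq)
  qed
  have i: "integrable lborel (\<lambda>\<xi>::real. C * (1 / (1 + \<xi>\<^sup>2)))"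
    using integrable_1_over_1_plus_square by (rule integrable_mult_right)
  show "integrable lborel (\<lambda>\<xi>. complex_of_real (w \<xi>) * fourier_integral \<psi> \<xi>)"
    by (rule Bochner_Integration.integrable_bound[OF i])
      (measurable, intro AE_I2 order_trans[OF bound], simp add: C0)
  have i2: "integrable lborel (\<lambda>\<xi>::real. C\<^sup>2 * (1 / (1 + \<xi>\<^sup>2)))"
    using integrable_1_over_1_plus_square by (rule integrable_mult_right)
  have "integrable lborel (\<lambda>\<xi>. (norm (complex_of_real (w \<xi>) * fourier_integral \<psi> \<xi>))\<^sup>2)"
  proof (rule Bochner_Integration.integrable_bound[OF i2])
    show "AE \<xi> in lborel. norm ((norm (complex_of_real (w \<xi>) * fourier_integral \<psi> \<xi>))\<^sup>2) \<le> norm (C\<^sup>2 * (1 / (1 + \<xi>\<^sup>2)))"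
    proof (rule AE_I2)
      fix \<xi> :: real
      have "(1 / (1 + \<xi>\<^sup>2))\<^sup>2 \<le> 1 / (1 + \<xi>\<^sup>2)"
        unfolding power2_eq_square[of "1 / (1 + \<xi>\<^sup>2)"] by (intro mult_left_le) (auto simp: add_nonneg_nonneg add_pos_nonneg pos_divide_le_eq)
      then have "(C * (1 / (1 + \<xi>\<^sup>2)))\<^sup>2 \<le> C\<^sup>2 * (1 / (1 + \<xi>\<^sup>2))"
        unfolding power_mult_distrib by (intro mult_left_mono) auto
      then show "norm ((norm (complex_of_real (w \<xi>) * fourier_integral \<psi> \<xi>))\<^sup>2) \<le> norm (C\<^sup>2 * (1 / (1 + \<xi>\<^sup>2)))"
        using power_mono[OF bound[of \<xi>] norm_ge_zero, of 2] by simp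
    qed
  qed measurable
  then show "L2_on UNIV (\<lambda>\<xi>. complex_of_real (w \<xi>) * fourier_integral \<psi> \<xi>)"
    by (subst L2_on_UNIV_borel_iff) auto
qed

lemma fourier_decaying_transform:
  assumes \<psi>: "fourier_decaying \<psi>"
  shows "L2_on UNIV (fourier_integral \<psi>)" and "integrable lborel (fourier_integral \<psi>)"
  using fourier_decaying_weighted_L2[OF \<psi>, of "\<lambda>_. 1"] by simp_all

lemma fourier_decaying_inversion:
  assumes \<psi>: "fourier_decaying \<psi>"
  shows "(LBINT \<xi>. fourier_integral \<psi> \<xi> * cis (y * \<xi>)) = complex_of_real (2 * pi * \<psi> y)"
proof -
  obtain M where M: "\<And>x. M < \<bar>x\<bar> \<Longrightarrow> \<psi> x = 0" and c: "continuous_on UNIV \<psi>"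
    using \<psi> unfolding fourier_decaying_def by blast
  obtain B where B: "\<And>x. \<bar>\<psi> x\<bar> \<le> B"
    using continuous_compact_support_bounded[OF c M] by blast
  show ?thesis
    by (rule Fourier_inversion[OF fourier_decaying_integrable(1)[OF \<psi>] c B fourier_decaying_transform(2)[OF \<psi>]])
qed

text \<open>Fubini's theorem moves the Fourier integral from \<open>u\<close> to \<open>\<psi>\<close>, where the inversion formula applies.\<close>

lemma Parseval_integrable:
  assumes u: "integrable lborel u" and \<psi>: "fourier_decaying \<psi>"
  shows "(LBINT \<xi>. fourier_integral u \<xi> * cnj (fourier_integral \<psi> \<xi>))
      = complex_of_real (2 * pi * (LBINT x. u x * \<psi> x))"
proof -
  have um [measurable]: "u \<in> borel_measurable borel" using u by auto
  have "(LBINT \<xi>. fourier_integral u \<xi> * cnj (fourier_integral \<psi> \<xi>))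
      = (LBINT \<xi>. cnj (fourier_integral \<psi> \<xi>) * (LBINT x. complex_of_real (u x) * cis (- (x * \<xi>))))"
    unfolding fourier_integral_eq_lborel[OF um] by (simp only: mult.commute)
  also have "\<dots> = (LBINT x. complex_of_real (u x) * (LBINT \<xi>. cnj (fourier_integral \<psi> \<xi>) * cis (- (x * \<xi>))))"
    using u fourier_decaying_transform(2)[OF \<psi>] by (intro Fubini_bounded_kernel) auto
  also have "\<dots> = (LBINT x. complex_of_real (2 * pi * (u x * \<psi> x)))"
  proof (intro Bochner_Integration.integral_cong refl)
    fix x
    have "(LBINT \<xi>. cnj (fourier_integral \<psi> \<xi>) * cis (- (x * \<xi>)))
        = (LBINT \<xi>. cnj (fourier_integral \<psi> \<xi> * cis (x * \<xi>)))"
      by (simp only: complex_cnj_mult cis_cnj)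
    also have "\<dots> = cnj (LBINT \<xi>. fourier_integral \<psi> \<xi> * cis (x * \<xi>))"
      by (rule Bochner_Integration.integral_cnj)
    also have "\<dots> = complex_of_real (2 * pi * \<psi> x)"
      unfolding fourier_decaying_inversion[OF \<psi>] by simp
    finally show "complex_of_real (u x) * (LBINT \<xi>. cnj (fourier_integral \<psi> \<xi>) * cis (- (x * \<xi>)))
        = complex_of_real (2 * pi * (u x * \<psi> x))" by simp
  qed
  also have "\<dots> = complex_of_real (LBINT x. 2 * pi * (u x * \<psi> x))"
    by (rule integral_complex_of_real)
  finally show ?thesis by simp
qed

lemma L2_on_fourier_integral:
  assumes u: "integrable lborel u" and u2: "integrable lborel (\<lambda>x. (u x)\<^sup>2)"
  shows "L2_on UNIV (fourier_integral u)"
proof -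
  have [measurable]: "u \<in> borel_measurable borel" using u by auto
  have "(\<integral>\<^sup>+\<xi>. ennreal ((cmod (fourier_integral u \<xi>))\<^sup>2) \<partial>lborel) < \<infinity>"
    using Fourier_Bessel_inequality[OF u u2] by (rule le_less_trans) simp
  then show ?thesis
    by (subst L2_on_UNIV_borel_iff) (auto simp: integrable_iff_bounded)
qed

lemma L2_inner_product:
  fixes f g :: "real \<Rightarrow> complex"
  assumes f: "L2_on UNIV f" and g: "L2_on UNIV g"
  shows "integrable lebesgue (\<lambda>x. f x * cnj (g x))"
    and "norm (LINT x|lebesgue. f x * cnj (g x)) \<le> sqrt (LINT x|lebesgue. (norm (f x))\<^sup>2) * sqrt (LINT x|lebesgue. (norm (g x))\<^sup>2)"
proof -
  have [measurable]: "f \<in> borel_measurable lebesgue" "g \<in> borel_measurable lebesgue"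
    using f g by (auto simp: L2_on_UNIV_iff)
  have m: "f \<in> borel_measurable lebesgue" "(\<lambda>x. cnj (g x)) \<in> borel_measurable lebesgue"
    by measurable
  have i: "integrable lebesgue (\<lambda>x. (norm (f x))\<^sup>2)" "integrable lebesgue (\<lambda>x. (norm (cnj (g x)))\<^sup>2)"
    using f g by (auto simp: L2_on_UNIV_iff)
  show "integrable lebesgue (\<lambda>x. f x * cnj (g x))"
    by (rule Cauchy_Schwarz_integral(1)[OF m i])
  show "norm (LINT x|lebesgue. f x * cnj (g x)) \<le> sqrt (LINT x|lebesgue. (norm (f x))\<^sup>2) * sqrt (LINT x|lebesgue. (norm (g x))\<^sup>2)"
    using Cauchy_Schwarz_integral(2)[OF m i] by simp
qed

text \<open>Once \<open>[-R,R]\<close> contains the support of \<open>\<psi>\<close>, truncation does not change the pairing with \<open>\<psi>\<close>. Hence the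
limit \<open>R \<rightarrow> \<infinity>\<close> in \<open>Parseval_L2\<close> concerns the Fourier side only.\<close>

lemma truncated_transform:
  assumes u: "L2_on UNIV u"
  shows "L2_on UNIV (fourier_integral (\<lambda>x. indicator {-R..R} x * u x))"
    and "fourier_decaying \<psi> \<Longrightarrow> (\<And>x. R < \<bar>x\<bar> \<Longrightarrow> \<psi> x = 0) \<Longrightarrow>
      (LINT \<xi>|lebesgue. fourier_integral (\<lambda>x. indicator {-R..R} x * u x) \<xi> * cnj (fourier_integral \<psi> \<xi>))
      = complex_of_real (2 * pi * (LINT x|lebesgue. u x * \<psi> x))"
proof -
  obtain w where w [measurable]: "w \<in> borel_measurable borel" and uw: "AE x in lebesgue. u x = w x" and w2: "L2_on UNIV w"
    using L2_on_borel_representative[OF u] .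
  have meas [measurable]: "u \<in> borel_measurable lebesgue" "w \<in> borel_measurable lebesgue"
    using u w2 by (auto simp: L2_on_UNIV_iff)
  have eq: "fourier_integral (\<lambda>x. indicator {-R..R} x * u x) = fourier_integral (\<lambda>x. indicator {-R..R} x * w x)"
    using meas uw by (intro ext fourier_integral_cong_AE borel_measurable_times borel_measurable_indicator) auto
  have w2': "integrable lborel (\<lambda>x. (w x)\<^sup>2)" using w2 by (simp add: L2_on_UNIV_borel_iff[OF w])
  note T = integrable_truncation[OF w w2']
  show "L2_on UNIV (fourier_integral (\<lambda>x. indicator {-R..R} x * u x))"
    unfolding eq by (rule L2_on_fourier_integral[OF T])
  assume \<psi>: "fourier_decaying \<psi>" and van: "\<And>x. R < \<bar>x\<bar> \<Longrightarrow> \<psi> x = 0"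
  have [measurable]: "\<psi> \<in> borel_measurable borel" by (rule fourier_decaying_borel[OF \<psi>])
  then have [measurable]: "\<psi> \<in> borel_measurable lebesgue" by (intro measurable_completion) simp
  have "(LINT \<xi>|lebesgue. fourier_integral (\<lambda>x. indicator {-R..R} x * u x) \<xi> * cnj (fourier_integral \<psi> \<xi>))
     = (LBINT \<xi>. fourier_integral (\<lambda>x. indicator {-R..R} x * w x) \<xi> * cnj (fourier_integral \<psi> \<xi>))"
    unfolding eq by (rule integral_completion) measurable
  also have "\<dots> = complex_of_real (2 * pi * (LBINT x. indicator {-R..R} x * w x * \<psi> x))"
    by (rule Parseval_integrable[OF T(1) \<psi>])
  also have "(LBINT x. indicator {-R..R} x * w x * \<psi> x) = (LBINT x. w x * \<psi> x)"
  proof (intro Bochner_Integration.integral_cong refl)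
    show "indicator {-R..R} x * w x * \<psi> x = w x * \<psi> x" for x
      using van[of x] by (cases "\<bar>x\<bar> \<le> R") (auto simp: indicator_def)
  qed
  also have "\<dots> = (LINT x|lebesgue. w x * \<psi> x)"
    by (rule integral_completion[symmetric]) measurable
  also have "\<dots> = (LINT x|lebesgue. u x * \<psi> x)"
    using uw by (intro integral_cong_AE) auto
  finally show "(LINT \<xi>|lebesgue. fourier_integral (\<lambda>x. indicator {-R..R} x * u x) \<xi> * cnj (fourier_integral \<psi> \<xi>))
      = complex_of_real (2 * pi * (LINT x|lebesgue. u x * \<psi> x))" .
qed

lemma is_fourier_L2_norm_tendsto:
  assumes u: "L2_on UNIV u" and g: "is_fourier_L2 u g"
  shows "((\<lambda>R. LINT \<xi>|lebesgue. (cmod (fourier_integral (\<lambda>x. indicator {-R..R} x * u x) \<xi> - g \<xi>))\<^sup>2) \<longlongrightarrow> 0) at_top"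
proof -
  have gL: "L2_on UNIV g" using g by (simp add: is_fourier_L2_def)
  have "(LINT \<xi>|lebesgue. (cmod (fourier_integral (\<lambda>x. indicator {-R..R} x * u x) \<xi> - g \<xi>))\<^sup>2)
      = enn2real (\<integral>\<^sup>+\<xi>. ennreal ((cmod (fourier_integral (\<lambda>x. indicator {-R..R} x * u x) \<xi> - g \<xi>))\<^sup>2) \<partial>lebesgue)" for R
    using L2_on_diff[OF truncated_transform(1)[OF u] gL, of R]
    by (intro integral_eq_nn_integral) (auto simp: L2_on_UNIV_iff)
  then show ?thesis
    using tendsto_enn2real[where l = 0 and F = at_top and u = "\<lambda>R. \<integral>\<^sup>+\<xi>. ennreal ((cmod (fourier_integral (\<lambda>x. indicator {-R..R} x * u x) \<xi> - g \<xi>))\<^sup>2) \<partial>lebesgue"] g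
    by (simp add: is_fourier_L2_def)
qed

text \<open>The pairing of the truncated transforms with \<open>\<psi>\<close> is eventually constant, and the truncated transforms
converge in \<open>L\<^sup>2\<close>.\<close>

theorem Parseval_L2:
  assumes u: "L2_on UNIV u" and g: "is_fourier_L2 u g" and \<psi>: "fourier_decaying \<psi>"
  shows "(LINT \<xi>|lebesgue. g \<xi> * cnj (fourier_integral \<psi> \<xi>)) = complex_of_real (2 * pi * (LINT x|lebesgue. u x * \<psi> x))"
proof -
  have gL: "L2_on UNIV g" using g by (simp add: is_fourier_L2_def)
  note \<psi>L = fourier_decaying_transform(1)[OF \<psi>]
  obtain M where M: "\<And>x. M < \<bar>x\<bar> \<Longrightarrow> \<psi> x = 0"
    using \<psi> unfolding fourier_decaying_def by blast
  let ?F = "\<lambda>R. fourier_integral (\<lambda>x. indicator {-R..R} x * u x)"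
  let ?D = "complex_of_real (2 * pi * (LINT x|lebesgue. u x * \<psi> x)) - (LINT \<xi>|lebesgue. g \<xi> * cnj (fourier_integral \<psi> \<xi>))"
  let ?K = "sqrt (LINT x|lebesgue. (norm (fourier_integral \<psi> x))\<^sup>2)"
  have bound: "norm ?D \<le> sqrt (LINT \<xi>|lebesgue. (cmod (?F R \<xi> - g \<xi>))\<^sup>2) * ?K" if "M \<le> R" for R
  proof -
    note FL = truncated_transform(1)[OF u, of R]
    have "?D = (LINT \<xi>|lebesgue. ?F R \<xi> * cnj (fourier_integral \<psi> \<xi>)) - (LINT \<xi>|lebesgue. g \<xi> * cnj (fourier_integral \<psi> \<xi>))"
      using that by (subst truncated_transform(2)[OF u \<psi>]) (auto intro: M)
    also have "\<dots> = (LINT \<xi>|lebesgue. (?F R \<xi> - g \<xi>) * cnj (fourier_integral \<psi> \<xi>))"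
      using L2_inner_product(1)[OF FL \<psi>L] L2_inner_product(1)[OF gL \<psi>L] by (simp add: left_diff_distrib)
    finally show ?thesis
      using L2_inner_product(2)[OF L2_on_diff[OF FL gL] \<psi>L] by simp
  qed
  have "((\<lambda>R. sqrt (LINT \<xi>|lebesgue. (cmod (?F R \<xi> - g \<xi>))\<^sup>2) * ?K) \<longlongrightarrow> sqrt 0 * ?K) at_top"
    by (intro tendsto_intros is_fourier_L2_norm_tendsto[OF u g])
  then have "norm ?D \<le> sqrt 0 * ?K"
    by (rule tendsto_lowerbound) (use bound in \<open>auto intro: eventually_at_top_linorderI[of M]\<close>)
  then show ?thesis by simp
qed

lemma is_fourier_L2_unique:
  assumes u: "L2_on UNIV u" and g: "is_fourier_L2 u g" and h: "is_fourier_L2 u h"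
  shows "AE \<xi> in lebesgue. g \<xi> = h \<xi>"
proof -
  let ?F = "\<lambda>R. fourier_integral (\<lambda>x. indicator {-R..R} x * u x)"
  have L: "L2_on UNIV g" "L2_on UNIV h" using g h by (auto simp: is_fourier_L2_def)
  note gh = L2_on_diff[OF L]
  let ?n = "\<lambda>f. LINT \<xi>|lebesgue. (cmod (f \<xi>))\<^sup>2"
  have "?n (\<lambda>\<xi>. g \<xi> - h \<xi>) \<le> 2 * ?n (\<lambda>\<xi>. ?F R \<xi> - g \<xi>) + 2 * ?n (\<lambda>\<xi>. ?F R \<xi> - h \<xi>)" for R
  proof -
    note FL = truncated_transform(1)[OF u, of R]
    have i: "integrable lebesgue (\<lambda>\<xi>. (cmod (?F R \<xi> - g \<xi>))\<^sup>2)" "integrable lebesgue (\<lambda>\<xi>. (cmod (?F R \<xi> - h \<xi>))\<^sup>2)"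
      "integrable lebesgue (\<lambda>\<xi>. (cmod (g \<xi> - h \<xi>))\<^sup>2)"
      using L2_on_diff[OF FL L(1)] L2_on_diff[OF FL L(2)] gh by (auto simp: L2_on_UNIV_iff)
    have "?n (\<lambda>\<xi>. g \<xi> - h \<xi>) \<le> (LINT \<xi>|lebesgue. 2 * (cmod (?F R \<xi> - g \<xi>))\<^sup>2 + 2 * (cmod (?F R \<xi> - h \<xi>))\<^sup>2)"
    proof (intro integral_mono)
      fix \<xi>
      have "cmod (g \<xi> - h \<xi>) \<le> cmod (?F R \<xi> - h \<xi>) + cmod (?F R \<xi> - g \<xi>)"
        using norm_triangle_ineq4[of "?F R \<xi> - h \<xi>" "?F R \<xi> - g \<xi>"] by simp
      then have "(cmod (g \<xi> - h \<xi>))\<^sup>2 \<le> (cmod (?F R \<xi> - h \<xi>) + cmod (?F R \<xi> - g \<xi>))\<^sup>2"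
        by (intro power_mono) auto
      also have "\<dots> \<le> 2 * (cmod (?F R \<xi> - g \<xi>))\<^sup>2 + 2 * (cmod (?F R \<xi> - h \<xi>))\<^sup>2"
        using sum_squares_bound[of "cmod (?F R \<xi> - h \<xi>)" "cmod (?F R \<xi> - g \<xi>)"] by (simp add: power2_sum)
      finally show "(cmod (g \<xi> - h \<xi>))\<^sup>2 \<le> 2 * (cmod (?F R \<xi> - g \<xi>))\<^sup>2 + 2 * (cmod (?F R \<xi> - h \<xi>))\<^sup>2" .
    qed (use i in auto)
    then show ?thesis using i by simp
  qed
  moreover have "((\<lambda>R. 2 * ?n (\<lambda>\<xi>. ?F R \<xi> - g \<xi>) + 2 * ?n (\<lambda>\<xi>. ?F R \<xi> - h \<xi>)) \<longlongrightarrow> 2 * 0 + 2 * 0) at_top"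
    by (intro tendsto_intros is_fourier_L2_norm_tendsto[OF u g] is_fourier_L2_norm_tendsto[OF u h])
  ultimately have "?n (\<lambda>\<xi>. g \<xi> - h \<xi>) \<le> 2 * 0 + 2 * 0"
    by (intro tendsto_lowerbound[where f = "\<lambda>R. 2 * ?n (\<lambda>\<xi>. ?F R \<xi> - g \<xi>) + 2 * ?n (\<lambda>\<xi>. ?F R \<xi> - h \<xi>)" and F = at_top]) auto
  moreover have "0 \<le> ?n (\<lambda>\<xi>. g \<xi> - h \<xi>)" by (intro Bochner_Integration.integral_nonneg) auto
  ultimately have "?n (\<lambda>\<xi>. g \<xi> - h \<xi>) = 0" by simp
  then have "AE \<xi> in lebesgue. (cmod (g \<xi> - h \<xi>))\<^sup>2 = 0"
    using gh by (subst (asm) integral_nonneg_eq_0_iff_AE) (auto simp: L2_on_UNIV_iff)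
  then show ?thesis by eventually_elim simp
qed

text \<open>The representative \<^const>\<open>fourier_L2\<close> is a choice, so linearity holds only almost everywhere and has to
pass through uniqueness.\<close>

lemma fourier_L2_diff_AE:
  assumes u: "L2_on UNIV u" and \<psi>: "fourier_decaying \<psi>"
  shows "AE \<xi> in lebesgue. fourier_L2 (\<lambda>x. \<psi> x - u x) \<xi> = fourier_integral \<psi> \<xi> - fourier_L2 u \<xi>"
proof -
  have \<psi>L: "L2_on UNIV \<psi>"
    using fourier_decaying_integrable(2)[OF \<psi>] by (simp add: L2_on_UNIV_borel_iff fourier_decaying_borel[OF \<psi>])
  note d = L2_on_diff[OF \<psi>L u]
  note k = is_fourier_L2_fourier_L2[OF d]
  note g = is_fourier_L2_fourier_L2[OF u]
  have L: "L2_on UNIV (fourier_L2 (\<lambda>x. \<psi> x - u x))" "L2_on UNIV (fourier_L2 u)"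
    using k g by (auto simp: is_fourier_L2_def)
  note hL = L2_on_diff[OF fourier_decaying_transform(1)[OF \<psi>] L(2)]
  obtain M where M: "\<And>x. M < \<bar>x\<bar> \<Longrightarrow> \<psi> x = 0"
    using \<psi> unfolding fourier_decaying_def by blast
  have "fourier_integral (\<lambda>x. indicator {-R..R} x * (\<psi> x - u x)) \<xi>
     = fourier_integral \<psi> \<xi> - fourier_integral (\<lambda>x. indicator {-R..R} x * u x) \<xi>" if R: "M \<le> R" for R \<xi>
  proof -
    obtain w where w [measurable]: "w \<in> borel_measurable borel" and uw: "AE x in lebesgue. u x = w x" and w2: "L2_on UNIV w"
      using L2_on_borel_representative[OF u] .
    have meas: "u \<in> borel_measurable lebesgue" "w \<in> borel_measurable lebesgue" "\<psi> \<in> borel_measurable lebesgue"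
      using u w2 \<psi>L by (auto simp: L2_on_UNIV_iff)
    have w2': "integrable lborel (\<lambda>x. (w x)\<^sup>2)" using w2 by (simp add: L2_on_UNIV_borel_iff[OF w])
    have "fourier_integral (\<lambda>x. indicator {-R..R} x * (\<psi> x - u x)) \<xi> = fourier_integral (\<lambda>x. \<psi> x - indicator {-R..R} x * w x) \<xi>"
    proof (rule fourier_integral_cong_AE)
      show "AE x in lebesgue. indicator {-R..R} x * (\<psi> x - u x) = \<psi> x - indicator {-R..R} x * w x"
        using uw
      proof eventually_elim
        fix x assume "u x = w x"
        then show "indicator {-R..R} x * (\<psi> x - u x) = \<psi> x - indicator {-R..R} x * w x"
          using R M[of x] by (cases "\<bar>x\<bar> \<le> R") (auto simp: indicator_def)
      qed
    qed (use meas in \<open>auto intro!: borel_measurable_times borel_measurable_diff borel_measurable_indicator\<close>)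
    also have "\<dots> = fourier_integral \<psi> \<xi> - fourier_integral (\<lambda>x. indicator {-R..R} x * w x) \<xi>"
      by (rule fourier_integral_diff[OF fourier_decaying_integrable(1)[OF \<psi>] integrable_truncation(1)[OF w w2']])
    also have "fourier_integral (\<lambda>x. indicator {-R..R} x * w x) \<xi> = fourier_integral (\<lambda>x. indicator {-R..R} x * u x) \<xi>"
      using meas uw by (intro fourier_integral_cong_AE borel_measurable_times borel_measurable_indicator) auto
    finally show ?thesis .
  qed
  then have ev: "\<forall>\<^sub>F R in at_top. (\<integral>\<^sup>+\<xi>. ennreal ((cmod (fourier_integral (\<lambda>x. indicator {-R..R} x * u x) \<xi> - fourier_L2 u \<xi>))\<^sup>2) \<partial>lebesgue)
      = (\<integral>\<^sup>+\<xi>. ennreal ((cmod (fourier_integral (\<lambda>x. indicator {-R..R} x * (\<psi> x - u x)) \<xi> - (fourier_integral \<psi> \<xi> - fourier_L2 u \<xi>)))\<^sup>2) \<partial>lebesgue)"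
    by (intro eventually_at_top_linorderI[of M]) (simp add: norm_minus_commute)
  have "is_fourier_L2 (\<lambda>x. \<psi> x - u x) (\<lambda>\<xi>. fourier_integral \<psi> \<xi> - fourier_L2 u \<xi>)"
    unfolding is_fourier_L2_def using hL g Lim_transform_eventually[OF _ ev] by (auto simp: is_fourier_L2_def)
  then show ?thesis by (rule is_fourier_L2_unique[OF d k])
qed

section \<open>Smooth functions, bumps and test functions\<close>

definition smooth :: "(real \<Rightarrow> real) \<Rightarrow> bool" where
  "smooth f \<longleftrightarrow> (\<forall>n x. (deriv ^^ n) f field_differentiable at x)"

text \<open>A coinduction principle: it avoids formulas for higher derivatives.\<close>

lemma smooth_if_in_deriv_closed_class:
  assumes "f \<in> S" and diff: "\<And>f x. f \<in> S \<Longrightarrow> f field_differentiable at x"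
    and closed: "\<And>f. f \<in> S \<Longrightarrow> deriv f \<in> S"
  shows "smooth f"
proof -
  have "(deriv ^^ n) f \<in> S" for n using assms(1) closed by (induction n) auto
  then show ?thesis unfolding smooth_def using diff by blast
qed

lemma smooth_deriv_funpow: "smooth f \<Longrightarrow> smooth ((deriv ^^ n) f)"
  unfolding smooth_def funpow_add[THEN fun_cong, unfolded o_apply, symmetric] by blast

lemma smooth_deriv: "smooth f \<Longrightarrow> smooth (deriv f)"
  using smooth_deriv_funpow[of f 1] by simp

lemma smooth_DERIV: "smooth f \<Longrightarrow> (f has_real_derivative deriv f x) (at x)"
  unfolding smooth_def by (metis DERIV_deriv_iff_field_differentiable funpow_0)

lemma smooth_continuous: "smooth f \<Longrightarrow> continuous_on A f"
  by (meson DERIV_isCont continuous_at_imp_continuous_on smooth_DERIV)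

lemma smooth_affine:
  assumes "smooth f" shows "smooth (\<lambda>x. f (c * x + d))"
proof (rule smooth_if_in_deriv_closed_class)
  let ?S = "{h. \<exists>k f. smooth f \<and> h = (\<lambda>x. k * f (c * x + d))}"
  show "(\<lambda>x. f (c * x + d)) \<in> ?S" using assms by (auto intro!: exI[of _ 1] exI[of _ f])
  have der: "((\<lambda>x. k * f (c * x + d)) has_real_derivative (k * c) * deriv f (c * x + d)) (at x)" if "smooth f" for k f x
    by (auto intro!: derivative_eq_intros DERIV_chain2[OF smooth_DERIV[OF that]])
  fix h assume "h \<in> ?S"
  then obtain k f where f: "smooth f" and h: "h = (\<lambda>x. k * f (c * x + d))" by blast
  show "h field_differentiable at x" for x
    unfolding h using der[OF f, of k x] by (auto simp: field_differentiable_def)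
  have "deriv h = (\<lambda>x. (k * c) * deriv f (c * x + d))"
    unfolding h by (rule ext) (rule DERIV_imp_deriv[OF der[OF f]])
  with smooth_deriv[OF f] show "deriv h \<in> ?S" by blast
qed

text \<open>By the Leibniz rule, sums of products of smooth functions are closed under differentiation, although
the products alone are not.\<close>

inductive_set products_of_smooth :: "(real \<Rightarrow> real) set" where
  prod: "smooth f \<Longrightarrow> smooth g \<Longrightarrow> (\<lambda>x. f x * g x) \<in> products_of_smooth"
| sum: "a \<in> products_of_smooth \<Longrightarrow> b \<in> products_of_smooth \<Longrightarrow> (\<lambda>x. a x + b x) \<in> products_of_smooth"

lemma products_of_smooth_DERIV:
  assumes "a \<in> products_of_smooth"
  shows "\<exists>a'\<in>products_of_smooth. \<forall>x. (a has_real_derivative a' x) (at x)"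
  using assms
proof induction
  case (prod f g)
  let ?a' = "\<lambda>x. deriv f x * g x + f x * deriv g x"
  have "?a' \<in> products_of_smooth"
    using prod smooth_deriv by (intro products_of_smooth.intros) auto
  moreover have "\<forall>x. ((\<lambda>x. f x * g x) has_real_derivative ?a' x) (at x)"
    using smooth_DERIV[OF prod(1)] smooth_DERIV[OF prod(2)]
    by (auto intro!: derivative_eq_intros)
  ultimately show ?case by (intro bexI[where x = ?a'])
next
  case (sum a b)
  then obtain a' b' where "a' \<in> products_of_smooth" "b' \<in> products_of_smooth"
    and d: "\<And>x. (a has_real_derivative a' x) (at x)" "\<And>x. (b has_real_derivative b' x) (at x)" by blast
  then have "(\<lambda>x. a' x + b' x) \<in> products_of_smooth" by (intro products_of_smooth.sum)
  moreover have "\<forall>x. ((\<lambda>x. a x + b x) has_real_derivative a' x + b' x) (at x)"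
    using d by (auto intro!: derivative_eq_intros)
  ultimately show ?case by (intro bexI[where x = "\<lambda>x. a' x + b' x"])
qed

lemma smooth_mult:
  assumes "smooth f" "smooth g" shows "smooth (\<lambda>x. f x * g x)"
proof (rule smooth_if_in_deriv_closed_class[of _ products_of_smooth])
  show "(\<lambda>x. f x * g x) \<in> products_of_smooth" using assms by (rule products_of_smooth.prod)
  fix a assume "a \<in> products_of_smooth"
  then obtain a' where a': "a' \<in> products_of_smooth" "\<And>x. (a has_real_derivative a' x) (at x)"
    using products_of_smooth_DERIV by blast
  then show "a field_differentiable at x" for x by (auto simp: field_differentiable_def)
  have "deriv a = a'" using a'(2) by (intro ext DERIV_imp_deriv)
  then show "deriv a \<in> products_of_smooth" using a'(1) by simp
qed

definition flat_exp :: "real \<Rightarrow> real" where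
  "flat_exp x = (if 0 < x then exp (- (1 / x)) else 0)"

lemma poly_times_exp_minus_tendsto_0: "((\<lambda>y::real. poly p y * exp (- y)) \<longlongrightarrow> 0) at_top"
proof -
  have "((\<lambda>y::real. \<Sum>i\<le>degree p. coeff p i * (y ^ i / exp y)) \<longlongrightarrow> (\<Sum>i\<le>degree p. coeff p i * 0)) at_top"
    by (intro tendsto_intros tendsto_power_div_exp_0)
  then show ?thesis
    by (simp add: poly_altdef sum_distrib_right exp_minus divide_inverse mult.assoc)
qed

text \<open>All derivatives of \<open>exp (-1/x)\<close> are polynomials in \<open>1/x\<close> times \<open>exp (-1/x)\<close>. At the origin the
exponential beats the polynomial.\<close>

lemma flat_poly_DERIV:
  fixes p :: "real poly"
  shows "((\<lambda>x. if 0 < x then poly p (1 / x) * exp (- (1 / x)) else 0) has_real_derivative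
     (if 0 < x then poly ([:0, 0, 1:] * (p - pderiv p)) (1 / x) * exp (- (1 / x)) else 0)) (at x)"
    (is "(?f has_real_derivative ?f' x) (at x)")
proof -
  consider "0 < x" | "x < 0" | "x = 0" by linarith
  then show ?thesis
  proof cases
    case 1
    have "((\<lambda>x. poly p (1 / x) * exp (- (1 / x))) has_real_derivative ?f' x) (at x)"
      using 1 by (auto intro!: derivative_eq_intros DERIV_chain2[OF poly_DERIV]
          simp: power2_eq_square algebra_simps)
    then show ?thesis
      by (rule DERIV_cong_ev[THEN iffD1, OF refl _ refl, rotated])
        (use 1 in \<open>auto intro!: eventually_mono[OF eventually_nhds_in_open[of "{0<..}"]]\<close>)
  next
    case 2
    have "((\<lambda>_. 0) has_real_derivative ?f' x) (at x)" using 2 by simp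
    then show ?thesis
      by (rule DERIV_cong_ev[THEN iffD1, OF refl _ refl, rotated])
        (use 2 in \<open>auto intro!: eventually_mono[OF eventually_nhds_in_open[of "{..<0}"]]\<close>)
  next
    case 3
    have r: "((\<lambda>h. ?f h / h) \<longlongrightarrow> 0) (at_right 0)"
    proof -
      have "((\<lambda>h. poly ([:0, 1:] * p) (inverse h) * exp (- inverse h)) \<longlongrightarrow> 0) (at_right (0::real))"
        by (rule filterlim_compose[OF poly_times_exp_minus_tendsto_0 filterlim_inverse_at_top_right])
      then show ?thesis
      proof (rule Lim_transform_eventually)
        show "\<forall>\<^sub>F h in at_right 0. poly ([:0, 1:] * p) (inverse h) * exp (- inverse h) = ?f h / h"
          using eventually_at_right_less[of "0::real"]
          by eventually_elim (simp add: inverse_eq_divide)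
      qed
    qed
    have l: "((\<lambda>h. ?f h / h) \<longlongrightarrow> 0) (at_left 0)"
    proof (rule tendsto_eventually)
      have "\<forall>\<^sub>F h in at_left 0. h < (0::real)" by (simp add: eventually_at_filter)
      then show "\<forall>\<^sub>F h in at_left 0. ?f h / h = 0" by eventually_elim simp
    qed
    have "((\<lambda>h. ?f h / h) \<longlongrightarrow> 0) (at 0)" using l r by (simp add: filterlim_split_at)
    then have "((\<lambda>h. (?f (0 + h) - ?f 0) / h) \<longlongrightarrow> 0) (at 0)"
      by (simp only: add_0_left less_irrefl if_False diff_zero)
    then show ?thesis unfolding 3 DERIV_def by simp
  qed
qed

lemma smooth_flat_exp: "smooth flat_exp"
proof (rule smooth_if_in_deriv_closed_class)
  let ?S = "{f. \<exists>p::real poly. f = (\<lambda>x. if 0 < x then poly p (1 / x) * exp (- (1 / x)) else 0)}"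
  show "flat_exp \<in> ?S" by (auto intro!: exI[of _ 1] simp: flat_exp_def fun_eq_iff)
  fix f assume "f \<in> ?S"
  then obtain p :: "real poly" where f: "f = (\<lambda>x. if 0 < x then poly p (1 / x) * exp (- (1 / x)) else 0)" by blast
  show "f field_differentiable at x" for x
    unfolding f field_differentiable_def using flat_poly_DERIV[of p x] by blast
  have "deriv f = (\<lambda>x. if 0 < x then poly ([:0, 0, 1:] * (p - pderiv p)) (1 / x) * exp (- (1 / x)) else 0)"
    unfolding f by (rule ext) (rule DERIV_imp_deriv[OF flat_poly_DERIV])
  then show "deriv f \<in> ?S" by blast
qed

lemma flat_exp_bounds: "0 \<le> flat_exp x" "flat_exp x \<le> 1"
  by (auto simp: flat_exp_def)

text \<open>With growing \<open>n\<close> these bumps approach the indicator function of \<open>(a,b)\<close>, because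
\<open>exp (-1/(n y)) \<rightarrow> 1\<close> for every \<open>y > 0\<close>.\<close>

definition smooth_plateau :: "real \<Rightarrow> real \<Rightarrow> nat \<Rightarrow> real \<Rightarrow> real" where
  "smooth_plateau a b n x = flat_exp (real (Suc n) * (x - a)) * flat_exp (real (Suc n) * (b - x))"

lemma smooth_plateau_smooth: "smooth (smooth_plateau a b n)"
proof -
  have "smooth_plateau a b n = (\<lambda>x. flat_exp (real (Suc n) * x + - real (Suc n) * a) * flat_exp (- real (Suc n) * x + real (Suc n) * b))"
    unfolding smooth_plateau_def by (simp add: fun_eq_iff algebra_simps)
  then show ?thesis
    by (simp only:) (intro smooth_mult smooth_affine smooth_flat_exp)
qed

lemma smooth_plateau_eq_0: "x \<notin> {a<..<b} \<Longrightarrow> smooth_plateau a b n x = 0"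
  by (auto simp: smooth_plateau_def flat_exp_def zero_less_mult_iff)

lemma smooth_plateau_pos: "x \<in> {a<..<b} \<Longrightarrow> 0 < smooth_plateau a b n x"
  by (auto simp: smooth_plateau_def flat_exp_def)

lemma smooth_plateau_bounded: "\<bar>smooth_plateau a b n x\<bar> \<le> 1"
  unfolding smooth_plateau_def abs_mult using flat_exp_bounds
  by (intro mult_le_one) auto

lemma flat_exp_scaled_tendsto_1:
  assumes "0 < y" shows "(\<lambda>n. flat_exp (real (Suc n) * y)) \<longlonglongrightarrow> 1"
proof -
  have "(\<lambda>n. exp (- (inverse (real (Suc n)) * (1 / y)))) \<longlonglongrightarrow> exp (- (0 * (1 / y)))"
    by (intro tendsto_intros LIMSEQ_inverse_real_of_nat)
  moreover have "flat_exp (real (Suc n) * y) = exp (- (inverse (real (Suc n)) * (1 / y)))" for n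
  proof -
    have "0 < real (Suc n) * y" using assms by simp
    then show ?thesis by (simp only: flat_exp_def if_True inverse_eq_divide times_divide_times_eq mult_1)
  qed
  ultimately show ?thesis by simp
qed

lemma smooth_plateau_tendsto_indicator:
  "(\<lambda>n. smooth_plateau a b n x) \<longlonglongrightarrow> indicator {a<..<b} x"
proof (cases "x \<in> {a<..<b}")
  case True
  then have "(\<lambda>n. smooth_plateau a b n x) \<longlonglongrightarrow> 1 * 1"
    unfolding smooth_plateau_def by (intro tendsto_mult flat_exp_scaled_tendsto_1) auto
  then show ?thesis using True by simp
qed (simp add: smooth_plateau_eq_0)

lemma test_functions_iff:
  "\<phi> \<in> test_functions \<Omega> \<longleftrightarrow> smooth \<phi> \<and> (\<exists>K. compact K \<and> K \<subseteq> \<Omega> \<and> (\<forall>x. x \<notin> K \<longrightarrow> \<phi> x = 0))"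
  by (simp add: test_functions_def smooth_def)

lemma deriv_funpow_eq_0_off_closed:
  assumes "closed K" and "\<And>x. x \<notin> K \<Longrightarrow> f x = 0" and "x \<notin> K"
  shows "(deriv ^^ n) f x = (0::real)"
  using assms(3)
proof (induction n arbitrary: x)
  case (Suc n)
  have "\<forall>\<^sub>F y in nhds x. y \<in> - K"
    using assms(1) Suc.prems by (intro eventually_nhds_in_open) auto
  then have "\<forall>\<^sub>F y in nhds x. (deriv ^^ n) f y = 0"
    by eventually_elim (use Suc.IH in auto)
  then have "deriv ((deriv ^^ n) f) x = deriv (\<lambda>_. 0) x"
    by (intro deriv_cong_ev) auto
  then show ?case by simp
qed (use assms in auto)

lemma test_functions_deriv_funpow:
  assumes "\<phi> \<in> test_functions \<Omega>" shows "(deriv ^^ n) \<phi> \<in> test_functions \<Omega>"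
proof -
  obtain K where K: "compact K" "K \<subseteq> \<Omega>" "\<And>x. x \<notin> K \<Longrightarrow> \<phi> x = 0" and s: "smooth \<phi>"
    using assms unfolding test_functions_iff by blast
  have "\<forall>x. x \<notin> K \<longrightarrow> (deriv ^^ n) \<phi> x = 0"
    using deriv_funpow_eq_0_off_closed[where f = \<phi>, OF compact_imp_closed[OF K(1)] K(3)] by blast
  with K(1,2) smooth_deriv_funpow[OF s] show ?thesis unfolding test_functions_iff by blast
qed

lemma test_functions_bounded_support:
  assumes "\<phi> \<in> test_functions \<Omega>"
  obtains M where "\<And>x. M < \<bar>x\<bar> \<Longrightarrow> \<phi> x = 0"
proof -
  obtain K where K: "compact K" "\<And>x. x \<notin> K \<Longrightarrow> \<phi> x = 0"
    using assms unfolding test_functions_iff by blast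
  obtain M where "\<And>x. x \<in> K \<Longrightarrow> \<bar>x\<bar> \<le> M"
    using compact_imp_bounded[OF K(1)] unfolding bounded_iff real_norm_def by blast
  then have "x \<notin> K" if "M < \<bar>x\<bar>" for x using that by fastforce
  with K(2) that show ?thesis by blast
qed

lemma test_functions_integrable:
  assumes "\<phi> \<in> test_functions \<Omega>" shows "integrable lborel \<phi>"
proof -
  obtain M where "\<And>x. M < \<bar>x\<bar> \<Longrightarrow> \<phi> x = 0" using test_functions_bounded_support[OF assms] by blast
  with assms show ?thesis
    by (intro continuous_compact_support_integrable smooth_continuous) (auto simp: test_functions_iff)
qed

text \<open>The boundary terms vanish since \<open>\<phi>\<close> is zero at both ends of a large interval.\<close>

lemma integral_by_parts_test_function:
  fixes g :: "real \<Rightarrow> 'b::euclidean_space"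
  assumes \<phi>: "\<phi> \<in> test_functions \<Omega>"
    and g: "\<And>x. (g has_vector_derivative g' x) (at x)" and cont: "continuous_on UNIV g'"
  shows "(LBINT x. deriv \<phi> x *\<^sub>R g x) = - (LBINT x. \<phi> x *\<^sub>R g' x)"
proof -
  have s: "smooth \<phi>" using \<phi> by (simp add: test_functions_iff)
  obtain M where M: "\<And>x. M < \<bar>x\<bar> \<Longrightarrow> \<phi> x = 0" using test_functions_bounded_support[OF \<phi>] by blast
  define L where "L = \<bar>M\<bar> + 1"
  have L: "0 \<le> L" "M < L" by (auto simp: L_def)
  have off: "\<phi> x = 0" "deriv \<phi> x = 0" if "x \<notin> {-L..L}" for x
  proof -
    have "closed {-L..L}" by simp
    moreover have z: "\<phi> y = 0" if "y \<notin> {-L..L}" for y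
      using that M[of y] L by (auto simp: abs_if split: if_splits)
    ultimately show "deriv \<phi> x = 0"
      using deriv_funpow_eq_0_off_closed[of "{-L..L}" \<phi> x 1] that by simp
    show "\<phi> x = 0" using z that .
  qed
  have gc: "continuous_on UNIV g"
    using g by (auto intro!: continuous_at_imp_continuous_on has_vector_derivative_continuous)
  have c1: "continuous_on A (\<lambda>x. \<phi> x *\<^sub>R g' x)" for A
    using smooth_continuous[OF s] continuous_on_subset[OF cont] by (intro continuous_intros) auto
  have c2: "continuous_on A (\<lambda>x. deriv \<phi> x *\<^sub>R g x)" for A
    using smooth_continuous[OF smooth_deriv[OF s]] continuous_on_subset[OF gc] by (intro continuous_intros) auto
  have "(LBINT x. indicator {-L..L} x *\<^sub>R (\<phi> x *\<^sub>R g' x + deriv \<phi> x *\<^sub>R g x)) = \<phi> L *\<^sub>R g L - \<phi> (-L) *\<^sub>R g (-L)"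
  proof (rule integral_FTC_atLeastAtMost)
    show "((\<lambda>x. \<phi> x *\<^sub>R g x) has_vector_derivative (\<phi> x *\<^sub>R g' x + deriv \<phi> x *\<^sub>R g x)) (at x within {-L..L})" for x
      using has_vector_derivative_scaleR[OF smooth_DERIV[OF s] g]
      by (rule has_vector_derivative_at_within)
    show "continuous_on {-L..L} (\<lambda>x. \<phi> x *\<^sub>R g' x + deriv \<phi> x *\<^sub>R g x)"
      by (rule continuous_on_add[OF c1 c2])
  qed (use L in auto)
  also have "\<dots> = 0" using M[of L] M[of "-L"] L by auto
  also have "(LBINT x. indicator {-L..L} x *\<^sub>R (\<phi> x *\<^sub>R g' x + deriv \<phi> x *\<^sub>R g x))
     = (LBINT x. \<phi> x *\<^sub>R g' x + deriv \<phi> x *\<^sub>R g x)"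
    using off by (intro Bochner_Integration.integral_cong refl) (auto simp: indicator_def)
  also have "\<dots> = (LBINT x. \<phi> x *\<^sub>R g' x) + (LBINT x. deriv \<phi> x *\<^sub>R g x)"
  proof (rule Bochner_Integration.integral_add)
    have "integrable lborel (\<lambda>x. indicator {-L..L} x *\<^sub>R (\<phi> x *\<^sub>R g' x))"
      "integrable lborel (\<lambda>x. indicator {-L..L} x *\<^sub>R (deriv \<phi> x *\<^sub>R g x))"
      by (intro borel_integrable_compact c1 c2; simp)+
    moreover have "(\<lambda>x. indicator {-L..L} x *\<^sub>R (\<phi> x *\<^sub>R g' x)) = (\<lambda>x. \<phi> x *\<^sub>R g' x)"
      "(\<lambda>x. indicator {-L..L} x *\<^sub>R (deriv \<phi> x *\<^sub>R g x)) = (\<lambda>x. deriv \<phi> x *\<^sub>R g x)"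
      using off by (auto simp: fun_eq_iff indicator_def)
    ultimately show "integrable lborel (\<lambda>x. \<phi> x *\<^sub>R g' x)" "integrable lborel (\<lambda>x. deriv \<phi> x *\<^sub>R g x)"
      by (simp_all only:)
  qed
  finally show ?thesis by (simp add: eq_neg_iff_add_eq_0 add.commute)
qed

lemma fourier_integral_deriv:
  assumes \<phi>: "\<phi> \<in> test_functions \<Omega>"
  shows "fourier_integral (deriv \<phi>) \<xi> = \<i> * complex_of_real \<xi> * fourier_integral \<phi> \<xi>"
proof -
  have s: "smooth \<phi>" using \<phi> by (simp add: test_functions_iff)
  have m: "\<phi> \<in> borel_measurable borel" "deriv \<phi> \<in> borel_measurable borel"
    using smooth_continuous[OF s] smooth_continuous[OF smooth_deriv[OF s]]
    by (auto intro: borel_measurable_continuous_onI)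
  have der: "((\<lambda>x. cis (- (x * \<xi>))) has_vector_derivative - (\<i> * complex_of_real \<xi>) * cis (- (x * \<xi>))) (at x)" for x
  proof -
    have "((\<lambda>z. exp (- (\<i> * complex_of_real \<xi>) * z)) has_field_derivative
        - (\<i> * complex_of_real \<xi>) * exp (- (\<i> * complex_of_real \<xi>) * complex_of_real x)) (at (complex_of_real x))"
      by (auto intro!: derivative_eq_intros)
    from has_vector_derivative_real_field[OF this, of UNIV]
    show ?thesis by (simp add: cis_conv_exp mult_ac)
  qed
  have "(LBINT x. deriv \<phi> x *\<^sub>R cis (- (x * \<xi>)))
      = - (LBINT x. \<phi> x *\<^sub>R (- (\<i> * complex_of_real \<xi>) * cis (- (x * \<xi>))))"
    by (rule integral_by_parts_test_function[OF \<phi> der]) (intro continuous_intros)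
  also have "\<dots> = (LBINT x. \<i> * complex_of_real \<xi> * (complex_of_real (\<phi> x) * cis (- (x * \<xi>))))"
    by (subst integral_minus[symmetric]) (simp add: scaleR_conv_of_real mult_ac)
  also have "\<dots> = \<i> * complex_of_real \<xi> * (LBINT x. complex_of_real (\<phi> x) * cis (- (x * \<xi>)))"
    by (rule integral_mult_right_zero)
  finally show ?thesis
    unfolding fourier_integral_eq_lborel[OF m(1)] fourier_integral_eq_lborel[OF m(2)]
    by (simp add: scaleR_conv_of_real)
qed

lemma fourier_integral_deriv_funpow:
  assumes \<phi>: "\<phi> \<in> test_functions \<Omega>"
  shows "fourier_integral ((deriv ^^ n) \<phi>) \<xi> = (\<i> * complex_of_real \<xi>) ^ n * fourier_integral \<phi> \<xi>"
proof (induction n)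
  case (Suc n)
  show ?case
    using fourier_integral_deriv[OF test_functions_deriv_funpow[OF \<phi>, of n]] Suc by simp
qed simp

text \<open>The transform of the fourth derivative is bounded, and \<open>(1 + \<xi>\<^sup>2)\<^sup>2 \<le> 2 + 2 \<xi>\<^sup>4\<close>.\<close>

lemma test_function_fourier_decaying:
  assumes \<phi>: "\<phi> \<in> test_functions \<Omega>" shows "fourier_decaying \<phi>"
  unfolding fourier_decaying_def
proof (intro conjI)
  show "continuous_on UNIV \<phi>" using \<phi> by (auto simp: test_functions_iff smooth_continuous)
  show "\<exists>M. \<forall>x. M < \<bar>x\<bar> \<longrightarrow> \<phi> x = 0" using test_functions_bounded_support[OF \<phi>] by blast
  let ?A = "LBINT x. \<bar>\<phi> x\<bar>" and ?B = "LBINT x. \<bar>(deriv ^^ 4) \<phi> x\<bar>"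
  have "cmod (fourier_integral \<phi> \<xi>) * (1 + \<xi>\<^sup>2)\<^sup>2 \<le> 2 * ?A + 2 * ?B" for \<xi>
  proof -
    let ?c = "cmod (fourier_integral \<phi> \<xi>)"
    have "\<xi> ^ 4 * ?c = norm ((\<i> * complex_of_real \<xi>) ^ 4 * fourier_integral \<phi> \<xi>)"
      by (simp add: norm_mult norm_power)
    also have "\<dots> \<le> ?B"
      unfolding fourier_integral_deriv_funpow[OF \<phi>, symmetric]
      by (intro norm_fourier_integral_le test_functions_integrable[OF test_functions_deriv_funpow[OF \<phi>]])
    finally have b: "\<xi> ^ 4 * ?c \<le> ?B" .
    have a: "?c \<le> ?A" by (rule norm_fourier_integral_le[OF test_functions_integrable[OF \<phi>]])
    have "(1 + \<xi>\<^sup>2)\<^sup>2 \<le> 2 + 2 * \<xi> ^ 4"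
      using sum_squares_bound[of 1 "\<xi>\<^sup>2"] by (simp add: power2_sum power_mult[symmetric])
    then have "?c * (1 + \<xi>\<^sup>2)\<^sup>2 \<le> ?c * (2 + 2 * \<xi> ^ 4)" by (intro mult_left_mono) auto
    also have "\<dots> = 2 * ?c + 2 * (\<xi> ^ 4 * ?c)" by (simp add: algebra_simps)
    finally show ?thesis using a b by linarith
  qed
  then show "\<exists>C. \<forall>\<xi>. cmod (fourier_integral \<phi> \<xi>) * (1 + \<xi>\<^sup>2)\<^sup>2 \<le> C" by blast
qed

text \<open>Integration by parts moves the derivatives onto a polynomial of degree below \<open>n\<close>.\<close>

lemma deriv_funpow_moments_vanish:
  assumes \<phi>: "\<phi> \<in> test_functions \<Omega>"
  shows "j < n \<Longrightarrow> (LBINT x. (deriv ^^ n) \<phi> x * x ^ j) = 0"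
proof (induction n arbitrary: j)
  case (Suc n)
  have "(LBINT x. deriv ((deriv ^^ n) \<phi>) x *\<^sub>R x ^ j) = - (LBINT x. (deriv ^^ n) \<phi> x *\<^sub>R (real j * x ^ (j - 1)))"
  proof (rule integral_by_parts_test_function[OF test_functions_deriv_funpow[OF \<phi>]])
    show "((\<lambda>x. x ^ j) has_vector_derivative real j * x ^ (j - 1)) (at x)" for x :: real
      unfolding has_real_derivative_iff_has_vector_derivative[symmetric]
      by (auto intro!: derivative_eq_intros)
  qed (intro continuous_intros)
  also have "(LBINT x. (deriv ^^ n) \<phi> x *\<^sub>R (real j * x ^ (j - 1))) = real j * (LBINT x. (deriv ^^ n) \<phi> x * x ^ (j - 1))"
    by (subst integral_mult_right_zero[symmetric]) (simp add: mult_ac)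
  also have "\<dots> = 0"
  proof (cases "j = 0")
    case False
    with Suc.prems have "j - 1 < n" by simp
    from Suc.IH[OF this] show ?thesis by simp
  qed simp
  finally show ?case by simp
qed simp

text \<open>A function of bounded support with zero derivative is constant, hence zero.\<close>

lemma deriv_funpow_test_function_nonzero:
  assumes \<phi>: "\<phi> \<in> test_functions \<Omega>" and nz: "\<phi> x0 \<noteq> 0"
  shows "\<exists>x. (deriv ^^ n) \<phi> x \<noteq> 0"
proof (induction n)
  case (Suc n)
  show ?case
  proof (rule ccontr)
    let ?f = "(deriv ^^ n) \<phi>"
    assume "\<nexists>x. (deriv ^^ Suc n) \<phi> x \<noteq> 0"
    then have "deriv ?f x = 0" for x by simp
    moreover have f: "?f \<in> test_functions \<Omega>" by (rule test_functions_deriv_funpow[OF \<phi>])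
    ultimately have "DERIV ?f x :> 0" for x
      using smooth_DERIV[of ?f x] by (simp add: test_functions_iff)
    then have const: "?f x = ?f y" for x y by (intro DERIV_isconst_all) auto
    obtain M where M: "\<And>x. M < \<bar>x\<bar> \<Longrightarrow> ?f x = 0" using test_functions_bounded_support[OF f] by blast
    then have "?f x = 0" for x using const[of x "\<bar>M\<bar> + 1"] M[of "\<bar>M\<bar> + 1"] by simp
    with Suc show False by blast
  qed
qed (use nz in auto)

section \<open>Support of functions in the energy space\<close>

text \<open>The positive and the negative part of \<open>f\<close> are densities of two measures that agree on half-lines,
hence are equal.\<close>

lemma AE_zero_if_upper_interval_integrals_zero:
  fixes f :: "real \<Rightarrow> real"
  assumes f: "integrable lborel f" and z: "\<And>x. (LBINT y. indicator {x<..} y * f y) = 0"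
  shows "AE x in lborel. f x = 0"
proof -
  have [measurable]: "f \<in> borel_measurable borel" using f by auto
  define P where "P = (\<lambda>x. ennreal (f x))"
  define N where "N = (\<lambda>x. ennreal (- f x))"
  have [measurable]: "P \<in> borel_measurable borel" "N \<in> borel_measurable borel"
    unfolding P_def N_def by measurable
  have i: "integrable lborel (\<lambda>y. indicator {x<..} y * max 0 (f y))" "integrable lborel (\<lambda>y. indicator {x<..} y * max 0 (- f y))" for x
    by (rule Bochner_Integration.integrable_bound[OF f]; auto simp: indicator_def)+
  have eP: "emeasure (density lborel P) {x<..} = ennreal (LBINT y. indicator {x<..} y * max 0 (f y))" for x
  proof -
    have "emeasure (density lborel P) {x<..} = (\<integral>\<^sup>+y. ennreal (indicator {x<..} y * max 0 (f y)) \<partial>lborel)"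
      by (subst emeasure_density) (auto simp: P_def indicator_def max_def ennreal_neg intro!: nn_integral_cong)
    also have "\<dots> = ennreal (LBINT y. indicator {x<..} y * max 0 (f y))"
      by (intro nn_integral_eq_integral i) auto
    finally show ?thesis .
  qed
  have eN: "emeasure (density lborel N) {x<..} = ennreal (LBINT y. indicator {x<..} y * max 0 (- f y))" for x
  proof -
    have "emeasure (density lborel N) {x<..} = (\<integral>\<^sup>+y. ennreal (indicator {x<..} y * max 0 (- f y)) \<partial>lborel)"
      by (subst emeasure_density) (auto simp: N_def indicator_def max_def ennreal_neg intro!: nn_integral_cong)
    also have "\<dots> = ennreal (LBINT y. indicator {x<..} y * max 0 (- f y))"
      by (intro nn_integral_eq_integral i) auto
    finally show ?thesis .
  qed
  have eq: "(LBINT y. indicator {x<..} y * max 0 (f y)) = (LBINT y. indicator {x<..} y * max 0 (- f y))" for x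
  proof -
    have "(LBINT y. indicator {x<..} y * max 0 (f y)) - (LBINT y. indicator {x<..} y * max 0 (- f y))
        = (LBINT y. indicator {x<..} y * max 0 (f y) - indicator {x<..} y * max 0 (- f y))"
      by (rule Bochner_Integration.integral_diff[symmetric]) (rule i)+
    also have "\<dots> = (LBINT y. indicator {x<..} y * f y)"
      by (intro Bochner_Integration.integral_cong refl) (auto simp: max_def)
    finally show ?thesis using z by simp
  qed
  have "density lborel P = density lborel N"
    by (rule measure_eqI_lessThan) (auto simp: eP eN eq)
  then have "AE x in lborel. P x = N x"
    by (intro sigma_finite_measure.density_unique[OF sigma_finite_lborel]) auto
  then show ?thesis
  proof eventually_elim
    fix x assume "P x = N x"
    then show "f x = 0"
      by (cases "0 \<le> f x") (auto simp: P_def N_def ennreal_neg ennreal_eq_0_iff)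
  qed
qed

text \<open>The bumps \<^const>\<open>smooth_plateau\<close> approximate indicator functions of intervals, so the integrals of \<open>u\<close>
over all subintervals of \<open>(p,q)\<close> vanish.\<close>

lemma du_Bois_Reymond:
  fixes u :: "real \<Rightarrow> real"
  assumes u: "L2_on UNIV u"
    and orth: "\<And>\<psi>. \<psi> \<in> test_functions UNIV \<Longrightarrow> (\<And>x. x \<notin> {p<..<q} \<Longrightarrow> \<psi> x = 0) \<Longrightarrow> (LINT x|lebesgue. u x * \<psi> x) = 0"
  shows "AE x in lebesgue. x \<in> {p<..<q} \<longrightarrow> u x = 0"
proof -
  obtain w where w [measurable]: "w \<in> borel_measurable borel" and uw: "AE x in lebesgue. u x = w x" and w2: "L2_on UNIV w"
    using L2_on_borel_representative[OF u] .
  have um [measurable]: "u \<in> borel_measurable lebesgue" using u by (auto simp: L2_on_UNIV_iff)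
  have w2': "integrable lborel (\<lambda>x. (w x)\<^sup>2)" using w2 by (simp add: L2_on_UNIV_borel_iff[OF w])
  have iw: "integrable lborel (\<lambda>x. indicator {c<..<d} x * w x)" for c d
  proof (rule Bochner_Integration.integrable_bound[OF integrable_truncation(1)[OF w w2', of "max \<bar>c\<bar> \<bar>d\<bar>"]])
    show "AE x in lborel. norm (indicator {c<..<d} x * w x) \<le> norm (indicator {- max \<bar>c\<bar> \<bar>d\<bar>..max \<bar>c\<bar> \<bar>d\<bar>} x * w x)"
      by (intro AE_I2) (auto simp: indicator_def)
  qed measurable
  have zero: "(LBINT x. indicator {c<..<d} x * w x) = 0" if cd: "p \<le> c" "d \<le> q" for c d
  proof (rule LIMSEQ_unique)
    have m [measurable]: "smooth_plateau c d n \<in> borel_measurable borel" for n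
      by (intro borel_measurable_continuous_onI smooth_continuous smooth_plateau_smooth)
    show "(\<lambda>n. LBINT x. smooth_plateau c d n x * w x) \<longlonglongrightarrow> (LBINT x. indicator {c<..<d} x * w x)"
    proof (rule integral_dominated_convergence[where w = "\<lambda>x. \<bar>indicator {c<..<d} x * w x\<bar>"])
      show "AE x in lborel. (\<lambda>n. smooth_plateau c d n x * w x) \<longlonglongrightarrow> indicator {c<..<d} x * w x"
        by (intro AE_I2 tendsto_mult smooth_plateau_tendsto_indicator tendsto_const)
      show "AE x in lborel. norm (smooth_plateau c d n x * w x) \<le> \<bar>indicator {c<..<d} x * w x\<bar>" for n
      proof (rule AE_I2)
        fix x
        show "norm (smooth_plateau c d n x * w x) \<le> \<bar>indicator {c<..<d} x * w x\<bar>"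
          using smooth_plateau_eq_0[of x c d n] smooth_plateau_bounded[of c d n x]
          by (cases "x \<in> {c<..<d}") (auto simp: abs_mult intro!: mult_left_le_one_le)
      qed
    qed (use iw in auto)
    have "(LBINT x. smooth_plateau c d n x * w x) = 0" for n
    proof -
      have "(LBINT x. smooth_plateau c d n x * w x) = (LINT x|lebesgue. smooth_plateau c d n x * w x)"
        by (rule integral_completion[symmetric]) measurable
      also have "\<dots> = (LINT x|lebesgue. u x * smooth_plateau c d n x)"
      proof (rule integral_cong_AE)
        have "w \<in> borel_measurable lebesgue" "smooth_plateau c d n \<in> borel_measurable lebesgue"
          using w m by (auto intro: measurable_completion)
        then show "(\<lambda>x. smooth_plateau c d n x * w x) \<in> borel_measurable lebesgue"
          "(\<lambda>x. u x * smooth_plateau c d n x) \<in> borel_measurable lebesgue"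
          using um by (auto intro: borel_measurable_times)
        show "AE x in lebesgue. smooth_plateau c d n x * w x = u x * smooth_plateau c d n x"
          using uw by eventually_elim simp
      qed
      also have "\<dots> = 0"
      proof (rule orth)
        have "smooth_plateau c d n x = 0" if "x \<notin> {c..d}" for x
          using that by (intro smooth_plateau_eq_0) auto
        then show "smooth_plateau c d n \<in> test_functions UNIV"
          unfolding test_functions_iff using smooth_plateau_smooth
          by (intro conjI exI[of _ "{c..d}"]) auto
        show "smooth_plateau c d n x = 0" if "x \<notin> {p<..<q}" for x
          using that cd by (intro smooth_plateau_eq_0) auto
      qed
      finally show ?thesis .
    qed
    then show "(\<lambda>n. LBINT x. smooth_plateau c d n x * w x) \<longlonglongrightarrow> 0" by simp
  qed
  have "AE x in lborel. indicator {p<..<q} x * w x = 0"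
  proof (rule AE_zero_if_upper_interval_integrals_zero[OF iw])
    fix x
    have "(LBINT y. indicator {x<..} y * (indicator {p<..<q} y * w y)) = (LBINT y. indicator {max x p<..<q} y * w y)"
      by (intro Bochner_Integration.integral_cong refl) (auto simp: indicator_def)
    also have "\<dots> = 0" by (rule zero) auto
    finally show "(LBINT y. indicator {x<..} y * (indicator {p<..<q} y * w y)) = 0" .
  qed
  then have "AE x in lebesgue. indicator {p<..<q} x * w x = 0" by (rule AE_completion)
  then show ?thesis using uw by eventually_elim (auto simp: indicator_def)
qed

lemma bessel_weight_bounds:
  fixes s \<xi> :: real
  assumes "0 \<le> s" "s \<le> 2"
  shows "1 \<le> (1 + \<xi>\<^sup>2) powr (s / 2)" "(1 + \<xi>\<^sup>2) powr (s / 2) \<le> 1 + \<xi>\<^sup>2"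
proof -
  show "1 \<le> (1 + \<xi>\<^sup>2) powr (s / 2)" using assms by (intro ge_one_powr_ge_zero) auto
  have "(1 + \<xi>\<^sup>2) powr (s / 2) \<le> (1 + \<xi>\<^sup>2) powr 1" using assms by (intro powr_mono) auto
  then show "(1 + \<xi>\<^sup>2) powr (s / 2) \<le> 1 + \<xi>\<^sup>2" by (simp add: add_nonneg_nonneg)
qed

text \<open>The approximating test functions are supported in \<open>\<Omega>\<close> and so orthogonal to \<open>\<psi>\<close>. By Parseval's identity
and the Cauchy-Schwarz inequality the error is at most the energy norm of \<open>\<phi> n - v\<close> times the \<open>L\<^sup>2\<close> norm
of the transform of \<open>\<psi>\<close>, because the Bessel weight is at least \<open>1\<close>.\<close>

lemma Hs_tilde_orthogonal:
  assumes v: "v \<in> Hs_tilde s \<Omega>" and s: "0 \<le> s" "s \<le> 2"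
    and \<psi>: "\<psi> \<in> test_functions UNIV" and van: "\<And>x. x \<in> \<Omega> \<Longrightarrow> \<psi> x = 0"
  shows "(LINT x|lebesgue. v x * \<psi> x) = 0"
proof -
  obtain \<phi> where \<phi>: "\<And>n. \<phi> n \<in> test_functions \<Omega>" and lim: "(\<lambda>n. Hs_norm s (\<lambda>x. \<phi> n x - v x)) \<longlonglongrightarrow> 0"
    and vL: "L2_on UNIV v" and vB: "L2_on UNIV (bessel_weighted_fourier s v)"
    using v unfolding Hs_tilde_def Hs_def by blast
  note \<psi>d = test_function_fourier_decaying[OF \<psi>]
  let ?K = "sqrt (LINT x|lebesgue. (norm (fourier_integral \<psi> x))\<^sup>2)"
  have "2 * pi * \<bar>LINT x|lebesgue. v x * \<psi> x\<bar> \<le> Hs_norm s (\<lambda>x. \<phi> n x - v x) * ?K" for n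
  proof -
    let ?w = "\<lambda>x. \<phi> n x - v x"
    note \<phi>d = test_function_fourier_decaying[OF \<phi>[of n]]
    have \<phi>L: "L2_on UNIV (\<phi> n)"
      using fourier_decaying_integrable(2)[OF \<phi>d] by (simp add: L2_on_UNIV_borel_iff fourier_decaying_borel[OF \<phi>d])
    have wL: "L2_on UNIV ?w" by (rule L2_on_diff[OF \<phi>L vL])
    note k = is_fourier_L2_fourier_L2[OF wL]
    have kL: "L2_on UNIV (fourier_L2 ?w)" using k by (simp add: is_fourier_L2_def)
    have wt [measurable]: "(\<lambda>\<xi>::real. (1 + \<xi>\<^sup>2) powr (s / 2)) \<in> borel_measurable borel" by measurable
    have "L2_on UNIV (\<lambda>\<xi>. complex_of_real ((1 + \<xi>\<^sup>2) powr (s / 2)) * fourier_integral (\<phi> n) \<xi>)"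
      by (rule fourier_decaying_weighted_L2(1)[OF \<phi>d wt]) (use bessel_weight_bounds[OF s] in auto)
    note dB = L2_on_diff[OF this vB]
    \<comment> \<open>Integrability has to be checked: the norm of a function outside \<open>L\<^sup>2\<close> would be \<open>0\<close> by default.\<close>
    have wB: "L2_on UNIV (bessel_weighted_fourier s ?w)"
    proof (rule L2_on_cong_AE[OF dB])
      have "(\<lambda>\<xi>. complex_of_real ((1 + \<xi>\<^sup>2) powr (s / 2))) \<in> borel_measurable lebesgue"
        by (rule measurable_completion) measurable
      then show "bessel_weighted_fourier s ?w \<in> borel_measurable lebesgue"
        using kL unfolding bessel_weighted_fourier_def L2_on_UNIV_iff by (intro borel_measurable_times) auto
      show "AE \<xi> in lebesgue. complex_of_real ((1 + \<xi>\<^sup>2) powr (s / 2)) * fourier_integral (\<phi> n) \<xi> - bessel_weighted_fourier s v \<xi>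
          = bessel_weighted_fourier s ?w \<xi>"
        using fourier_L2_diff_AE[OF vL \<phi>d]
        by eventually_elim (simp add: bessel_weighted_fourier_def right_diff_distrib)
    qed
    have "(LINT \<xi>|lebesgue. (norm (fourier_L2 ?w \<xi>))\<^sup>2) \<le> (LINT \<xi>|lebesgue. (norm (bessel_weighted_fourier s ?w \<xi>))\<^sup>2)"
    proof (intro integral_mono)
      fix \<xi>
      have "1 * norm (fourier_L2 ?w \<xi>) \<le> (1 + \<xi>\<^sup>2) powr (s / 2) * norm (fourier_L2 ?w \<xi>)"
        by (intro mult_right_mono bessel_weight_bounds[OF s]) auto
      then have "norm (fourier_L2 ?w \<xi>) \<le> norm (bessel_weighted_fourier s ?w \<xi>)"
        by (simp add: bessel_weighted_fourier_def norm_mult)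
      then show "(norm (fourier_L2 ?w \<xi>))\<^sup>2 \<le> (norm (bessel_weighted_fourier s ?w \<xi>))\<^sup>2"
        by (intro power_mono) auto
    qed (use kL wB in \<open>auto simp: L2_on_UNIV_iff\<close>)
    then have le: "sqrt (LINT \<xi>|lebesgue. (norm (fourier_L2 ?w \<xi>))\<^sup>2) \<le> Hs_norm s ?w"
      unfolding Hs_norm_def L2_norm_def lebesgue_on_UNIV_eq by simp
    have "?w x * \<psi> x = - (v x * \<psi> x)" for x
    proof (cases "x \<in> \<Omega>")
      case False
      then have "\<phi> n x = 0" using \<phi>[of n] unfolding test_functions_iff by blast
      then show ?thesis by simp
    qed (simp add: van)
    then have "complex_of_real (- (2 * pi * (LINT x|lebesgue. v x * \<psi> x))) = (LINT \<xi>|lebesgue. fourier_L2 ?w \<xi> * cnj (fourier_integral \<psi> \<xi>))"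
      using Parseval_L2[OF wL k \<psi>d] by simp
    then have "norm (complex_of_real (- (2 * pi * (LINT x|lebesgue. v x * \<psi> x)))) \<le> sqrt (LINT \<xi>|lebesgue. (norm (fourier_L2 ?w \<xi>))\<^sup>2) * ?K"
      using L2_inner_product(2)[OF kL fourier_decaying_transform(1)[OF \<psi>d]] by (simp only:)
    also have "\<dots> \<le> Hs_norm s ?w * ?K"
      by (intro mult_right_mono le) auto
    finally show ?thesis by (simp only: norm_of_real abs_minus_cancel abs_mult) simp
  qed
  moreover have "(\<lambda>n. Hs_norm s (\<lambda>x. \<phi> n x - v x) * ?K) \<longlonglongrightarrow> 0 * ?K"
    by (intro tendsto_intros lim)
  ultimately have "2 * pi * \<bar>LINT x|lebesgue. v x * \<psi> x\<bar> \<le> 0 * ?K"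
    by (intro LIMSEQ_le_const[where X = "\<lambda>n. Hs_norm s (\<lambda>x. \<phi> n x - v x) * ?K"]) auto
  then show ?thesis using pi_gt_zero by (simp add: mult_le_0_iff)
qed

theorem Hs_tilde_vanishes_outside:
  assumes v: "v \<in> Hs_tilde s {a<..<b}" and s: "0 \<le> s" "s \<le> 2"
  shows "AE x in lebesgue. x \<notin> {a..b} \<longrightarrow> v x = 0"
proof -
  have vL: "L2_on UNIV v" using v by (simp add: Hs_tilde_def Hs_def)
  \<comment> \<open>Countably many bounded intervals exhaust the complement of \<open>[a,b]\<close>.\<close>
  have "AE x in lebesgue. x \<in> {p<..<q} \<longrightarrow> v x = 0" if "{p<..<q} \<inter> {a<..<b} = {}" for p q
  proof (rule du_Bois_Reymond[OF vL])
    fix \<psi> assume \<psi>: "\<psi> \<in> test_functions UNIV" and z: "\<And>x. x \<notin> {p<..<q} \<Longrightarrow> \<psi> x = 0"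
    show "(LINT x|lebesgue. v x * \<psi> x) = 0"
      using that z by (intro Hs_tilde_orthogonal[OF v s \<psi>]) blast
  qed
  then have "AE x in lebesgue. \<forall>n::nat. (x \<in> {b<..<b + real n} \<longrightarrow> v x = 0) \<and> (x \<in> {a - real n<..<a} \<longrightarrow> v x = 0)"
    unfolding AE_all_countable by (intro allI AE_conjI) auto
  then show ?thesis
  proof eventually_elim
    fix x assume *: "\<forall>n::nat. (x \<in> {b<..<b + real n} \<longrightarrow> v x = 0) \<and> (x \<in> {a - real n<..<a} \<longrightarrow> v x = 0)"
    obtain n :: nat where n: "\<bar>x - b\<bar> + \<bar>x - a\<bar> < real n" using reals_Archimedean2 by blast
    show "x \<notin> {a..b} \<longrightarrow> v x = 0"
      using *[rule_format, of n] n by (auto simp: not_le)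
  qed
qed

section \<open>The fractional Laplacian as a singular integral\<close>

definition second_difference :: "real \<Rightarrow> (real \<Rightarrow> real) \<Rightarrow> real \<Rightarrow> real" where
  "second_difference t \<phi> x = \<phi> x - (\<phi> (x + t) + \<phi> (x - t)) / 2"

lemma test_functions_mono: "\<phi> \<in> test_functions \<Omega> \<Longrightarrow> \<Omega> \<subseteq> \<Omega>' \<Longrightarrow> \<phi> \<in> test_functions \<Omega>'"
  unfolding test_functions_iff by blast

lemma test_functions_shift:
  assumes "\<phi> \<in> test_functions \<Omega>" shows "(\<lambda>x. \<phi> (x + a)) \<in> test_functions UNIV"
proof -
  obtain K where K: "compact K" "\<And>x. x \<notin> K \<Longrightarrow> \<phi> x = 0" and s: "smooth \<phi>"
    using assms unfolding test_functions_iff by blast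
  have "\<phi> (x + a) = 0" if "x \<notin> (+) (- a) ` K" for x
  proof (rule K(2))
    show "x + a \<notin> K"
    proof
      assume "x + a \<in> K"
      then have "- a + (x + a) \<in> (+) (- a) ` K" by (rule imageI)
      with that show False by simp
    qed
  qed
  moreover have "compact ((+) (- a) ` K)" using K(1) by (rule compact_translation)
  moreover have "smooth (\<lambda>x. \<phi> (x + a))" using smooth_affine[OF s, of 1 a] by simp
  ultimately show ?thesis unfolding test_functions_iff by blast
qed

lemma test_functions_borel: "\<phi> \<in> test_functions \<Omega> \<Longrightarrow> \<phi> \<in> borel_measurable borel"
  by (rule fourier_decaying_borel[OF test_function_fourier_decaying])

lemma fourier_integral_shift:
  assumes [measurable]: "\<phi> \<in> borel_measurable borel"
  shows "fourier_integral (\<lambda>x. \<phi> (x + a)) \<xi> = cis (a * \<xi>) * fourier_integral \<phi> \<xi>"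
proof -
  have m: "(\<lambda>x. \<phi> (x + a)) \<in> borel_measurable borel" by measurable
  have "fourier_integral (\<lambda>x. \<phi> (x + a)) \<xi> = (LBINT x. complex_of_real (\<phi> (x + a)) * cis (- (x * \<xi>)))"
    by (rule fourier_integral_eq_lborel[OF m])
  also have "\<dots> = \<bar>1\<bar> *\<^sub>R (LBINT y. complex_of_real (\<phi> ((- a + 1 * y) + a)) * cis (- ((- a + 1 * y) * \<xi>)))"
    by (rule lborel_integral_real_affine) simp
  also have "\<dots> = (LBINT y. cis (a * \<xi>) * (complex_of_real (\<phi> y) * cis (- (y * \<xi>))))"
  proof -
    have "cis (- ((- a + 1 * y) * \<xi>)) = cis (a * \<xi>) * cis (- (y * \<xi>))" for y
      by (simp add: cis_mult algebra_simps)
    then show ?thesis by (simp add: mult.left_commute)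
  qed
  also have "\<dots> = cis (a * \<xi>) * fourier_integral \<phi> \<xi>"
    unfolding fourier_integral_eq_lborel[OF assms] by (rule integral_mult_right_zero)
  finally show ?thesis .
qed

lemma L2_on_test_function: "\<phi> \<in> test_functions \<Omega> \<Longrightarrow> L2_on UNIV \<phi>"
  using fourier_decaying_integrable(2)[OF test_function_fourier_decaying, of \<phi> \<Omega>]
  by (simp add: L2_on_UNIV_borel_iff test_functions_borel)

lemma L2_mult_integrable:
  fixes u w :: "real \<Rightarrow> real"
  assumes "L2_on UNIV u" "L2_on UNIV w" shows "integrable lebesgue (\<lambda>x. u x * w x)"
  using assms by (intro Cauchy_Schwarz_integral(1)) (auto simp: L2_on_UNIV_iff)

lemma cos_eq_cis: "complex_of_real (cos x) = (cis x + cis (- x)) / 2"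
  by (simp add: complex_eq_iff)

text \<open>Translation by \<open>t\<close> multiplies the transform by \<open>cis (t \<xi>)\<close>, so the second difference has the Fourier
multiplier \<open>1 - cos (t \<xi>)\<close>.\<close>

lemma Parseval_second_difference:
  assumes u: "L2_on UNIV u" and \<phi>: "\<phi> \<in> test_functions \<Omega>"
  shows "(LINT \<xi>|lebesgue. complex_of_real (1 - cos (t * \<xi>)) * (fourier_L2 u \<xi> * cnj (fourier_integral \<phi> \<xi>)))
    = complex_of_real (2 * pi * (LINT x|lebesgue. u x * second_difference t \<phi> x))"
proof -
  let ?H = "\<lambda>\<xi>. fourier_L2 u \<xi> * cnj (fourier_integral \<phi> \<xi>)"
  note g = is_fourier_L2_fourier_L2[OF u]
  have gL: "L2_on UNIV (fourier_L2 u)" using g by (simp add: is_fourier_L2_def)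
  have shift: "integrable lebesgue (\<lambda>\<xi>. cis (- (a * \<xi>)) * ?H \<xi>)"
      "(LINT \<xi>|lebesgue. cis (- (a * \<xi>)) * ?H \<xi>) = complex_of_real (2 * pi * (LINT x|lebesgue. u x * \<phi> (x + a)))"
      "integrable lebesgue (\<lambda>x. u x * \<phi> (x + a))" for a
  proof -
    note \<phi>a = test_functions_shift[OF \<phi>, of a]
    note d = test_function_fourier_decaying[OF \<phi>a]
    have eq: "fourier_L2 u \<xi> * cnj (fourier_integral (\<lambda>x. \<phi> (x + a)) \<xi>) = cis (- (a * \<xi>)) * ?H \<xi>" for \<xi>
      unfolding fourier_integral_shift[OF test_functions_borel[OF \<phi>]]
      by (simp add: cis_cnj mult_ac)
    show "integrable lebesgue (\<lambda>\<xi>. cis (- (a * \<xi>)) * ?H \<xi>)"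
      using L2_inner_product(1)[OF gL fourier_decaying_transform(1)[OF d]] unfolding eq .
    show "(LINT \<xi>|lebesgue. cis (- (a * \<xi>)) * ?H \<xi>) = complex_of_real (2 * pi * (LINT x|lebesgue. u x * \<phi> (x + a)))"
      using Parseval_L2[OF u g d] unfolding eq .
    show "integrable lebesgue (\<lambda>x. u x * \<phi> (x + a))"
      by (rule L2_mult_integrable[OF u L2_on_test_function[OF \<phi>a]])
  qed
  have "(LINT \<xi>|lebesgue. complex_of_real (1 - cos (t * \<xi>)) * ?H \<xi>)
      = (LINT \<xi>|lebesgue. cis (- (0 * \<xi>)) * ?H \<xi> - (cis (- (t * \<xi>)) * ?H \<xi> + cis (- (- t * \<xi>)) * ?H \<xi>) / 2)"
    by (intro Bochner_Integration.integral_cong refl) (simp add: cos_eq_cis field_simps)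
  also have "\<dots> = (LINT \<xi>|lebesgue. cis (- (0 * \<xi>)) * ?H \<xi>)
      - ((LINT \<xi>|lebesgue. cis (- (t * \<xi>)) * ?H \<xi>) + (LINT \<xi>|lebesgue. cis (- (- t * \<xi>)) * ?H \<xi>)) / 2"
    by (subst Bochner_Integration.integral_diff)
      (intro shift(1) integrable_divide Bochner_Integration.integrable_add
        | simp only: integral_divide_zero Bochner_Integration.integral_add[OF shift(1) shift(1)])+
  also have "\<dots> = complex_of_real (2 * pi * ((LINT x|lebesgue. u x * \<phi> (x + 0))
      - ((LINT x|lebesgue. u x * \<phi> (x + t)) + (LINT x|lebesgue. u x * \<phi> (x + - t))) / 2))"
    unfolding shift(2) by (simp add: algebra_simps)
  also have "(LINT x|lebesgue. u x * \<phi> (x + 0))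
      - ((LINT x|lebesgue. u x * \<phi> (x + t)) + (LINT x|lebesgue. u x * \<phi> (x + - t))) / 2
      = (LINT x|lebesgue. u x * \<phi> (x + 0) - (u x * \<phi> (x + t) + u x * \<phi> (x + - t)) / 2)"
    by (subst Bochner_Integration.integral_diff)
      (intro shift(3) integrable_divide Bochner_Integration.integrable_add
        | simp only: integral_divide_zero Bochner_Integration.integral_add[OF shift(3) shift(3)])+
  also have "\<dots> = (LINT x|lebesgue. u x * second_difference t \<phi> x)"
    by (intro Bochner_Integration.integral_cong refl) (simp add: second_difference_def field_simps)
  finally show ?thesis .
qed

definition frac_kernel :: "real \<Rightarrow> real \<Rightarrow> real" where
  "frac_kernel s t = indicator {0<..} t * t powr (- 1 - 2 * s)"

lemma frac_kernel_measurable [measurable]: "frac_kernel s \<in> borel_measurable borel"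
  unfolding frac_kernel_def by measurable

lemma frac_kernel_nonneg: "0 \<le> frac_kernel s t"
  by (simp add: frac_kernel_def)

lemma integrable_powr_on:
  assumes "(\<lambda>x::real. x powr e) integrable_on S" and [measurable]: "S \<in> sets borel"
  shows "integrable lborel (\<lambda>x. indicator S x * x powr e)"
proof -
  have "(\<lambda>x::real. x powr e) absolutely_integrable_on S"
    using assms(1) by (rule nonnegative_absolutely_integrable_1) simp
  then have "integrable lebesgue (\<lambda>x. indicator S x * x powr e)"
    by (simp add: set_integrable_def)
  then show ?thesis
    by (subst (asm) integrable_completion) auto
qed

text \<open>The factor \<open>min 1 (t\<^sup>2)\<close> is the size of a second difference. It makes the singularity at \<open>0\<close> integrable
because \<open>s < 1\<close>, and the tail is integrable because \<open>s > 0\<close>.\<close>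

lemma integrable_frac_kernel_min:
  assumes s: "0 < s" "s < 1"
  shows "integrable lborel (\<lambda>t. frac_kernel s t * min 1 (t\<^sup>2))"
proof -
  have a: "integrable lborel (\<lambda>t::real. indicator {0..1} t * t powr (1 - 2 * s))"
    using has_integral_powr_from_0[of "1 - 2 * s" 1] s by (intro integrable_powr_on) auto
  have b: "integrable lborel (\<lambda>t::real. indicator {1..} t * t powr (- 1 - 2 * s))"
    using has_integral_powr_to_inf[of "- 1 - 2 * s" 1] s by (intro integrable_powr_on) auto
  show ?thesis
  proof (rule Bochner_Integration.integrable_bound[OF Bochner_Integration.integrable_add[OF a b]])
    show "AE t in lborel. norm (frac_kernel s t * min 1 (t\<^sup>2))
        \<le> norm (indicator {0..1} t * t powr (1 - 2 * s) + indicator {1..} t * t powr (- 1 - 2 * s))"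
    proof (rule AE_I2)
      fix t :: real
      consider "t \<le> 0" | "0 < t" "t \<le> 1" | "1 < t" by linarith
      then show "norm (frac_kernel s t * min 1 (t\<^sup>2))
        \<le> norm (indicator {0..1} t * t powr (1 - 2 * s) + indicator {1..} t * t powr (- 1 - 2 * s))"
      proof cases
        case 2
        have "t powr (- 1 - 2 * s) * min 1 (t\<^sup>2) \<le> t powr (- 1 - 2 * s) * t powr 2"
          using 2 by (intro mult_left_mono) (auto simp: powr_numeral)
        also have "\<dots> = t powr (1 - 2 * s)" by (subst powr_add[symmetric]) simp
        finally have "t powr (- 1 - 2 * s) * min 1 (t\<^sup>2) \<le> t powr (1 - 2 * s) + indicator {1..} t * t powr (- 1 - 2 * s)"
          by (simp add: add_increasing2)
        then show ?thesis using 2 by (simp add: frac_kernel_def abs_mult)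
      next
        case 3
        have "t powr (- 1 - 2 * s) * min 1 (t\<^sup>2) \<le> t powr (- 1 - 2 * s) * 1"
          by (intro mult_left_mono) auto
        then show ?thesis using 3 by (simp add: frac_kernel_def abs_mult)
      qed (simp add: frac_kernel_def)
    qed
  qed measurable
qed

lemma integrable_frac_kernel_mult:
  assumes s: "0 < s" "s < 1" and [measurable]: "f \<in> borel_measurable borel"
    and bound: "\<And>t. 0 < t \<Longrightarrow> \<bar>f t\<bar> \<le> C * min 1 (t\<^sup>2)"
  shows "integrable lborel (\<lambda>t. frac_kernel s t * f t)"
    and "(LBINT t. \<bar>frac_kernel s t * f t\<bar>) \<le> C * (LBINT t. frac_kernel s t * min 1 (t\<^sup>2))"
proof -
  have i: "integrable lborel (\<lambda>t. C * (frac_kernel s t * min 1 (t\<^sup>2)))"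
    using integrable_frac_kernel_min[OF s] by (rule integrable_mult_right)
  have le: "\<bar>frac_kernel s t * f t\<bar> \<le> C * (frac_kernel s t * min 1 (t\<^sup>2))" for t
  proof (cases "0 < t")
    case True
    have "\<bar>frac_kernel s t * f t\<bar> = frac_kernel s t * \<bar>f t\<bar>"
      by (simp add: abs_mult frac_kernel_nonneg)
    also have "\<dots> \<le> frac_kernel s t * (C * min 1 (t\<^sup>2))"
      by (intro mult_left_mono bound True frac_kernel_nonneg)
    finally show ?thesis by (simp only: mult.left_commute)
  qed (simp add: frac_kernel_def)
  show i2: "integrable lborel (\<lambda>t. frac_kernel s t * f t)"
    by (rule Bochner_Integration.integrable_bound[OF i])
      (measurable, intro AE_I2, use le in \<open>auto intro: order_trans[OF _ abs_ge_self]\<close>)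
  have "(LBINT t. \<bar>frac_kernel s t * f t\<bar>) \<le> (LBINT t. C * (frac_kernel s t * min 1 (t\<^sup>2)))"
    by (intro integral_mono le i integrable_abs i2)
  then show "(LBINT t. \<bar>frac_kernel s t * f t\<bar>) \<le> C * (LBINT t. frac_kernel s t * min 1 (t\<^sup>2))"
    by simp
qed

text \<open>The normalization between the singular integral below and the Fourier multiplier \<open>\<bar>\<xi>\<bar>\<^sup>2\<^sup>s\<close>.\<close>

definition frac_const :: "real \<Rightarrow> real" where
  "frac_const s = (LBINT r. frac_kernel s r * (1 - cos r))"

lemma one_minus_cos_bound: "\<bar>1 - cos (t * \<xi>)\<bar> \<le> (2 + \<xi>\<^sup>2) * min 1 (t\<^sup>2)" for t \<xi> :: real
proof -
  have nn: "0 \<le> 1 - cos (t * \<xi>)" by simp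
  have a: "1 - cos (t * \<xi>) \<le> 2" using cos_ge_minus_one[of "t * \<xi>"] by linarith
  have "1 - cos (t * \<xi>) = 2 * (sin (t * \<xi> / 2))\<^sup>2"
    using cos_double_sin[of "t * \<xi> / 2"] by simp
  also have "\<dots> \<le> 2 * (t * \<xi> / 2)\<^sup>2"
    using abs_sin_x_le_abs_x[of "t * \<xi> / 2"] by (intro mult_left_mono) (auto simp: abs_le_square_iff[symmetric])
  also have "\<dots> = \<xi>\<^sup>2 * t\<^sup>2 / 2" by (simp add: power2_eq_square)
  also have "\<dots> \<le> \<xi>\<^sup>2 * t\<^sup>2" by simp
  also have "\<dots> \<le> (2 + \<xi>\<^sup>2) * t\<^sup>2" by (intro mult_right_mono) auto
  finally have b: "1 - cos (t * \<xi>) \<le> (2 + \<xi>\<^sup>2) * t\<^sup>2" .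
  have "1 - cos (t * \<xi>) \<le> (2 + \<xi>\<^sup>2) * 1" using a zero_le_power2[of \<xi>] unfolding mult_1_right by linarith
  with b nn show ?thesis by (simp add: min_def)
qed

text \<open>Substituting \<open>r = t \<bar>\<xi>\<bar>\<close> shows that \<open>\<bar>\<xi>\<bar>\<^sup>2\<^sup>s\<close> is a superposition of the multipliers of second differences.\<close>

lemma frac_const_scaling:
  "(LBINT t. frac_kernel s t * (1 - cos (t * \<xi>))) = frac_const s * \<bar>\<xi>\<bar> powr (2 * s)"
proof (cases "\<xi> = 0")
  case False
  let ?a = "\<bar>\<xi>\<bar>"
  have a: "0 < ?a" using False by simp
  have "(LBINT t. frac_kernel s t * (1 - cos (t * \<xi>)))
      = \<bar>1 / ?a\<bar> *\<^sub>R (LBINT r. frac_kernel s (0 + 1 / ?a * r) * (1 - cos ((0 + 1 / ?a * r) * \<xi>)))"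
    using a by (intro lborel_integral_real_affine) simp
  also have "\<dots> = (LBINT r. 1 / ?a * (frac_kernel s (0 + 1 / ?a * r) * (1 - cos ((0 + 1 / ?a * r) * \<xi>))))"
    by simp
  also have "\<dots> = (LBINT r. ?a powr (2 * s) * (frac_kernel s r * (1 - cos r)))"
  proof (intro Bochner_Integration.integral_cong refl)
    fix r :: real
    have c: "cos ((0 + 1 / ?a * r) * \<xi>) = cos r"
      using False by (cases "0 < \<xi>") (auto simp: abs_if)
    have k: "1 / ?a * frac_kernel s (0 + 1 / ?a * r) = ?a powr (2 * s) * frac_kernel s r"
    proof (cases "0 < r")
      case True
      have "1 / ?a * (r / ?a) powr (- 1 - 2 * s) = ?a powr (- 1) * (r powr (- 1 - 2 * s) / ?a powr (- 1 - 2 * s))"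
        using True a by (simp add: powr_divide powr_minus inverse_eq_divide)
      also have "\<dots> = r powr (- 1 - 2 * s) * (?a powr (- 1) / ?a powr (- 1 - 2 * s))" by simp
      also have "?a powr (- 1) / ?a powr (- 1 - 2 * s) = ?a powr (2 * s)"
        by (subst powr_diff[symmetric]) simp
      finally show ?thesis using True a by (simp add: frac_kernel_def mult.commute)
    next
      case False
      then have "\<not> 0 < r / ?a" using a by (simp add: zero_less_divide_iff)
      then show ?thesis using False by (simp add: frac_kernel_def)
    qed
    show "1 / ?a * (frac_kernel s (0 + 1 / ?a * r) * (1 - cos ((0 + 1 / ?a * r) * \<xi>)))
        = ?a powr (2 * s) * (frac_kernel s r * (1 - cos r))"
      unfolding c mult.assoc[symmetric] k ..
  qed
  also have "\<dots> = ?a powr (2 * s) * frac_const s"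
    unfolding frac_const_def by (rule integral_mult_right_zero)
  finally show ?thesis by (simp add: mult.commute)
qed simp

lemma Fubini_weighted_kernel:
  fixes f :: "real \<Rightarrow> complex" and N :: "real \<Rightarrow> real \<Rightarrow> real"
  assumes [measurable]: "f \<in> borel_measurable borel" "(\<lambda>(x, t). N x t) \<in> borel_measurable (borel \<Otimes>\<^sub>M borel)"
    and N: "\<And>x. integrable lborel (N x)"
    and dom: "integrable lborel (\<lambda>x. W x * norm (f x))" and le: "\<And>x. (LBINT t. \<bar>N x t\<bar>) \<le> W x"
  shows "(LBINT x. complex_of_real (LBINT t. N x t) * f x)
       = (LBINT t. LBINT x. complex_of_real (N x t) * f x)"
proof -
  have int: "integrable (lborel \<Otimes>\<^sub>M lborel) (\<lambda>(x, t). complex_of_real (N x t) * f x)"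
  proof (rule lborel_pair.Fubini_integrable)
    show "AE x in lborel. integrable lborel (\<lambda>t. case (x, t) of (x, t) \<Rightarrow> complex_of_real (N x t) * f x)"
      using N by (intro AE_I2) auto
    show "integrable lborel (\<lambda>x. LBINT t. norm (case (x, t) of (x, t) \<Rightarrow> complex_of_real (N x t) * f x))"
    proof (rule Bochner_Integration.integrable_bound[OF dom])
      show "AE x in lborel. norm (LBINT t. norm (case (x, t) of (x, t) \<Rightarrow> complex_of_real (N x t) * f x)) \<le> norm (W x * norm (f x))"
      proof (rule AE_I2)
        fix x
        have "(LBINT t. norm (complex_of_real (N x t) * f x)) = (LBINT t. \<bar>N x t\<bar>) * norm (f x)"
          by (simp add: norm_mult)
        moreover have "0 \<le> (LBINT t. \<bar>N x t\<bar>)" by simp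
        ultimately show "norm (LBINT t. norm (case (x, t) of (x, t) \<Rightarrow> complex_of_real (N x t) * f x)) \<le> norm (W x * norm (f x))"
          using le[of x] by (auto simp: abs_mult intro!: mult_right_mono)
      qed
    qed measurable
  qed measurable
  have "(LBINT x. complex_of_real (LBINT t. N x t) * f x) = (LBINT x. LBINT t. complex_of_real (N x t) * f x)"
    by (intro Bochner_Integration.integral_cong refl) (simp add: integral_complex_of_real[symmetric] del: integral_complex_of_real)
  also have "\<dots> = (LBINT t. LBINT x. complex_of_real (N x t) * f x)"
    using lborel_pair.Fubini_integral[of "\<lambda>x t. complex_of_real (N x t) * f x"] int by simp
  finally show ?thesis .
qed

text \<open>For small \<open>t\<close>, the mean value theorem is applied to \<open>\<phi>\<close> on either side of \<open>x\<close> and then to \<open>deriv \<phi>\<close>.\<close>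

lemma second_difference_bound:
  assumes \<phi>: "\<phi> \<in> test_functions \<Omega>"
  shows "\<exists>C\<ge>0. \<forall>t>0. \<forall>x. \<bar>second_difference t \<phi> x\<bar> \<le> C * min 1 (t\<^sup>2)"
proof -
  have s: "smooth \<phi>" "smooth (deriv \<phi>)" using \<phi> smooth_deriv by (auto simp: test_functions_iff)
  have bdd: "\<exists>B. \<forall>x. \<bar>(deriv ^^ n) \<phi> x\<bar> \<le> B" for n
  proof -
    have t: "(deriv ^^ n) \<phi> \<in> test_functions \<Omega>" by (rule test_functions_deriv_funpow[OF \<phi>])
    obtain M where "\<And>x. M < \<bar>x\<bar> \<Longrightarrow> (deriv ^^ n) \<phi> x = 0" using test_functions_bounded_support[OF t] by blast
    with t show ?thesis
      by (intro continuous_compact_support_bounded[of _ M] smooth_continuous) (auto simp: test_functions_iff)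
  qed
  obtain A where A: "\<And>x. \<bar>\<phi> x\<bar> \<le> A" using bdd[of 0] by auto
  obtain B where B: "\<And>x. \<bar>deriv (deriv \<phi>) x\<bar> \<le> B" using bdd[of 2] by (auto simp: numeral_2_eq_2)
  have A0: "0 \<le> A" and B0: "0 \<le> B" using A[of 0] B[of 0] by linarith+
  have "\<bar>second_difference t \<phi> x\<bar> \<le> (2 * A + B) * min 1 (t\<^sup>2)" if t: "0 < t" for t x
  proof -
    have a: "\<bar>second_difference t \<phi> x\<bar> \<le> 2 * A"
    proof -
      have "\<bar>(\<phi> (x + t) + \<phi> (x - t)) / 2\<bar> \<le> (\<bar>\<phi> (x + t)\<bar> + \<bar>\<phi> (x - t)\<bar>) / 2"
        unfolding abs_divide abs_numeral by (intro divide_right_mono abs_triangle_ineq) simp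
      also have "\<dots> \<le> (A + A) / 2"
        by (intro divide_right_mono add_mono A) simp
      finally have "\<bar>(\<phi> (x + t) + \<phi> (x - t)) / 2\<bar> \<le> A" by simp
      then show ?thesis
        unfolding second_difference_def
        using order_trans[OF abs_triangle_ineq4 add_mono[OF A[of x]]] by (metis mult_2)
    qed
    obtain z where z: "x < z" "z < x + t" "\<phi> (x + t) - \<phi> x = t * deriv \<phi> z"
      using MVT2[of x "x + t" \<phi> "deriv \<phi>"] smooth_DERIV[OF s(1)] t by auto
    obtain y where y: "x - t < y" "y < x" "\<phi> x - \<phi> (x - t) = t * deriv \<phi> y"
      using MVT2[of "x - t" x \<phi> "deriv \<phi>"] smooth_DERIV[OF s(1)] t by auto
    obtain r where r: "deriv \<phi> z - deriv \<phi> y = (z - y) * deriv (deriv \<phi>) r"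
      using MVT2[of y z "deriv \<phi>" "deriv (deriv \<phi>)"] smooth_DERIV[OF s(2)] y z by auto
    have "second_difference t \<phi> x = - ((\<phi> (x + t) - \<phi> x) - (\<phi> x - \<phi> (x - t))) / 2"
      by (simp add: second_difference_def field_simps)
    also have "\<dots> = - (t / 2) * (deriv \<phi> z - deriv \<phi> y)"
      unfolding z(3) y(3) by (simp add: right_diff_distrib[symmetric])
    finally have "second_difference t \<phi> x = - (t / 2) * ((z - y) * deriv (deriv \<phi>) r)"
      unfolding r .
    then have "\<bar>second_difference t \<phi> x\<bar> = t / 2 * ((z - y) * \<bar>deriv (deriv \<phi>) r\<bar>)"
      using t y z by (simp add: abs_mult)
    also have "\<dots> \<le> t / 2 * ((2 * t) * B)"
      using t y z B[of r] by (intro mult_left_mono mult_mono) auto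
    also have "\<dots> = B * t\<^sup>2" by (simp add: power2_eq_square)
    finally have b: "\<bar>second_difference t \<phi> x\<bar> \<le> B * t\<^sup>2" .
    have "\<bar>second_difference t \<phi> x\<bar> \<le> (2 * A + B) * 1" using a B0 by simp
    moreover have "\<bar>second_difference t \<phi> x\<bar> \<le> (2 * A + B) * t\<^sup>2"
      using b A0 mult_right_mono[of B "2 * A + B" "t\<^sup>2"] by simp
    ultimately show ?thesis by (simp add: min_def)
  qed
  then show ?thesis using A0 B0 by (intro exI[of _ "2 * A + B"]) auto
qed

text \<open>The pointwise form of \<^term>\<open>frac_const s\<close> times the fractional Laplacian of \<open>\<phi>\<close>.\<close>

definition singular_integral :: "real \<Rightarrow> (real \<Rightarrow> real) \<Rightarrow> real \<Rightarrow> real" where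
  "singular_integral s \<phi> x = (LBINT t. frac_kernel s t * second_difference t \<phi> x)"

lemma singular_integral_measurable:
  assumes [measurable]: "\<phi> \<in> borel_measurable borel"
  shows "singular_integral s \<phi> \<in> borel_measurable borel"
  unfolding singular_integral_def second_difference_def by measurable

lemma singular_integral_integrable:
  assumes s: "0 < s" "s < 1" and \<phi>: "\<phi> \<in> test_functions \<Omega>"
  shows "integrable lborel (\<lambda>t. frac_kernel s t * second_difference t \<phi> x)"
proof -
  have [measurable]: "\<phi> \<in> borel_measurable borel" by (rule test_functions_borel[OF \<phi>])
  obtain C where "\<And>t x. 0 < t \<Longrightarrow> \<bar>second_difference t \<phi> x\<bar> \<le> C * min 1 (t\<^sup>2)"
    using second_difference_bound[OF \<phi>] by blast
  then show ?thesis
    by (intro integrable_frac_kernel_mult(1)[OF s, of _ C]) (auto simp: second_difference_def)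
qed

lemma singular_integral_bounded:
  assumes s: "0 < s" "s < 1" and \<phi>: "\<phi> \<in> test_functions \<Omega>"
  obtains C where "\<And>x. (LBINT t. \<bar>frac_kernel s t * second_difference t \<phi> x\<bar>) \<le> C"
    "\<And>x. \<bar>singular_integral s \<phi> x\<bar> \<le> C"
proof -
  have [measurable]: "\<phi> \<in> borel_measurable borel" by (rule test_functions_borel[OF \<phi>])
  obtain C where C: "\<And>t x. 0 < t \<Longrightarrow> \<bar>second_difference t \<phi> x\<bar> \<le> C * min 1 (t\<^sup>2)"
    using second_difference_bound[OF \<phi>] by blast
  let ?C = "C * (LBINT t. frac_kernel s t * min 1 (t\<^sup>2))"
  have a: "(LBINT t. \<bar>frac_kernel s t * second_difference t \<phi> x\<bar>) \<le> ?C" for x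
    using C by (intro integrable_frac_kernel_mult(2)[OF s]) (auto simp: second_difference_def)
  have "\<bar>singular_integral s \<phi> x\<bar> \<le> ?C" for x
    unfolding singular_integral_def by (rule order_trans[OF integral_abs_bound a])
  with a show ?thesis by (rule that)
qed

lemma complex_borel_representative:
  fixes H :: "real \<Rightarrow> complex"
  assumes "H \<in> borel_measurable lebesgue"
  obtains K where "K \<in> borel_measurable borel" "AE x in lebesgue. H x = K x"
proof -
  have "(\<lambda>x. Re (H x)) \<in> borel_measurable lebesgue" "(\<lambda>x. Im (H x)) \<in> borel_measurable lebesgue"
    using assms by auto
  then obtain a b where [measurable]: "a \<in> borel_measurable borel" "b \<in> borel_measurable borel"
    and ab: "AE x in lborel. Re (H x) = a x" "AE x in lborel. Im (H x) = b x"
    using completion_ex_borel_measurable_real[of "\<lambda>x. Re (H x)" lborel] completion_ex_borel_measurable_real[of "\<lambda>x. Im (H x)" lborel]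
    by auto
  have "AE x in lborel. H x = complex_of_real (a x) + \<i> * complex_of_real (b x)"
    using ab by eventually_elim (simp add: complex_eq_iff)
  then have "AE x in lebesgue. H x = complex_of_real (a x) + \<i> * complex_of_real (b x)" by (rule AE_completion)
  then show ?thesis by (intro that[of "\<lambda>x. complex_of_real (a x) + \<i> * complex_of_real (b x)"]) auto
qed

text \<open>Insert \<open>frac_const_scaling\<close> into the Fourier side, exchange the integrals, use Parseval's identity for
each second difference, and exchange back. The second exchange needs \<open>u\<close> to be integrable because
the singular integral of \<open>\<phi>\<close> is controlled here by its supremum only.\<close>

theorem frac_laplacian_eq_singular_integral:
  assumes s: "0 < s" "s < 1" and u: "L2_on UNIV u" and u1: "integrable lebesgue u" and \<phi>: "\<phi> \<in> test_functions \<Omega>"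
  shows "complex_of_real (frac_const s) * frac_laplacian s u \<phi> = complex_of_real (LINT x|lebesgue. u x * singular_integral s \<phi> x)"
proof -
  have \<phi>m [measurable]: "\<phi> \<in> borel_measurable borel" by (rule test_functions_borel[OF \<phi>])
  note \<phi>d = test_function_fourier_decaying[OF \<phi>]
  let ?k = "frac_kernel s"
  let ?H = "\<lambda>\<xi>. fourier_L2 u \<xi> * cnj (fourier_integral \<phi> \<xi>)"
  let ?p = "\<lambda>\<xi>::real. \<bar>\<xi>\<bar> powr (2 * s)"
  have gL: "L2_on UNIV (fourier_L2 u)" using is_fourier_L2_fourier_L2[OF u] by (simp add: is_fourier_L2_def)
  have p_le: "\<bar>?p \<xi>\<bar> \<le> 1 + \<xi>\<^sup>2" for \<xi>
  proof (cases "\<bar>\<xi>\<bar> \<le> 1")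
    case True
    then have "?p \<xi> \<le> 1" using s by (intro powr_le1) auto
    then show ?thesis by (simp add: add_increasing2)
  next
    case False
    then have "?p \<xi> \<le> \<bar>\<xi>\<bar> powr 2" using s by (intro powr_mono) auto
    also have "\<dots> = \<xi>\<^sup>2" by (simp add: powr_numeral)
    finally show ?thesis by simp
  qed
  have pL: "L2_on UNIV (\<lambda>\<xi>. complex_of_real (?p \<xi>) * fourier_integral \<phi> \<xi>)"
    by (rule fourier_decaying_weighted_L2(1)[OF \<phi>d _ p_le]) measurable
  have pH: "integrable lebesgue (\<lambda>\<xi>. complex_of_real (?p \<xi>) * ?H \<xi>)"
    using L2_inner_product(1)[OF gL pL] by (simp add: mult_ac)
  have Hm: "?H \<in> borel_measurable lebesgue"
    using L2_inner_product(1)[OF gL fourier_decaying_transform(1)[OF \<phi>d]] by auto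
  obtain K where K [measurable]: "K \<in> borel_measurable borel" and HK: "AE \<xi> in lebesgue. ?H \<xi> = K \<xi>"
    using complex_borel_representative[OF Hm] .
  have Km: "K \<in> borel_measurable lebesgue" by (rule measurable_completion) simp
  have to_K: "(LINT \<xi>|lebesgue. complex_of_real (q \<xi>) * ?H \<xi>) = (LBINT \<xi>. complex_of_real (q \<xi>) * K \<xi>)"
    if [measurable]: "q \<in> borel_measurable borel" for q :: "real \<Rightarrow> real"
  proof -
    have qm: "(\<lambda>\<xi>. complex_of_real (q \<xi>)) \<in> borel_measurable lebesgue" by (rule measurable_completion) measurable
    have "(LINT \<xi>|lebesgue. complex_of_real (q \<xi>) * ?H \<xi>) = (LINT \<xi>|lebesgue. complex_of_real (q \<xi>) * K \<xi>)"
      using HK by (intro integral_cong_AE borel_measurable_times[OF qm Hm] borel_measurable_times[OF qm Km])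
        (auto elim: eventually_mono)
    also have "\<dots> = (LBINT \<xi>. complex_of_real (q \<xi>) * K \<xi>)" by (rule integral_completion) measurable
    finally show ?thesis .
  qed
  have pK: "integrable lborel (\<lambda>\<xi>. frac_const s * ?p \<xi> * norm (K \<xi>))"
  proof -
    have pm: "(\<lambda>\<xi>. complex_of_real (?p \<xi>)) \<in> borel_measurable lebesgue" by (rule measurable_completion) measurable
    have "integrable lebesgue (\<lambda>\<xi>. complex_of_real (?p \<xi>) * K \<xi>)"
      using pH by (rule integrable_cong_AE_imp) (use HK borel_measurable_times[OF pm Km] in \<open>auto elim: eventually_mono\<close>)
    then have "integrable lborel (\<lambda>\<xi>. complex_of_real (?p \<xi>) * K \<xi>)"
      by (subst (asm) integrable_completion) auto
    then have "integrable lborel (\<lambda>\<xi>. frac_const s * norm (complex_of_real (?p \<xi>) * K \<xi>))"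
      by (intro integrable_mult_right integrable_norm)
    then show ?thesis by (simp add: norm_mult mult.assoc)
  qed
  obtain w where w [measurable]: "w \<in> borel_measurable borel" and uw: "AE x in lebesgue. u x = w x" and w2: "L2_on UNIV w"
    using L2_on_borel_representative[OF u] .
  have um: "u \<in> borel_measurable lebesgue" "w \<in> borel_measurable lebesgue" using u w2 by (auto simp: L2_on_UNIV_iff)
  have to_w: "(LINT x|lebesgue. u x * q x) = (LBINT x. w x * q x)" if [measurable]: "q \<in> borel_measurable borel" for q :: "real \<Rightarrow> real"
  proof -
    have qm: "q \<in> borel_measurable lebesgue" by (rule measurable_completion) measurable
    have "(LINT x|lebesgue. u x * q x) = (LINT x|lebesgue. w x * q x)"
      using uw by (intro integral_cong_AE borel_measurable_times um qm) (auto elim: eventually_mono)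
    also have "\<dots> = (LBINT x. w x * q x)" by (rule integral_completion) measurable
    finally show ?thesis .
  qed
  have w1: "integrable lborel w"
  proof -
    have "integrable lebesgue w" using u1 by (rule integrable_cong_AE_imp) (use uw um in \<open>auto elim: eventually_mono\<close>)
    then show ?thesis by (subst (asm) integrable_completion) auto
  qed
  have "complex_of_real (frac_const s) * frac_laplacian s u \<phi>
      = complex_of_real (1 / (2 * pi)) * (LINT \<xi>|lebesgue. complex_of_real (frac_const s * ?p \<xi>) * ?H \<xi>)"
  proof -
    have "frac_laplacian s u \<phi> = complex_of_real (1 / (2 * pi)) * (LINT \<xi>|lebesgue. complex_of_real (?p \<xi>) * ?H \<xi>)"
      unfolding frac_laplacian_def by (simp only: mult.assoc)
    moreover have "(LINT \<xi>|lebesgue. complex_of_real (frac_const s * ?p \<xi>) * ?H \<xi>)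
        = complex_of_real (frac_const s) * (LINT \<xi>|lebesgue. complex_of_real (?p \<xi>) * ?H \<xi>)"
      unfolding of_real_mult mult.assoc[of "complex_of_real (frac_const s)"] by (rule integral_mult_right_zero)
    ultimately show ?thesis by (simp only: mult.left_commute)
  qed
  also have "(LINT \<xi>|lebesgue. complex_of_real (frac_const s * ?p \<xi>) * ?H \<xi>)
      = (LBINT \<xi>. complex_of_real (frac_const s * ?p \<xi>) * K \<xi>)"
    by (rule to_K) measurable
  also have "\<dots> = (LBINT \<xi>. complex_of_real (LBINT t. ?k t * (1 - cos (t * \<xi>))) * K \<xi>)"
    unfolding frac_const_scaling ..
  also have "\<dots> = (LBINT t. LBINT \<xi>. complex_of_real (?k t * (1 - cos (t * \<xi>))) * K \<xi>)"
  proof (rule Fubini_weighted_kernel[where W = "\<lambda>\<xi>. frac_const s * ?p \<xi>"])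
    show "integrable lborel (\<lambda>t. ?k t * (1 - cos (t * \<xi>)))" for \<xi>
      by (rule integrable_frac_kernel_mult(1)[OF s _ one_minus_cos_bound]) measurable
    have "\<bar>?k t * (1 - cos (t * \<xi>))\<bar> = ?k t * (1 - cos (t * \<xi>))" for t \<xi>
      by (intro abs_of_nonneg mult_nonneg_nonneg frac_kernel_nonneg) simp
    then show "(LBINT t. \<bar>?k t * (1 - cos (t * \<xi>))\<bar>) \<le> frac_const s * ?p \<xi>" for \<xi>
      by (simp add: frac_const_scaling)
  qed (use pK in measurable)
  also have "\<dots> = (LBINT t. complex_of_real (2 * pi) * (LBINT x. complex_of_real (?k t * second_difference t \<phi> x) * complex_of_real (w x)))"
  proof (intro Bochner_Integration.integral_cong refl)
    fix t
    have [measurable]: "second_difference t \<phi> \<in> borel_measurable borel" unfolding second_difference_def by measurable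
    have "(LBINT \<xi>. complex_of_real (?k t * (1 - cos (t * \<xi>))) * K \<xi>)
        = complex_of_real (?k t) * (LBINT \<xi>. complex_of_real (1 - cos (t * \<xi>)) * K \<xi>)"
      by (subst integral_mult_right_zero[symmetric]) (simp only: of_real_mult mult.assoc)
    also have "(LBINT \<xi>. complex_of_real (1 - cos (t * \<xi>)) * K \<xi>) = (LINT \<xi>|lebesgue. complex_of_real (1 - cos (t * \<xi>)) * ?H \<xi>)"
      by (rule to_K[symmetric]) measurable
    also have "\<dots> = complex_of_real (2 * pi * (LINT x|lebesgue. u x * second_difference t \<phi> x))"
      by (rule Parseval_second_difference[OF u \<phi>])
    also have "(LINT x|lebesgue. u x * second_difference t \<phi> x) = (LBINT x. w x * second_difference t \<phi> x)"
      by (rule to_w) measurable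
    also have "complex_of_real (?k t) * complex_of_real (2 * pi * (LBINT x. w x * second_difference t \<phi> x))
        = complex_of_real (2 * pi) * complex_of_real (LBINT x. ?k t * second_difference t \<phi> x * w x)"
    proof -
      have "(LBINT x. ?k t * second_difference t \<phi> x * w x) = ?k t * (LBINT x. w x * second_difference t \<phi> x)"
        by (subst integral_mult_right_zero[symmetric]) (simp only: mult_ac)
      then show ?thesis by (simp only: of_real_mult mult.left_commute)
    qed
    also have "complex_of_real (LBINT x. ?k t * second_difference t \<phi> x * w x)
        = (LBINT x. complex_of_real (?k t * second_difference t \<phi> x) * complex_of_real (w x))"
      by (simp only: integral_complex_of_real[symmetric] of_real_mult)
    finally show "(LBINT \<xi>. complex_of_real (?k t * (1 - cos (t * \<xi>))) * K \<xi>)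
        = complex_of_real (2 * pi) * (LBINT x. complex_of_real (?k t * second_difference t \<phi> x) * complex_of_real (w x))" .
  qed
  also have "\<dots> = complex_of_real (2 * pi) * (LBINT t. LBINT x. complex_of_real (?k t * second_difference t \<phi> x) * complex_of_real (w x))"
    by (rule integral_mult_right_zero)
  also have "(LBINT t. LBINT x. complex_of_real (?k t * second_difference t \<phi> x) * complex_of_real (w x))
      = (LBINT x. complex_of_real (LBINT t. ?k t * second_difference t \<phi> x) * complex_of_real (w x))"
  proof -
    obtain C where C: "\<And>x. (LBINT t. \<bar>?k t * second_difference t \<phi> x\<bar>) \<le> C"
      using singular_integral_bounded[OF s \<phi>] by blast
    show ?thesis
    proof (rule Fubini_weighted_kernel[symmetric, where W = "\<lambda>_. C"])
      show "integrable lborel (\<lambda>t. ?k t * second_difference t \<phi> x)" for x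
        by (rule singular_integral_integrable[OF s \<phi>])
      show "integrable lborel (\<lambda>x. C * norm (complex_of_real (w x)))" using w1 by simp
      show "(\<lambda>(x, t). ?k t * second_difference t \<phi> x) \<in> borel_measurable (borel \<Otimes>\<^sub>M borel)"
        unfolding second_difference_def by measurable
    qed (use C in auto)
  qed
  also have "\<dots> = complex_of_real (LBINT x. w x * singular_integral s \<phi> x)"
    unfolding singular_integral_def[symmetric]
    by (simp only: integral_complex_of_real[symmetric] of_real_mult mult.commute)
  also have "(LBINT x. w x * singular_integral s \<phi> x) = (LINT x|lebesgue. u x * singular_integral s \<phi> x)"
    by (rule to_w[symmetric]) (rule singular_integral_measurable[OF \<phi>m])
  finally show ?thesis by (simp add: mult.assoc[symmetric])
qed

section \<open>Smallness off the support and coercivity\<close>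

text \<open>The coefficients grow at most like \<open>2\<^sup>n\<close>, since the series converges at \<open>z = 1/2\<close>. For \<open>\<bar>z\<bar> \<le> 1/4\<close> this
leaves a geometric tail of ratio \<open>1/2\<close>.\<close>

lemma binomial_series_remainder:
  fixes e :: real
  shows "\<exists>D>0. \<forall>N z. \<bar>z\<bar> \<le> 1 / 4 \<longrightarrow> \<bar>(1 + z) powr e - (\<Sum>n<N. (e gchoose n) * z ^ n)\<bar> \<le> D * (1 / 2) ^ N"
proof -
  have "summable (\<lambda>n. (e gchoose n) * (1 / 2 :: real) ^ n)"
    using gen_binomial_real[of "1 / 2" e] by (auto simp: sums_iff)
  then have "Bseq (\<lambda>n. (e gchoose n) * (1 / 2 :: real) ^ n)"
    by (intro convergent_imp_Bseq) (auto simp: convergent_def dest: summable_LIMSEQ_zero)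
  then obtain M where M0: "0 < M" and M: "\<And>n. norm ((e gchoose n) * (1 / 2 :: real) ^ n) \<le> M"
    unfolding Bseq_def by blast
  have "\<bar>(1 + z) powr e - (\<Sum>n<N. (e gchoose n) * z ^ n)\<bar> \<le> 2 * M * (1 / 2) ^ N" if z: "\<bar>z\<bar> \<le> 1 / 4" for N z
  proof -
    let ?f = "\<lambda>n. (e gchoose n) * z ^ n"
    have sums: "?f sums ((1 + z) powr e)" using z by (intro gen_binomial_real) simp
    have term_le: "norm (?f n) \<le> M * (1 / 2) ^ n" for n
    proof -
      have "norm (?f n) = \<bar>e gchoose n\<bar> * \<bar>z\<bar> ^ n" by (simp add: abs_mult power_abs)
      also have "\<dots> \<le> \<bar>e gchoose n\<bar> * (1 / 4) ^ n" using z by (intro mult_left_mono power_mono) auto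
      also have "\<dots> = norm ((e gchoose n) * (1 / 2) ^ n) * (1 / 2) ^ n"
        by (simp add: abs_mult power_mult_distrib[symmetric] mult.assoc)
      also have "\<dots> \<le> M * (1 / 2) ^ n" by (intro mult_right_mono M) auto
      finally show ?thesis .
    qed
    have geo: "(\<lambda>n. M * (1 / 2) ^ N * (1 / 2 :: real) ^ n) sums (M * (1 / 2) ^ N * 2)"
      using sums_mult[OF geometric_sums[of "1 / 2 :: real"], of "M * (1 / 2) ^ N"] by simp
    have "(1 + z) powr e - (\<Sum>n<N. ?f n) = (\<Sum>n. ?f (n + N))"
      using suminf_minus_initial_segment[of ?f N] sums by (simp add: sums_iff)
    also have "norm \<dots> \<le> (\<Sum>n. M * (1 / 2) ^ N * (1 / 2) ^ n)"
    proof (rule norm_suminf_le)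
      show "norm (?f (n + N)) \<le> M * (1 / 2) ^ N * (1 / 2) ^ n" for n
        using term_le[of "n + N"] by (simp add: power_add mult_ac)
      show "summable (\<lambda>n. M * (1 / 2) ^ N * (1 / 2 :: real) ^ n)" using geo by (simp add: sums_iff)
    qed
    also have "\<dots> = 2 * M * (1 / 2) ^ N" using geo by (simp add: sums_iff)
    finally show ?thesis by simp
  qed
  with M0 show ?thesis by (intro exI[of _ "2 * M"]) auto
qed

text \<open>To the right of the support only the values \<open>\<phi> (y - t)\<close> survive in the second difference.\<close>

lemma singular_integral_off_support:
  assumes van: "\<And>x. 1 / 2 < \<bar>x\<bar> \<Longrightarrow> \<phi> x = 0" and y: "1 \<le> y"
  shows "singular_integral s \<phi> y = - (LBINT x. \<phi> x * (y - x) powr (- 1 - 2 * s)) / 2"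
proof -
  have "singular_integral s \<phi> y = (LBINT t. frac_kernel s t * (- (\<phi> (y - t) / 2)))"
    unfolding singular_integral_def
  proof (intro Bochner_Integration.integral_cong refl)
    fix t
    show "frac_kernel s t * second_difference t \<phi> y = frac_kernel s t * (- (\<phi> (y - t) / 2))"
      using y van[of y] van[of "y + t"] by (cases "0 < t") (auto simp: frac_kernel_def second_difference_def)
  qed
  also have "\<dots> = \<bar>- 1\<bar> *\<^sub>R (LBINT x. frac_kernel s (y + - 1 * x) * (- (\<phi> (y - (y + - 1 * x)) / 2)))"
    by (rule lborel_integral_real_affine) simp
  also have "\<dots> = (LBINT x. (- 1 / 2) * (\<phi> x * (y - x) powr (- 1 - 2 * s)))"
  proof -
    have "frac_kernel s (y + - 1 * x) * (- (\<phi> (y - (y + - 1 * x)) / 2)) = (- 1 / 2) * (\<phi> x * (y - x) powr (- 1 - 2 * s))" for x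
    proof (cases "\<bar>x\<bar> \<le> 1 / 2")
      case True
      then have "0 < y - x" using y by (simp add: abs_le_iff)
      then show ?thesis by (simp add: frac_kernel_def)
    qed (simp add: van)
    then show ?thesis by (simp only: abs_minus_cancel abs_one scaleR_one)
  qed
  also have "\<dots> = (- 1 / 2) * (LBINT x. \<phi> x * (y - x) powr (- 1 - 2 * s))"
    by (rule integral_mult_right_zero)
  finally show ?thesis by simp
qed

lemma test_function_mult_integrable:
  assumes \<phi>: "\<phi> \<in> test_functions \<Omega>" and p: "continuous_on UNIV p"
  shows "integrable lborel (\<lambda>x. \<phi> x * p x)"
proof -
  obtain M where "\<And>x. M < \<bar>x\<bar> \<Longrightarrow> \<phi> x = 0" using test_functions_bounded_support[OF \<phi>] by blast
  moreover have "continuous_on UNIV \<phi>" using \<phi> by (auto simp: test_functions_iff smooth_continuous)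
  ultimately show ?thesis
    by (intro continuous_compact_support_integrable[where M = M] continuous_intros p) auto
qed

text \<open>For \<open>\<bar>x\<bar> \<le> 1/2\<close> and \<open>y \<ge> 2\<close> the kernel \<open>(y - x)\<^sup>-\<^sup>1\<^sup>-\<^sup>2\<^sup>s\<close> is a power series in \<open>x / y\<close> with
\<open>\<bar>x / y\<bar> \<le> 1/4\<close>. The vanishing moments annihilate its first \<open>N\<close> terms. The constant \<open>D\<close> depends on \<open>s\<close>
only.\<close>

lemma singular_integral_exponentially_small:
  assumes s: "0 \<le> s"
  shows "\<exists>D>0. \<forall>N \<phi> y. \<phi> \<in> test_functions UNIV \<longrightarrow> (\<forall>x. 1 / 2 < \<bar>x\<bar> \<longrightarrow> \<phi> x = 0) \<longrightarrow>
    (\<forall>j<N. (LBINT x. \<phi> x * x ^ j) = 0) \<longrightarrow> 2 \<le> y \<longrightarrow>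
    \<bar>singular_integral s \<phi> y\<bar> \<le> D * (1 / 2) ^ N * (LBINT x. \<bar>\<phi> x\<bar>)"
proof -
  let ?e = "- 1 - 2 * s"
  obtain D where D: "0 < D" and rem: "\<And>N z. \<bar>z\<bar> \<le> 1 / 4 \<Longrightarrow>
      \<bar>(1 + z) powr ?e - (\<Sum>n<N. (?e gchoose n) * z ^ n)\<bar> \<le> D * (1 / 2) ^ N"
    using binomial_series_remainder[of ?e] by blast
  have "\<bar>singular_integral s \<phi> y\<bar> \<le> D * (1 / 2) ^ N * (LBINT x. \<bar>\<phi> x\<bar>)"
    if \<phi>: "\<phi> \<in> test_functions UNIV" and van: "\<And>x. 1 / 2 < \<bar>x\<bar> \<Longrightarrow> \<phi> x = 0"
      and mom: "\<And>j. j < N \<Longrightarrow> (LBINT x. \<phi> x * x ^ j) = 0" and y: "2 \<le> y" for N \<phi> y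
  proof -
    have [measurable]: "\<phi> \<in> borel_measurable borel" by (rule test_functions_borel[OF \<phi>])
    let ?a = "\<lambda>n. (?e gchoose n) * (- 1 / y) ^ n"
    let ?P = "\<lambda>x. \<Sum>n<N. ?a n * x ^ n"
    have i\<phi>: "integrable lborel (\<lambda>x. \<bar>\<phi> x\<bar>)" using test_functions_integrable[OF \<phi>] by simp
    have iP: "integrable lborel (\<lambda>x. \<phi> x * x ^ n)" for n
      by (intro test_function_mult_integrable[OF \<phi>] continuous_intros)
    have "(LBINT x. \<phi> x * ?P x) = (LBINT x. (\<Sum>n<N. ?a n * (\<phi> x * x ^ n)))"
      by (simp add: sum_distrib_left mult_ac)
    also have "\<dots> = (\<Sum>n<N. LBINT x. ?a n * (\<phi> x * x ^ n))"
      by (intro Bochner_Integration.integral_sum integrable_mult_right iP)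
    also have "\<dots> = 0" by (simp add: mom)
    finally have P0: "(LBINT x. \<phi> x * ?P x) = 0" .
    have iP': "integrable lborel (\<lambda>x. \<phi> x * ?P x)"
      by (intro test_function_mult_integrable[OF \<phi>] continuous_intros)
    have ptw: "\<bar>\<phi> x * (y - x) powr ?e - y powr ?e * (\<phi> x * ?P x)\<bar> \<le> D * (1 / 2) ^ N * \<bar>\<phi> x\<bar>" for x
    proof (cases "\<bar>x\<bar> \<le> 1 / 2")
      case True
      let ?z = "- 1 / y * x"
      have z: "\<bar>?z\<bar> \<le> 1 / 4"
      proof -
        have "\<bar>?z\<bar> = \<bar>x\<bar> / y" using y by (simp add: abs_mult)
        also have "\<dots> \<le> (1 / 2) / 2" using True y by (intro frac_le) auto
        finally show ?thesis by simp
      qed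
      have "y - x = y * (1 + ?z)" using y by (simp add: field_simps)
      moreover have "0 \<le> 1 + ?z" using abs_le_D2[OF z] by linarith
      ultimately have pw: "(y - x) powr ?e = y powr ?e * (1 + ?z) powr ?e" using y by (simp add: powr_mult)
      have Pz: "?P x = (\<Sum>n<N. (?e gchoose n) * ?z ^ n)"
        unfolding power_mult_distrib by (simp only: mult.assoc)
      have "\<phi> x * (y - x) powr ?e - y powr ?e * (\<phi> x * ?P x)
          = \<phi> x * (y powr ?e * ((1 + ?z) powr ?e - (\<Sum>n<N. (?e gchoose n) * ?z ^ n)))"
        unfolding pw Pz by (simp add: right_diff_distrib mult_ac)
      then have "\<bar>\<phi> x * (y - x) powr ?e - y powr ?e * (\<phi> x * ?P x)\<bar>
          = \<bar>\<phi> x\<bar> * (y powr ?e * \<bar>(1 + ?z) powr ?e - (\<Sum>n<N. (?e gchoose n) * ?z ^ n)\<bar>)"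
        by (simp add: abs_mult)
      also have "\<dots> \<le> \<bar>\<phi> x\<bar> * (1 * (D * (1 / 2) ^ N))"
      proof (intro mult_left_mono mult_mono rem z)
        have "y powr ?e \<le> y powr 0" using y s by (intro powr_mono) auto
        then show "y powr ?e \<le> 1" using y by simp
      qed auto
      finally show ?thesis by (simp add: mult_ac)
    qed (simp add: van)
    have im: "integrable lborel (\<lambda>x. \<phi> x * (y - x) powr ?e - y powr ?e * (\<phi> x * ?P x))"
      by (rule Bochner_Integration.integrable_bound[OF integrable_mult_right[OF i\<phi>, of "D * (1 / 2) ^ N"]])
        (measurable, use ptw D in \<open>auto intro!: AE_I2 simp: abs_mult\<close>)
    have "(LBINT x. \<phi> x * (y - x) powr ?e)
        = (LBINT x. (\<phi> x * (y - x) powr ?e - y powr ?e * (\<phi> x * ?P x)) + y powr ?e * (\<phi> x * ?P x))"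
      by simp
    also have "\<dots> = (LBINT x. \<phi> x * (y - x) powr ?e - y powr ?e * (\<phi> x * ?P x)) + y powr ?e * (LBINT x. \<phi> x * ?P x)"
      by (subst Bochner_Integration.integral_add[OF im integrable_mult_right[OF iP']])
        (simp only: integral_mult_right_zero)
    also have "\<dots> = (LBINT x. \<phi> x * (y - x) powr ?e - y powr ?e * (\<phi> x * ?P x))"
      unfolding P0 by simp
    finally have "\<bar>LBINT x. \<phi> x * (y - x) powr ?e\<bar> \<le> (LBINT x. \<bar>\<phi> x * (y - x) powr ?e - y powr ?e * (\<phi> x * ?P x)\<bar>)"
      by (simp only: integral_abs_bound)
    also have "\<dots> \<le> (LBINT x. D * (1 / 2) ^ N * \<bar>\<phi> x\<bar>)"
      by (intro integral_mono ptw integrable_abs im integrable_mult_right i\<phi>)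
    also have "\<dots> = D * (1 / 2) ^ N * (LBINT x. \<bar>\<phi> x\<bar>)" by (rule integral_mult_right_zero)
    finally have "\<bar>LBINT x. \<phi> x * (y - x) powr ?e\<bar> \<le> D * (1 / 2) ^ N * (LBINT x. \<bar>\<phi> x\<bar>)" .
    moreover have "\<bar>singular_integral s \<phi> y\<bar> = \<bar>LBINT x. \<phi> x * (y - x) powr ?e\<bar> / 2"
      using y by (subst singular_integral_off_support[OF van]) auto
    ultimately show ?thesis by linarith
  qed
  with D show ?thesis by blast
qed

lemma autocorrelation_le:
  fixes \<phi> :: "real \<Rightarrow> real"
  assumes [measurable]: "\<phi> \<in> borel_measurable borel" and i: "integrable lborel (\<lambda>x. (\<phi> x)\<^sup>2)"
  shows "integrable lborel (\<lambda>x. \<phi> x * \<phi> (x + a))" and "(LBINT x. \<phi> x * \<phi> (x + a)) \<le> (LBINT x. (\<phi> x)\<^sup>2)"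
proof -
  have i2: "integrable lborel (\<lambda>x. (\<phi> (x + a))\<^sup>2)"
    using lborel_integrable_real_affine[OF i, of 1 a] by (simp add: add.commute)
  have e: "(LBINT x. (\<phi> (x + a))\<^sup>2) = (LBINT x. (\<phi> x)\<^sup>2)"
    using lborel_integral_real_affine[of 1 "\<lambda>x. (\<phi> x)\<^sup>2" a] by (simp add: add.commute)
  show p: "integrable lborel (\<lambda>x. \<phi> x * \<phi> (x + a))"
    using i i2 by (intro Cauchy_Schwarz_integral(1)) auto
  have "(LBINT x. \<phi> x * \<phi> (x + a)) \<le> (LBINT x. ((\<phi> x)\<^sup>2 + (\<phi> (x + a))\<^sup>2) / 2)"
  proof (intro integral_mono p integrable_divide Bochner_Integration.integrable_add i i2)
    show "\<phi> x * \<phi> (x + a) \<le> ((\<phi> x)\<^sup>2 + (\<phi> (x + a))\<^sup>2) / 2" for x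
      using sum_squares_bound[of "\<phi> x" "\<phi> (x + a)"] by simp
  qed
  also have "\<dots> = (LBINT x. (\<phi> x)\<^sup>2)"
    using i i2 e by simp
  finally show "(LBINT x. \<phi> x * \<phi> (x + a)) \<le> (LBINT x. (\<phi> x)\<^sup>2)" .
qed

text \<open>The pairing is an integral over \<open>t\<close> of \<open>\<parallel>\<phi>\<parallel>\<^sup>2\<close> minus autocorrelations of \<open>\<phi>\<close>. This is nonnegative
for every \<open>t\<close>, and equals \<open>\<parallel>\<phi>\<parallel>\<^sup>2\<close> for \<open>t > 1\<close> since \<open>\<phi>\<close> and its translates then have disjoint supports.
Already \<open>1 < t < 2\<close>, where the kernel is at least \<open>1/8\<close>, gives the bound.\<close>

lemma singular_integral_coercive:
  assumes s: "0 < s" "s < 1" and \<phi>: "\<phi> \<in> test_functions \<Omega>" and van: "\<And>x. 1 / 2 < \<bar>x\<bar> \<Longrightarrow> \<phi> x = 0"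
  shows "(LBINT x. (\<phi> x)\<^sup>2) / 8 \<le> (LBINT x. singular_integral s \<phi> x * \<phi> x)"
proof -
  have m [measurable]: "\<phi> \<in> borel_measurable borel" by (rule test_functions_borel[OF \<phi>])
  let ?k = "frac_kernel s"
  let ?n = "LBINT x. (\<phi> x)\<^sup>2"
  have i1: "integrable lborel \<phi>" by (rule test_functions_integrable[OF \<phi>])
  have i2: "integrable lborel (\<lambda>x. (\<phi> x)\<^sup>2)"
    by (rule fourier_decaying_integrable(2)[OF test_function_fourier_decaying[OF \<phi>]])
  define Q where "Q = (\<lambda>t. LBINT x. second_difference t \<phi> x * \<phi> x)"
  have Qm [measurable]: "Q \<in> borel_measurable borel"
    unfolding Q_def second_difference_def by measurable
  have sd: "integrable lborel (\<lambda>x. second_difference t \<phi> x * \<phi> x)"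
    and Q_eq: "Q t = ?n - ((LBINT x. \<phi> x * \<phi> (x + t)) + (LBINT x. \<phi> x * \<phi> (x + - t))) / 2" for t
  proof -
    have eq: "(\<lambda>x. second_difference t \<phi> x * \<phi> x) = (\<lambda>x. (\<phi> x)\<^sup>2 - (\<phi> x * \<phi> (x + t) + \<phi> x * \<phi> (x + - t)) / 2)"
      by (simp add: fun_eq_iff second_difference_def power2_eq_square field_simps)
    note a = autocorrelation_le(1)[OF m i2]
    show "integrable lborel (\<lambda>x. second_difference t \<phi> x * \<phi> x)"
      unfolding eq by (intro Bochner_Integration.integrable_diff i2 integrable_divide Bochner_Integration.integrable_add a)
    show "Q t = ?n - ((LBINT x. \<phi> x * \<phi> (x + t)) + (LBINT x. \<phi> x * \<phi> (x + - t))) / 2"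
      unfolding Q_def eq
      by (subst Bochner_Integration.integral_diff)
        (intro i2 integrable_divide Bochner_Integration.integrable_add a
          | simp only: integral_divide_zero Bochner_Integration.integral_add[OF a a])+
  qed
  have Q0: "0 \<le> Q t" for t
    using autocorrelation_le(2)[OF m i2, of t] autocorrelation_le(2)[OF m i2, of "- t"] unfolding Q_eq by simp
  have Q1: "Q t = ?n" if "1 < t" for t
  proof -
    have "\<phi> x * \<phi> (x + t) = 0 \<and> \<phi> x * \<phi> (x + - t) = 0" for x
    proof (cases "1 / 2 < \<bar>x\<bar>")
      case False
      then have "1 / 2 < \<bar>x + t\<bar>" "1 / 2 < \<bar>x + - t\<bar>" using that by linarith+
      then show ?thesis by (simp only: van mult_zero_right simp_thms)
    qed (simp add: van)
    then have "\<phi> x * \<phi> (x + t) = 0" "\<phi> x * \<phi> (x + - t) = 0" for x by blast+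
    then show ?thesis unfolding Q_eq by (simp only:) simp
  qed
  obtain C where C: "\<And>t x. 0 < t \<Longrightarrow> \<bar>second_difference t \<phi> x\<bar> \<le> C * min 1 (t\<^sup>2)"
    using second_difference_bound[OF \<phi>] by blast
  have Qi: "integrable lborel (\<lambda>t. ?k t * Q t)"
  proof (rule integrable_frac_kernel_mult(1)[OF s Qm])
    fix t :: real assume t: "0 < t"
    have "\<bar>Q t\<bar> \<le> (LBINT x. \<bar>second_difference t \<phi> x * \<phi> x\<bar>)"
      unfolding Q_def by (rule integral_abs_bound)
    also have "\<dots> \<le> (LBINT x. C * min 1 (t\<^sup>2) * \<bar>\<phi> x\<bar>)"
    proof (intro integral_mono integrable_mult_right integrable_abs sd i1)
      show "\<bar>second_difference t \<phi> x * \<phi> x\<bar> \<le> C * min 1 (t\<^sup>2) * \<bar>\<phi> x\<bar>" for x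
        unfolding abs_mult by (intro mult_right_mono C t) auto
    qed
    also have "\<dots> = C * (LBINT x. \<bar>\<phi> x\<bar>) * min 1 (t\<^sup>2)" by simp
    finally show "\<bar>Q t\<bar> \<le> C * (LBINT x. \<bar>\<phi> x\<bar>) * min 1 (t\<^sup>2)" .
  qed
  have "complex_of_real (LBINT x. singular_integral s \<phi> x * \<phi> x)
      = (LBINT x. complex_of_real (LBINT t. ?k t * second_difference t \<phi> x) * complex_of_real (\<phi> x))"
    unfolding singular_integral_def by (simp only: integral_complex_of_real[symmetric] of_real_mult)
  also have "\<dots> = (LBINT t. LBINT x. complex_of_real (?k t * second_difference t \<phi> x) * complex_of_real (\<phi> x))"
  proof -
    obtain B where B: "\<And>x. (LBINT t. \<bar>?k t * second_difference t \<phi> x\<bar>) \<le> B"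
      using singular_integral_bounded[OF s \<phi>] by blast
    show ?thesis
    proof (rule Fubini_weighted_kernel[where W = "\<lambda>_. B"])
      show "integrable lborel (\<lambda>t. ?k t * second_difference t \<phi> x)" for x
        by (rule singular_integral_integrable[OF s \<phi>])
      show "integrable lborel (\<lambda>x. B * norm (complex_of_real (\<phi> x)))" using i1 by simp
      show "(\<lambda>(x, t). ?k t * second_difference t \<phi> x) \<in> borel_measurable (borel \<Otimes>\<^sub>M borel)"
        unfolding second_difference_def by measurable
    qed (use B in auto)
  qed
  also have "\<dots> = (LBINT t. complex_of_real (?k t * Q t))"
  proof (intro Bochner_Integration.integral_cong refl)
    fix t
    have "(LBINT x. complex_of_real (?k t * second_difference t \<phi> x) * complex_of_real (\<phi> x))
        = complex_of_real (LBINT x. ?k t * (second_difference t \<phi> x * \<phi> x))"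
      by (simp only: integral_complex_of_real[symmetric] of_real_mult mult.assoc)
    also have "(LBINT x. ?k t * (second_difference t \<phi> x * \<phi> x)) = ?k t * Q t"
      unfolding Q_def by (rule integral_mult_right_zero)
    finally show "(LBINT x. complex_of_real (?k t * second_difference t \<phi> x) * complex_of_real (\<phi> x))
        = complex_of_real (?k t * Q t)" .
  qed
  also have "\<dots> = complex_of_real (LBINT t. ?k t * Q t)" by (rule integral_complex_of_real)
  finally have eq: "(LBINT x. singular_integral s \<phi> x * \<phi> x) = (LBINT t. ?k t * Q t)"
    by (simp only: of_real_eq_iff)
  have n8: "(LBINT t. indicator {1<..<2::real} t * (?n / 8)) = ?n / 8"
    by simp
  have "(LBINT t. indicator {1<..<2::real} t * (?n / 8)) \<le> (LBINT t. ?k t * Q t)"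
  proof (rule integral_mono[OF _ Qi])
    show "integrable lborel (\<lambda>t. indicator {1<..<2::real} t * (?n / 8))"
      by (intro integrable_mult_left integrable_real_indicator) auto
    fix t :: real
    show "indicator {1<..<2} t * (?n / 8) \<le> ?k t * Q t"
    proof (cases "t \<in> {1<..<2}")
      case True
      have "1 / 8 = (2::real) powr (- 3)" by (simp add: powr_minus powr_numeral)
      also have "\<dots> \<le> 2 powr (- 1 - 2 * s)" using s by (intro powr_mono) auto
      also have "\<dots> \<le> t powr (- 1 - 2 * s)" using True s by (intro powr_mono2') auto
      finally have "1 / 8 * ?n \<le> t powr (- 1 - 2 * s) * ?n" by (intro mult_right_mono) auto
      then show ?thesis using True Q1[of t] by (simp add: frac_kernel_def)
    next
      case False
      then show ?thesis using Q0 frac_kernel_nonneg by (simp add: zero_le_mult_iff)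
    qed
  qed
  then show ?thesis unfolding eq n8 .
qed

section \<open>Duality and the cost of control\<close>

lemma L2_on_zero_extension:
  fixes f :: "real \<Rightarrow> real"
  assumes f: "L2_on W f" and W: "W \<in> sets lebesgue"
  shows "L2_on UNIV (zero_extension W f)"
proof -
  have eq: "zero_extension W f = (\<lambda>x. if x \<in> W then f x else 0)"
    by (simp add: zero_extension_def fun_eq_iff)
  have sq: "(\<lambda>x. (norm (zero_extension W f x))\<^sup>2) = (\<lambda>x. if x \<in> W then (norm (f x))\<^sup>2 else 0)"
    by (simp add: zero_extension_def fun_eq_iff)
  show ?thesis
    unfolding L2_on_UNIV_iff sq Lebesgue_Measure.integrable_restrict_UNIV[OF W]
    using f W unfolding eq L2_on_def by (auto intro: borel_measurable_if_I)
qed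

lemma integrable_if_vanishes_outside:
  fixes u :: "real \<Rightarrow> real"
  assumes u: "L2_on UNIV u" and van: "AE x in lebesgue. x \<notin> {a..b} \<longrightarrow> u x = 0"
  shows "integrable lebesgue u"
proof -
  have um: "u \<in> borel_measurable lebesgue" using u by (simp add: L2_on_UNIV_iff)
  have ind: "(\<lambda>x. indicator {a..b} x :: real) \<in> borel_measurable lebesgue"
    by (intro borel_measurable_indicator) auto
  have "L2_on UNIV (\<lambda>x. indicator {a..b} x :: real)"
  proof -
    have "(norm (indicator {a..b} x :: real))\<^sup>2 = indicator {a..b} x" for x :: real by (auto simp: indicator_def)
    then show ?thesis
      by (subst L2_on_UNIV_borel_iff) (auto simp del: real_norm_def simp: emeasure_lborel_Icc_eq intro!: integrable_real_indicator)
  qed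
  then have "integrable lebesgue (\<lambda>x. u x * indicator {a..b} x)" by (rule L2_mult_integrable[OF u])
  then show ?thesis
    by (rule integrable_cong_AE_imp[OF _ um]) (use van in \<open>auto elim!: eventually_mono simp: indicator_def\<close>)
qed

lemma borel_measurable_lebesgue_cong_AE:
  fixes f g :: "real \<Rightarrow> real"
  assumes f: "f \<in> borel_measurable lebesgue" and ae: "AE x in lebesgue. f x = g x"
  shows "g \<in> borel_measurable lebesgue"
proof (rule measurableI)
  fix A :: "real set" assume A: "A \<in> sets borel"
  obtain N where N: "N \<in> null_sets lebesgue" "{x. f x \<noteq> g x} \<subseteq> N"
    using ae unfolding eventually_ae_filter by auto
  have "f -` A \<inter> space lebesgue \<in> sets lebesgue" using f A by (rule measurable_sets)
  moreover have "g -` A \<inter> N \<in> null_sets lebesgue"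
    by (rule null_sets_completion_subset[OF _ N(1)]) auto
  ultimately have "(f -` A \<inter> space lebesgue - N) \<union> (g -` A \<inter> N) \<in> sets lebesgue"
    using N(1) by (intro sets.Un sets.Diff) auto
  also have "(f -` A \<inter> space lebesgue - N) \<union> (g -` A \<inter> N) = g -` A \<inter> space lebesgue"
  proof -
    have "f x = g x" if "x \<notin> N" for x using N(2) that by blast
    then show ?thesis by auto
  qed
  finally show "g -` A \<inter> space lebesgue \<in> sets lebesgue" .
qed simp

text \<open>The weak formulation tested with a single \<open>\<phi>\<close>. On \<open>[-1,1]\<close> the solution agrees with its correction \<open>v\<close>,
and \<open>v\<close> vanishes elsewhere.\<close>

lemma exterior_solution_duality:
  assumes s: "0 < s" "s < 1" and f: "L2_on {2..3} f"
    and sol: "exterior_value_solution s {-1<..<1} {2..3} f w" and \<phi>: "\<phi> \<in> test_functions {-1<..<1}"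
  shows "(LINT x|lebesgue_on {-1..1}. w x * singular_integral s \<phi> x) = - (LINT x|lebesgue_on {2..3}. f x * singular_integral s \<phi> x)"
    and "integrable (lebesgue_on {-1..1}) (\<lambda>x. w x * singular_integral s \<phi> x)"
proof -
  let ?G = "singular_integral s \<phi>" and ?E = "zero_extension {2..3} f"
  have Gm: "?G \<in> borel_measurable lebesgue"
    by (rule measurable_completion) (simp add: singular_integral_measurable[OF test_functions_borel[OF \<phi>]])
  obtain B where B: "\<And>x. \<bar>?G x\<bar> \<le> B" using singular_integral_bounded[OF s \<phi>] by blast
  obtain v where v: "v \<in> Hs_tilde s {-1<..<1}"
    and weak: "frac_laplacian s v \<phi> = - frac_laplacian s ?E \<phi>"
    and w: "AE x in lebesgue. w x = ?E x + v x"
    using sol \<phi> unfolding exterior_value_solution_def by blast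
  have vL: "L2_on UNIV v" using v by (simp add: Hs_tilde_def Hs_def)
  have van: "AE x in lebesgue. x \<notin> {-1..1} \<longrightarrow> v x = 0"
    using Hs_tilde_vanishes_outside[OF v] s by simp
  have v1: "integrable lebesgue v" by (rule integrable_if_vanishes_outside[OF vL van])
  have EL: "L2_on UNIV ?E" by (rule L2_on_zero_extension[OF f]) simp
  have E1: "integrable lebesgue ?E"
    by (rule integrable_if_vanishes_outside[OF EL, of 2 3]) (simp add: zero_extension_def)
  have "complex_of_real (LINT x|lebesgue. v x * ?G x) = complex_of_real (- (LINT x|lebesgue. ?E x * ?G x))"
    using frac_laplacian_eq_singular_integral[OF s vL v1 \<phi>] frac_laplacian_eq_singular_integral[OF s EL E1 \<phi>] weak
    by simp
  then have vE: "(LINT x|lebesgue. v x * ?G x) = - (LINT x|lebesgue. ?E x * ?G x)"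
    by (simp only: of_real_eq_iff)
  have vG: "integrable lebesgue (\<lambda>x. v x * ?G x)"
  proof (rule Bochner_Integration.integrable_bound[OF integrable_mult_right[OF v1, of B]])
    show "AE x in lebesgue. norm (v x * ?G x) \<le> norm (B * v x)"
    proof (rule AE_I2)
      fix x
      have "\<bar>v x\<bar> * \<bar>?G x\<bar> \<le> \<bar>v x\<bar> * \<bar>B\<bar>" by (intro mult_left_mono order_trans[OF B]) auto
      then show "norm (v x * ?G x) \<le> norm (B * v x)" by (simp add: abs_mult mult.commute)
    qed
  qed (use Gm vL in \<open>auto simp: L2_on_UNIV_iff intro!: borel_measurable_times\<close>)
  have ae: "AE x in lebesgue. (if x \<in> {-1..1} then w x * ?G x else 0) = v x * ?G x"
    using w van by eventually_elim (auto simp: zero_extension_def)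
  have wm: "(\<lambda>x. if x \<in> {-1..1} then w x * ?G x else 0) \<in> borel_measurable lebesgue"
    by (rule borel_measurable_lebesgue_cong_AE[OF borel_measurable_integrable[OF vG]])
      (use ae in \<open>auto elim: eventually_mono\<close>)
  have "integrable lebesgue (\<lambda>x. if x \<in> {-1..1} then w x * ?G x else 0)"
    by (rule integrable_cong_AE_imp[OF vG wm]) (use ae in \<open>auto elim: eventually_mono\<close>)
  then show "integrable (lebesgue_on {-1..1}) (\<lambda>x. w x * ?G x)"
    by (subst (asm) Lebesgue_Measure.integrable_restrict_UNIV) auto
  have "(LINT x|lebesgue_on {-1..1}. w x * ?G x) = (LINT x|lebesgue. (if x \<in> {-1..1} then w x * ?G x else 0))"
    by (rule Lebesgue_Measure.integral_restrict_UNIV[symmetric]) simp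
  also have "\<dots> = (LINT x|lebesgue. v x * ?G x)"
    using vG by (intro integral_cong_AE wm ae) auto
  also note vE
  also have "(LINT x|lebesgue. ?E x * ?G x) = (LINT x|lebesgue. (if x \<in> {2..3} then f x * ?G x else 0))"
    by (intro Bochner_Integration.integral_cong refl) (simp add: zero_extension_def)
  also have "\<dots> = (LINT x|lebesgue_on {2..3}. f x * ?G x)"
    by (rule Lebesgue_Measure.integral_restrict_UNIV) simp
  finally show "(LINT x|lebesgue_on {-1..1}. w x * ?G x) = - (LINT x|lebesgue_on {2..3}. f x * ?G x)" .
qed

lemma measurable_lebesgue_on_of_borel:
  "f \<in> borel_measurable borel \<Longrightarrow> f \<in> borel_measurable (lebesgue_on S)"
  by (intro measurable_restrict_space1 measurable_completion) simp

lemma integrable_lebesgue_on_bounded: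
  fixes f :: "real \<Rightarrow> real"
  assumes f: "f \<in> borel_measurable borel" and B: "\<And>x. x \<in> {a..b} \<Longrightarrow> \<bar>f x\<bar> \<le> B"
  shows "integrable (lebesgue_on {a..b}) f"
proof -
  have "integrable (lebesgue_on {a..b}) (\<lambda>_. B)"
    by (subst integrable_restrict_space) (auto intro!: integrable_mult_left integrable_real_indicator simp: emeasure_lborel_Icc_eq)
  then show ?thesis
  proof (rule Bochner_Integration.integrable_bound)
    show "f \<in> borel_measurable (lebesgue_on {a..b})" by (rule measurable_lebesgue_on_of_borel[OF f])
    show "AE x in lebesgue_on {a..b}. norm (f x) \<le> norm B"
      by (rule AE_I2) (auto intro: order_trans[OF B abs_ge_self])
  qed
qed

lemma integral_lebesgue_on_eq_lborel:
  fixes f :: "real \<Rightarrow> real"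
  assumes f: "f \<in> borel_measurable borel" and van: "\<And>x. x \<notin> {a..b} \<Longrightarrow> f x = 0"
  shows "(LINT x|lebesgue_on {a..b}. f x) = (LBINT x. f x)"
proof -
  have "(LINT x|lebesgue_on {a..b}. f x) = (LINT x|lebesgue. (if x \<in> {a..b} then f x else 0))"
    by (rule Lebesgue_Measure.integral_restrict_UNIV[symmetric]) simp
  also have "\<dots> = (LINT x|lebesgue. f x)"
    using van by (intro Bochner_Integration.integral_cong refl) auto
  also have "\<dots> = (LBINT x. f x)" using f by (intro integral_completion) simp
  finally show ?thesis .
qed

text \<open>Coercivity bounds the pairing of \<open>g\<close> with \<open>\<phi>\<close> from below. On the support of \<open>\<phi>\<close> the weight
\<open>(1 - x\<^sup>2)\<^sup>-\<^sup>s\<close> is at most \<open>4/3\<close>, so the weight costs only a constant in the Cauchy-Schwarz inequality.\<close>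

lemma weighted_norm_lower_bound:
  assumes s: "0 < s" "s < 1" and \<phi>: "\<phi> \<in> test_functions \<Omega>" and van: "\<And>x. 1 / 2 < \<bar>x\<bar> \<Longrightarrow> \<phi> x = 0"
  shows "3 / 32 * sqrt (LBINT x. (\<phi> x)\<^sup>2) \<le> L2_norm {-1..1} (\<lambda>x. (1 - x\<^sup>2) powr s * singular_integral s \<phi> x)"
proof -
  let ?G = "singular_integral s \<phi>" and ?I = "lebesgue_on {-1..1::real}"
  let ?A = "L2_norm {-1..1} (\<lambda>x. (1 - x\<^sup>2) powr s * ?G x)"
  have m [measurable]: "\<phi> \<in> borel_measurable borel" by (rule test_functions_borel[OF \<phi>])
  have Gm [measurable]: "?G \<in> borel_measurable borel" by (rule singular_integral_measurable[OF m])
  obtain B where B: "\<And>x. \<bar>?G x\<bar> \<le> B" using singular_integral_bounded[OF s \<phi>] by blast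
  have i2: "integrable lborel (\<lambda>x. (\<phi> x)\<^sup>2)"
    by (rule fourier_decaying_integrable(2)[OF test_function_fourier_decaying[OF \<phi>]])
  have wt1: "(1 - x\<^sup>2) powr s \<le> 1" if "x \<in> {-1..1}" for x :: real
  proof -
    have "0 \<le> 1 - x\<^sup>2" using that by (simp add: abs_square_le_1 abs_le_iff)
    then show ?thesis using s by (intro powr_le1) auto
  qed
  have bG: "\<bar>((1 - x\<^sup>2) powr s * ?G x)\<^sup>2\<bar> \<le> B\<^sup>2" if "x \<in> {-1..1}" for x
  proof -
    have "\<bar>(1 - x\<^sup>2) powr s * ?G x\<bar> \<le> 1 * B"
      unfolding abs_mult using wt1[OF that] B[of x] by (intro mult_mono) auto
    then have "\<bar>(1 - x\<^sup>2) powr s * ?G x\<bar>\<^sup>2 \<le> B\<^sup>2" by (intro power_mono) auto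
    then show ?thesis by simp
  qed
  let ?\<psi> = "\<lambda>x. (1 - x\<^sup>2) powr (- s) * \<phi> x"
  have wtinv: "(1 - x\<^sup>2) powr (- s) \<le> 4 / 3" and pos: "0 < 1 - x\<^sup>2" if "\<bar>x\<bar> \<le> 1 / 2" for x :: real
  proof -
    have "x\<^sup>2 \<le> (1 / 2)\<^sup>2" using that by (simp add: abs_le_square_iff[symmetric])
    then have x: "3 / 4 \<le> 1 - x\<^sup>2" by (simp add: power2_eq_square)
    then show "0 < 1 - x\<^sup>2" by linarith
    have "(1 - x\<^sup>2) powr (- s) \<le> (3 / 4) powr (- s)" using x s by (intro powr_mono2') auto
    also have "\<dots> \<le> (3 / 4) powr (- 1)" using s by (intro powr_mono') auto
    also have "\<dots> = 4 / 3" by (simp add: powr_minus)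
    finally show "(1 - x\<^sup>2) powr (- s) \<le> 4 / 3" .
  qed
  have \<psi>le: "(?\<psi> x)\<^sup>2 \<le> 16 / 9 * (\<phi> x)\<^sup>2" for x
  proof (cases "\<bar>x\<bar> \<le> 1 / 2")
    case True
    have "((1 - x\<^sup>2) powr (- s))\<^sup>2 \<le> (4 / 3)\<^sup>2" using wtinv[OF True] by (intro power_mono) auto
    then have "((1 - x\<^sup>2) powr (- s))\<^sup>2 * (\<phi> x)\<^sup>2 \<le> (4 / 3)\<^sup>2 * (\<phi> x)\<^sup>2" by (intro mult_right_mono) auto
    then show ?thesis by (simp add: power_mult_distrib power_divide)
  qed (simp add: van)
  have \<psi>i: "integrable lborel (\<lambda>x. (?\<psi> x)\<^sup>2)"
    by (rule Bochner_Integration.integrable_bound[OF integrable_mult_right[OF i2, of "16 / 9"]])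
      (measurable, use \<psi>le in \<open>auto intro!: AE_I2\<close>)
  have \<psi>n: "(LINT x|?I. (norm (?\<psi> x))\<^sup>2) \<le> 16 / 9 * (LBINT x. (\<phi> x)\<^sup>2)"
  proof -
    have "(LINT x|?I. (norm (?\<psi> x))\<^sup>2) = (LBINT x. (?\<psi> x)\<^sup>2)"
      using van by (subst integral_lebesgue_on_eq_lborel) auto
    also have "\<dots> \<le> (LBINT x. 16 / 9 * (\<phi> x)\<^sup>2)"
      by (intro integral_mono \<psi>i \<psi>le integrable_mult_right i2)
    finally show ?thesis by simp
  qed
  have "(LBINT x. (\<phi> x)\<^sup>2) / 8 \<le> (LBINT x. ?G x * \<phi> x)"
    by (rule singular_integral_coercive[OF s \<phi> van])
  also have "\<dots> = (LINT x|?I. ?G x * \<phi> x)"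
    using van by (subst integral_lebesgue_on_eq_lborel) auto
  also have "\<dots> = (LINT x|?I. ((1 - x\<^sup>2) powr s * ?G x) * ?\<psi> x)"
  proof (intro Bochner_Integration.integral_cong refl)
    fix x
    show "?G x * \<phi> x = ((1 - x\<^sup>2) powr s * ?G x) * ?\<psi> x"
    proof (cases "\<bar>x\<bar> \<le> 1 / 2")
      case True
      have "(1 - x\<^sup>2) powr s * (1 - x\<^sup>2) powr (- s) = 1"
        using pos[OF True] by (simp add: powr_minus)
      then have "((1 - x\<^sup>2) powr s * (1 - x\<^sup>2) powr (- s)) * (?G x * \<phi> x) = ?G x * \<phi> x" by simp
      then show ?thesis by (simp only: mult_ac)
    qed (simp add: van)
  qed
  also have "\<dots> \<le> norm (LINT x|?I. ((1 - x\<^sup>2) powr s * ?G x) * ?\<psi> x)" by simp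
  also have "\<dots> \<le> sqrt (LINT x|?I. (norm ((1 - x\<^sup>2) powr s * ?G x))\<^sup>2) * sqrt (LINT x|?I. (norm (?\<psi> x))\<^sup>2)"
  proof (rule Cauchy_Schwarz_integral(2))
    show "(\<lambda>x. (1 - x\<^sup>2) powr s * ?G x) \<in> borel_measurable ?I" "?\<psi> \<in> borel_measurable ?I"
      by (rule measurable_lebesgue_on_of_borel, measurable)+
    show "integrable ?I (\<lambda>x. (norm ((1 - x\<^sup>2) powr s * ?G x))\<^sup>2)"
      using bG by (intro integrable_lebesgue_on_bounded[where B = "B\<^sup>2"]) auto
    have "integrable lebesgue (\<lambda>x. (?\<psi> x)\<^sup>2)" using \<psi>i by (subst integrable_completion) auto
    then have "integrable lebesgue (\<lambda>x. if x \<in> {-1..1} then (?\<psi> x)\<^sup>2 else 0)"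
      by (rule back_subst[of "integrable lebesgue"]) (use van in \<open>auto simp: fun_eq_iff\<close>)
    then show "integrable ?I (\<lambda>x. (norm (?\<psi> x))\<^sup>2)"
      by (subst (asm) Lebesgue_Measure.integrable_restrict_UNIV) auto
  qed
  also have "\<dots> \<le> ?A * (4 / 3 * sqrt (LBINT x. (\<phi> x)\<^sup>2))"
  proof -
    have "sqrt (LINT x|?I. (norm (?\<psi> x))\<^sup>2) \<le> sqrt ((4 / 3)\<^sup>2 * (LBINT x. (\<phi> x)\<^sup>2))"
      using \<psi>n by (intro real_sqrt_le_mono) (simp add: power_divide)
    also have "\<dots> = 4 / 3 * sqrt (LBINT x. (\<phi> x)\<^sup>2)" by (simp add: real_sqrt_mult)
    finally show ?thesis
      unfolding L2_norm_def by (intro mult_left_mono) auto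
  qed
  finally have main: "(LBINT x. (\<phi> x)\<^sup>2) / 8 \<le> ?A * (4 / 3 * sqrt (LBINT x. (\<phi> x)\<^sup>2))" .
  show ?thesis
  proof (cases "(LBINT x. (\<phi> x)\<^sup>2) = 0")
    case True
    then show ?thesis by (simp add: L2_norm_def)
  next
    case False
    let ?n = "sqrt (LBINT x. (\<phi> x)\<^sup>2)"
    have n0: "0 \<le> (LBINT x. (\<phi> x)\<^sup>2)" by simp
    have n: "0 < ?n" by (rule real_sqrt_gt_zero[OF le_neq_trans[OF n0 False[symmetric]]])
    have "?n * (?n / 8) \<le> ?n * (?A * (4 / 3))"
      using main n0 by (simp add: mult_ac)
    then have "?n / 8 \<le> ?A * (4 / 3)" using n by (simp only: mult_le_cancel_left_pos)
    then show ?thesis by linarith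
  qed
qed

text \<open>The target \<open>h\<close> is aligned with \<open>g\<close>: its pairing with \<open>g\<close> is \<open>2 \<delta> A\<close>, and an error of weighted norm \<open>\<delta>\<close>
removes at most \<open>\<delta> A\<close>. What remains must be supplied by the control through \<open>exterior_solution_duality\<close>.\<close>

lemma control_lower_bound:
  assumes s: "0 < s" "s < 1" and \<phi>: "\<phi> \<in> test_functions {-1<..<1}" and van: "\<And>x. 1 / 2 < \<bar>x\<bar> \<Longrightarrow> \<phi> x = 0"
    and small: "\<And>y. 2 \<le> y \<Longrightarrow> \<bar>singular_integral s \<phi> y\<bar> \<le> b"
    and \<delta>: "0 < \<delta>" and A: "A = L2_norm {-1..1} (\<lambda>x. (1 - x\<^sup>2) powr s * singular_integral s \<phi> x)" "0 < A"
    and h: "h = (\<lambda>x. 2 * \<delta> / A * ((1 - x\<^sup>2) powr (2 * s) * singular_integral s \<phi> x))"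
    and E: "L2_on {-1..1} (\<lambda>x. (1 - x\<^sup>2) powr (- s) * (h x - w x))"
    and En: "L2_norm {-1..1} (\<lambda>x. (1 - x\<^sup>2) powr (- s) * (h x - w x)) \<le> \<delta>"
    and f: "L2_on {2..3} f" and sol: "exterior_value_solution s {-1<..<1} {2..3} f w"
  shows "\<delta> * A \<le> L2_norm {2..3} f * b"
proof -
  let ?G = "singular_integral s \<phi>" and ?I = "lebesgue_on {-1..1::real}"
  let ?\<omega> = "\<lambda>x::real. (1 - x\<^sup>2) powr s"
  let ?e = "\<lambda>x. (1 - x\<^sup>2) powr (- s) * (h x - w x)"
  have m [measurable]: "\<phi> \<in> borel_measurable borel" by (rule test_functions_borel[OF \<phi>])
  have Gm [measurable]: "?G \<in> borel_measurable borel" by (rule singular_integral_measurable[OF m])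
  obtain B where B: "\<And>x. \<bar>?G x\<bar> \<le> B" using singular_integral_bounded[OF s \<phi>] by blast
  have wt1: "0 \<le> 1 - x\<^sup>2" if "x \<in> {-1..1}" for x :: real
    using that by (simp add: abs_square_le_1 abs_le_iff)
  have wG: "\<bar>?\<omega> x * ?G x\<bar> \<le> B" if "x \<in> {-1..1}" for x
  proof -
    have "?\<omega> x \<le> 1" using wt1[OF that] s by (intro powr_le1) auto
    then have "\<bar>?\<omega> x * ?G x\<bar> \<le> 1 * B"
      unfolding abs_mult using B[of x] by (intro mult_mono) auto
    then show ?thesis by simp
  qed
  have wG2: "\<bar>(?\<omega> x * ?G x)\<^sup>2\<bar> \<le> B\<^sup>2" if "x \<in> {-1..1}" for x
    using power_mono[OF wG[OF that] abs_ge_zero, of 2] by simp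
  have i: "integrable ?I (\<lambda>x. (?\<omega> x * ?G x)\<^sup>2)"
    by (rule integrable_lebesgue_on_bounded[OF _ wG2]) measurable
  have A2: "(LINT x|?I. (?\<omega> x * ?G x)\<^sup>2) = A\<^sup>2"
    unfolding A(1) L2_norm_def by simp
  have hG: "h x * ?G x = 2 * \<delta> / A * (?\<omega> x * ?G x)\<^sup>2" for x
  proof -
    have "(1 - x\<^sup>2) powr (2 * s) = (?\<omega> x)\<^sup>2"
      by (simp add: power2_eq_square powr_add[symmetric])
    then show ?thesis unfolding h by (simp add: power2_eq_square)
  qed
  have hi: "integrable ?I (\<lambda>x. h x * ?G x)" unfolding hG using i by (rule integrable_mult_right)
  have hv: "(LINT x|?I. h x * ?G x) = 2 * \<delta> * A"
  proof -
    have "(LINT x|?I. h x * ?G x) = 2 * \<delta> / A * A\<^sup>2"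
      unfolding hG A2[symmetric] by (rule integral_mult_right_zero)
    also have "\<dots> = 2 * \<delta> * A" using A(2) by (simp add: power2_eq_square)
    finally show ?thesis .
  qed
  have Em: "?e \<in> borel_measurable ?I" and Ei: "integrable ?I (\<lambda>x. (norm (?e x))\<^sup>2)"
    using E by (auto simp: L2_on_def)
  have Gi: "integrable ?I (\<lambda>x. (norm (?\<omega> x * ?G x))\<^sup>2)" using i by simp
  have \<omega>m: "(\<lambda>x. ?\<omega> x * ?G x) \<in> borel_measurable ?I"
    by (rule measurable_lebesgue_on_of_borel) measurable
  have G2i: "integrable (lebesgue_on {2..3}) (\<lambda>x. (norm (?G x))\<^sup>2)"
  proof (rule integrable_lebesgue_on_bounded)
    show "\<bar>(norm (?G x))\<^sup>2\<bar> \<le> B\<^sup>2" for x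
      using power_mono[OF B[of x] abs_ge_zero, of 2] by simp
  qed measurable
  note dual = exterior_solution_duality[OF s f sol \<phi>]
  \<comment> \<open>At the endpoints both weights are \<open>0\<close> and do not cancel.\<close>
  have ends: "AE x in ?I. x \<in> {-1<..<1}"
  proof -
    have "AE x in lebesgue. x \<noteq> -1 \<and> x \<noteq> (1::real)"
      by (intro AE_completion AE_conjI AE_lborel_singleton)
    then have "AE x in lebesgue. x \<in> {-1..1} \<longrightarrow> x \<in> {-1<..<1::real}"
      by eventually_elim auto
    then show ?thesis by (subst AE_restrict_space_iff) auto
  qed
  have "(LINT x|?I. (h x - w x) * ?G x) = (LINT x|?I. ?e x * (?\<omega> x * ?G x))"
  proof (rule integral_cong_AE)
    show "(\<lambda>x. (h x - w x) * ?G x) \<in> borel_measurable ?I"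
      using hi dual(2) by (simp add: left_diff_distrib)
    show "(\<lambda>x. ?e x * (?\<omega> x * ?G x)) \<in> borel_measurable ?I"
      using Em \<omega>m by (rule borel_measurable_times)
    show "AE x in ?I. (h x - w x) * ?G x = ?e x * (?\<omega> x * ?G x)"
      using ends
    proof eventually_elim
      fix x :: real assume "x \<in> {-1<..<1}"
      then have "0 < 1 - x\<^sup>2" by (simp add: abs_square_less_1 abs_less_iff)
      then have "(1 - x\<^sup>2) powr (- s) * ?\<omega> x = 1" by (simp add: powr_minus)
      then have "((1 - x\<^sup>2) powr (- s) * ?\<omega> x) * ((h x - w x) * ?G x) = (h x - w x) * ?G x" by simp
      then show "(h x - w x) * ?G x = ?e x * (?\<omega> x * ?G x)" by (simp only: mult_ac)
    qed
  qed
  then have "\<bar>LINT x|?I. (h x - w x) * ?G x\<bar> \<le> sqrt (LINT x|?I. (norm (?e x))\<^sup>2) * sqrt (LINT x|?I. (norm (?\<omega> x * ?G x))\<^sup>2)"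
    using Cauchy_Schwarz_integral(2)[OF Em \<omega>m Ei Gi] by simp
  also have "\<dots> \<le> \<delta> * A"
  proof (rule mult_mono)
    show "sqrt (LINT x|?I. (norm (?e x))\<^sup>2) \<le> \<delta>" using En unfolding L2_norm_def .
    show "sqrt (LINT x|?I. (norm (?\<omega> x * ?G x))\<^sup>2) \<le> A" unfolding A(1) L2_norm_def ..
  qed (use \<delta> in auto)
  finally have diff: "\<bar>LINT x|?I. (h x - w x) * ?G x\<bar> \<le> \<delta> * A" .
  have "(LINT x|?I. (h x - w x) * ?G x) = 2 * \<delta> * A - (LINT x|?I. w x * ?G x)"
    using hi dual(2) hv by (simp add: left_diff_distrib)
  with diff have "\<delta> * A \<le> (LINT x|?I. w x * ?G x)" by linarith
  also have "\<dots> = - (LINT x|lebesgue_on {2..3}. f x * ?G x)" by (rule dual(1))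
  also have "\<dots> \<le> norm (LINT x|lebesgue_on {2..3}. f x * ?G x)" by simp
  also have "\<dots> \<le> sqrt (LINT x|lebesgue_on {2..3}. (norm (f x))\<^sup>2) * sqrt (LINT x|lebesgue_on {2..3}. (norm (?G x))\<^sup>2)"
  proof (rule Cauchy_Schwarz_integral(2))
    show "integrable (lebesgue_on {2..3}) (\<lambda>x. (norm (?G x))\<^sup>2)" by (rule G2i)
  qed (use f in \<open>auto simp: L2_on_def intro: measurable_lebesgue_on_of_borel\<close>)
  also have "\<dots> \<le> L2_norm {2..3} f * b"
  proof -
    have b0: "0 \<le> b" using small[of 2] abs_ge_zero[of "?G 2"] by linarith
    have "(LINT x|lebesgue_on {2..3}. (norm (?G x))\<^sup>2) \<le> (LINT x|lebesgue_on {2..3::real}. b\<^sup>2)"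
    proof (rule integral_mono)
      show "integrable (lebesgue_on {2..3}) (\<lambda>x. (norm (?G x))\<^sup>2)" by (rule G2i)
      show "integrable (lebesgue_on {2..3::real}) (\<lambda>_. b\<^sup>2)"
        by (rule integrable_lebesgue_on_bounded[where B = "b\<^sup>2"]) auto
      fix x assume "x \<in> space (lebesgue_on {2..3::real})"
      then have "\<bar>?G x\<bar> \<le> b" by (intro small) simp
      from power_mono[OF this abs_ge_zero, of 2] show "(norm (?G x))\<^sup>2 \<le> b\<^sup>2" by simp
    qed
    also have "\<dots> = b\<^sup>2" by (simp add: measure_restrict_space)
    finally have "sqrt (LINT x|lebesgue_on {2..3}. (norm (?G x))\<^sup>2) \<le> b"
      using b0 by (rule real_le_lsqrt[rotated])
    then show ?thesis unfolding L2_norm_def by (intro mult_left_mono) auto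
  qed
  finally show ?thesis .
qed

text \<open>The iterated derivatives of a bump function.\<close>

lemma oscillating_test_functions:
  shows "\<exists>\<phi>. (\<forall>N. \<phi> N \<in> test_functions {-1<..<1}) \<and> (\<forall>N x. 1 / 2 < \<bar>x\<bar> \<longrightarrow> \<phi> N x = 0) \<and>
    (\<forall>N j. j < N \<longrightarrow> (LBINT x. \<phi> N x * x ^ j) = 0) \<and> (\<forall>N. 0 < (LBINT x. (\<phi> N x)\<^sup>2))"
proof -
  let ?b = "smooth_plateau (- 1 / 2) (1 / 2) 0"
  let ?K = "{- 1 / 2..1 / 2 :: real}"
  have off: "?b x = 0" if "x \<notin> ?K" for x
    using that by (intro smooth_plateau_eq_0) auto
  have "compact ?K \<and> ?K \<subseteq> {-1<..<1} \<and> (\<forall>x. x \<notin> ?K \<longrightarrow> ?b x = 0)" using off by auto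
  then have b: "?b \<in> test_functions {-1<..<1}"
    unfolding test_functions_iff using smooth_plateau_smooth by blast
  let ?\<phi> = "\<lambda>N. (deriv ^^ N) ?b"
  have t: "?\<phi> N \<in> test_functions {-1<..<1}" for N by (rule test_functions_deriv_funpow[OF b])
  have "?\<phi> N x = 0" if "1 / 2 < \<bar>x\<bar>" for N x
  proof (rule deriv_funpow_eq_0_off_closed[OF _ off])
    show "x \<notin> ?K" using that by (auto simp: abs_if split: if_splits)
  qed auto
  moreover have "(LBINT x. ?\<phi> N x * x ^ j) = 0" if "j < N" for N j
    by (rule deriv_funpow_moments_vanish[OF b that])
  moreover have "0 < (LBINT x. (?\<phi> N x)\<^sup>2)" for N
  proof (rule ccontr)
    assume "\<not> 0 < (LBINT x. (?\<phi> N x)\<^sup>2)"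
    moreover have "0 \<le> (LBINT x. (?\<phi> N x)\<^sup>2)" by simp
    ultimately have "(LBINT x. (?\<phi> N x)\<^sup>2) = 0" by linarith
    moreover have i: "integrable lborel (\<lambda>x. (?\<phi> N x)\<^sup>2)"
      by (rule fourier_decaying_integrable(2)[OF test_function_fourier_decaying[OF t]])
    ultimately have "AE x in lborel. (?\<phi> N x)\<^sup>2 = 0"
      by (subst (asm) integral_nonneg_eq_0_iff_AE) auto
    then have "AE x in lborel. x \<in> {x. ?\<phi> N x = 0}" by eventually_elim simp
    moreover have c: "continuous_on UNIV (?\<phi> N)" using t by (auto simp: test_functions_iff smooth_continuous)
    then have "closed {x. ?\<phi> N x = 0}" by (intro closed_Collect_eq continuous_intros)
    ultimately have "{x. ?\<phi> N x = 0} = UNIV"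
      using mem_closed_if_AE_lebesgue[OF _ AE_completion] by blast
    moreover have "?b 0 \<noteq> 0" using smooth_plateau_pos[of 0 "- 1 / 2" "1 / 2" 0] by simp
    ultimately show False using deriv_funpow_test_function_nonzero[OF b, of 0 N] by blast
  qed
  ultimately show ?thesis using t by (intro exI[of _ ?\<phi>]) blast
qed

lemma L1_le_L2_of_half_support:
  assumes \<phi>: "\<phi> \<in> test_functions \<Omega>" and van: "\<And>x. 1 / 2 < \<bar>x\<bar> \<Longrightarrow> \<phi> x = 0"
  shows "(LBINT x. \<bar>\<phi> x\<bar>) \<le> sqrt (LBINT x. (\<phi> x)\<^sup>2)"
proof -
  have [measurable]: "\<phi> \<in> borel_measurable borel" by (rule test_functions_borel[OF \<phi>])
  let ?J = "indicator {- 1 / 2..1 / 2 :: real} :: real \<Rightarrow> real"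
  have J: "(norm (?J x))\<^sup>2 = ?J x" for x by (auto simp: indicator_def)
  have "\<bar>\<phi> x\<bar> = \<bar>\<phi> x\<bar> * ?J x" for x
    using van[of x] by (cases "\<bar>x\<bar> \<le> 1 / 2") (auto simp: indicator_def abs_le_iff)
  then have "(LBINT x. \<bar>\<phi> x\<bar>) = (LBINT x. \<bar>\<phi> x\<bar> * ?J x)"
    by (intro Bochner_Integration.integral_cong refl)
  also have "\<dots> \<le> norm (LBINT x. \<bar>\<phi> x\<bar> * ?J x)" by simp
  also have "\<dots> \<le> sqrt (LBINT x. (norm \<bar>\<phi> x\<bar>)\<^sup>2) * sqrt (LBINT x. (norm (?J x))\<^sup>2)"
  proof (rule Cauchy_Schwarz_integral(2))
    show "integrable lborel (\<lambda>x. (norm \<bar>\<phi> x\<bar>)\<^sup>2)"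
      using fourier_decaying_integrable(2)[OF test_function_fourier_decaying[OF \<phi>]] by simp
    show "integrable lborel (\<lambda>x. (norm (?J x))\<^sup>2)"
      unfolding J by (intro integrable_real_indicator) (auto simp: emeasure_lborel_Icc_eq)
  qed auto
  also have "\<dots> = sqrt (LBINT x. (\<phi> x)\<^sup>2)" unfolding J by simp
  finally show ?thesis .
qed

theorem theorem3:
  fixes s :: real
  assumes "0 < s" and "s < 1"
  shows "\<exists>(h :: nat \<Rightarrow> real \<Rightarrow> real) (C :: real) (c :: real).
    (\<forall>k\<ge>1. L2_on {-1..1} (h k)) \<and> C > 0 \<and> c > 0 \<and>
    (\<forall>k\<ge>1. \<forall>(ht :: real \<Rightarrow> real) (ft :: real \<Rightarrow> real).
       L2_on {-1..1} (\<lambda>x. (1 - x\<^sup>2) powr (- s) * (h k x - ht x)) \<and>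
       L2_norm {-1..1} (\<lambda>x. (1 - x\<^sup>2) powr (- s) * (h k x - ht x)) \<le> 1 / real k \<and>
       L2_on {2..3} ft \<and>
       exterior_value_solution s {-1<..<1} {2..3} ft ht
       \<longrightarrow> L2_norm {2..3} ft \<ge> C * exp (c * real k))"
proof -
  note s = assms
  obtain \<phi> where \<phi>: "\<And>N. \<phi> N \<in> test_functions {-1<..<1}" and van: "\<And>N x. 1 / 2 < \<bar>x\<bar> \<Longrightarrow> \<phi> N x = 0"
    and mom: "\<And>N j. j < N \<Longrightarrow> (LBINT x. \<phi> N x * x ^ j) = 0" and pos: "\<And>N. 0 < (LBINT x. (\<phi> N x)\<^sup>2)"
    using oscillating_test_functions by blast
  obtain D where D: "0 < D" and decay: "\<forall>N \<phi> y. \<phi> \<in> test_functions UNIV \<longrightarrow> (\<forall>x. 1 / 2 < \<bar>x\<bar> \<longrightarrow> \<phi> x = 0) \<longrightarrow>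
      (\<forall>j<N. (LBINT x. \<phi> x * x ^ j) = 0) \<longrightarrow> 2 \<le> y \<longrightarrow>
      \<bar>singular_integral s \<phi> y\<bar> \<le> D * (1 / 2) ^ N * (LBINT x. \<bar>\<phi> x\<bar>)"
    using singular_integral_exponentially_small[OF less_imp_le[OF s(1)]] by blast
  have small: "\<bar>singular_integral s (\<phi> N) y\<bar> \<le> D * (1 / 2) ^ N * (LBINT x. \<bar>\<phi> N x\<bar>)" if "2 \<le> y" for N y
    by (rule decay[rule_format, OF test_functions_mono[OF \<phi> subset_UNIV] van mom that])
  define n where "n = (\<lambda>N. sqrt (LBINT x. (\<phi> N x)\<^sup>2))"
  define A where "A = (\<lambda>N. L2_norm {-1..1} (\<lambda>x. (1 - x\<^sup>2) powr s * singular_integral s (\<phi> N) x))"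
  have n: "0 < n N" for N using pos[of N] by (simp add: n_def)
  have A_ge: "3 / 32 * n N \<le> A N" for N
    unfolding n_def A_def by (rule weighted_norm_lower_bound[OF s \<phi> van])
  have A: "0 < A N" for N using A_ge[of N] n[of N] by linarith
  \<comment> \<open>Twice as many vanishing moments as \<open>k\<close>, so that the exponential gain outweighs the factor \<open>1 / k\<close>.\<close>
  define h where "h = (\<lambda>k x. 2 * (1 / real k) / A (2 * k) * ((1 - x\<^sup>2) powr (2 * s) * singular_integral s (\<phi> (2 * k)) x))"
  have hL: "L2_on {-1..1} (h k)" for k
  proof -
    have Gm [measurable]: "singular_integral s (\<phi> (2 * k)) \<in> borel_measurable borel"
      by (rule singular_integral_measurable[OF test_functions_borel[OF \<phi>]])
    obtain B where B: "\<And>x. \<bar>singular_integral s (\<phi> (2 * k)) x\<bar> \<le> B" using singular_integral_bounded[OF s \<phi>] by blast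
    have hm [measurable]: "h k \<in> borel_measurable borel" unfolding h_def by measurable
    let ?c = "2 * (1 / real k) / A (2 * k)"
    have "\<bar>h k x\<bar> \<le> \<bar>?c\<bar> * (1 * B)" if "x \<in> {-1..1}" for x
    proof -
      have "0 \<le> 1 - x\<^sup>2" using that by (simp add: abs_square_le_1 abs_le_iff)
      then have "(1 - x\<^sup>2) powr (2 * s) \<le> 1" using s by (intro powr_le1) auto
      then show ?thesis
        unfolding h_def abs_mult using B[of x] by (intro mult_left_mono mult_mono) auto
    qed
    then have "\<bar>(norm (h k x))\<^sup>2\<bar> \<le> (\<bar>?c\<bar> * (1 * B))\<^sup>2" if "x \<in> {-1..1}" for x
      using power_mono[of "\<bar>h k x\<bar>" _ 2] that by simp
    then have "integrable (lebesgue_on {-1..1}) (\<lambda>x. (norm (h k x))\<^sup>2)"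
      by (intro integrable_lebesgue_on_bounded) auto
    then show ?thesis unfolding L2_on_def using measurable_lebesgue_on_of_borel[OF hm] by blast
  qed
  have bound: "3 / (32 * D) * exp (ln 2 * real k) \<le> L2_norm {2..3} ft"
    if k: "1 \<le> k" and E: "L2_on {-1..1} (\<lambda>x. (1 - x\<^sup>2) powr (- s) * (h k x - ht x))"
      "L2_norm {-1..1} (\<lambda>x. (1 - x\<^sup>2) powr (- s) * (h k x - ht x)) \<le> 1 / real k"
      and f: "L2_on {2..3} ft" "exterior_value_solution s {-1<..<1} {2..3} ft ht" for k ht ft
  proof -
    let ?N = "2 * k"
    have k0: "0 < 1 / real k" using k by simp
    have sm: "\<bar>singular_integral s (\<phi> ?N) y\<bar> \<le> D * (1 / 4) ^ k * n ?N" if "2 \<le> y" for y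
    proof -
      have "\<bar>singular_integral s (\<phi> ?N) y\<bar> \<le> D * (1 / 2) ^ ?N * (LBINT x. \<bar>\<phi> ?N x\<bar>)"
        by (rule small[OF that])
      also have "\<dots> \<le> D * (1 / 2) ^ ?N * n ?N"
        unfolding n_def using D by (intro mult_left_mono L1_le_L2_of_half_support[OF \<phi> van]) auto
      also have "(1 / 2 :: real) ^ ?N = (1 / 4) ^ k" by (simp add: power_mult power2_eq_square)
      finally show ?thesis .
    qed
    have hk: "h k = (\<lambda>x. 2 * (1 / real k) / A ?N * ((1 - x\<^sup>2) powr (2 * s) * singular_integral s (\<phi> ?N) x))"
      by (simp add: h_def)
    have "1 / real k * A ?N \<le> L2_norm {2..3} ft * (D * (1 / 4) ^ k * n ?N)"
      by (rule control_lower_bound[OF s \<phi> van sm k0 _ A hk E f]) (simp_all add: A_def)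
    moreover have "1 / real k * (3 / 32 * n ?N) \<le> 1 / real k * A ?N"
      using k0 by (intro mult_left_mono A_ge) auto
    ultimately have "n ?N * (3 / 32 * (1 / real k)) \<le> n ?N * (L2_norm {2..3} ft * (D * (1 / 4) ^ k))"
      by (simp add: mult_ac)
    then have *: "3 / 32 * (1 / real k) \<le> L2_norm {2..3} ft * (D * (1 / 4) ^ k)"
      using n[of ?N] by (simp only: mult_le_cancel_left_pos)
    \<comment> \<open>The factor \<open>1 / k\<close> is absorbed by half of the exponential gain \<open>4\<^sup>k\<close>.\<close>
    have "(2::real) ^ k \<le> 4 ^ k * (1 / real k)"
    proof -
      have "real k \<le> 2 ^ k" using less_exp[of k] by (metis less_imp_le of_nat_le_iff of_nat_numeral of_nat_power)
      then have "2 ^ k * real k \<le> 2 ^ k * (2 ^ k :: real)" by (intro mult_left_mono) auto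
      also have "\<dots> = 4 ^ k" by (simp add: power_mult_distrib[symmetric])
      finally show ?thesis using k by (simp add: field_simps)
    qed
    then have "3 / (32 * D) * 2 ^ k \<le> 3 / (32 * D) * (4 ^ k * (1 / real k))"
      using D by (intro mult_left_mono) auto
    also have "\<dots> = (4 ^ k / D) * (3 / 32 * (1 / real k))" by simp
    also have "\<dots> \<le> (4 ^ k / D) * (L2_norm {2..3} ft * (D * (1 / 4) ^ k))"
      using D by (intro mult_left_mono *) auto
    also have "\<dots> = L2_norm {2..3} ft * (4 ^ k * (1 / 4) ^ k)" using D by simp
    also have "(4::real) ^ k * (1 / 4) ^ k = 1" by (simp add: power_mult_distrib[symmetric])
    finally have "3 / (32 * D) * 2 ^ k \<le> L2_norm {2..3} ft" by simp
    moreover have "exp (ln 2 * real k) = 2 ^ k"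
      by (metis exp_ln exp_of_nat_mult mult.commute zero_less_numeral)
    ultimately show ?thesis by simp
  qed
  show ?thesis
  proof (rule exI[of _ h], rule exI[of _ "3 / (32 * D)"], rule exI[of _ "ln 2"], intro conjI allI impI)
    show "0 < 3 / (32 * D)" using D by simp
    show "0 < ln (2::real)" by simp
  qed (use hL bound in auto)
qed

end
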